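(* Let $1<\sigma_0\le\sigma<2$, let $\Omega\subset\mathbb R^n$ be open and bounded, and let $\phi\in\mathcal C^2(\mathbb R^n)$ be convex with $\gamma\le\det(D^2\phi)\le\Gamma$ in $\mathbb R^n$, $0<\gamma\le\Gamma<\infty$. Assume that $\zeta(y)=|y|^{1+\alpha_1}$ belongs to $L^1(\mathbb R^n,\mathcal W_\phi)$ for some $\alpha_1<\sigma_0-1$. For $\lambda\in(0,1]$ let $\phi_\lambda(y)=\lambda^{-2}\phi(\lambda y)$. Suppose there are $\lambda_k\in(0,1]$, $u_k\in\mathcal C(\overline\Omega)\cap L^1(\mathbb R^n,\mathcal W_{\phi_{\lambda_k}})$, $f_k\in L^\infty(\Omega)$ continuous, and $b_k\in L^\infty(\Omega\times\mathbb R^n)$ with values in $[\Lambda^{-1},\Lambda]$ (for a fixed $\Lambda\ge1$), $k\in\mathbb N$, such that: - $\displaystyle\int_{\mathbb R^n}\delta(u_k,x,y)\frac{b_k(x,y)}{v_{\phi_{\lambda_k}}(y)^{\frac{n+\sigma}{2}}}\,dy=f_k(x)$ in the viscosity sense in $\Omega$; - $u_k\to u$ uniformly in $\overline\Omega$ and a.e. in $\mathbb R^n$; - $|u_k(x)|\le 1+\zeta(x)$ in $\mathbb R^n$; - $\lambda_k\to0$; - $f_k\to f$ locally uniformly in $\Omega$; - $b_k\to b$ uniformly in $\Omega\times\mathbb R^n$. Then $$\int_{\mathbb R^n}\delta(u,x,y)\frac{b(x,y)}{v_{\phi_0}(y)^{\frac{n+\sigma}{2}}}\,dy=f(x),\quad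 x\in\Omega,$$ in the viscosity sense, where $\phi_0(y)=\tfrac12 D^2\phi(0)y\cdot y$.
   Context: Notation. $\delta(u,x,y)=u(x+y)+u(x-y)-2u(x)$. For convex $\psi\in\mathcal C^2(\mathbb R^n)$ set $v_\psi(y)=\psi(y)-\psi(0)-D\psi(0)\cdot y$; in particular $v_{\phi_0}=\phi_0$. The weight is $\mathcal W_\psi(y)=\dfrac{1}{1+v_\psi(y)^{\frac{n+\sigma_0}{2}}}$, and $g\in L^1(\mathbb R^n,\mathcal W_\psi)$ means $\int_{\mathbb R^n}|g|\,\mathcal W_\psi\,dy<\infty$. Viscosity solutions. Let $\mathcal I[u(x),x]$ be an integro-differential operator and $f$ bounded and continuous. A function $u:\mathbb R^n\to\mathbb R$, upper semicontinuous in $\overline\Omega$, is a viscosity subsolution in $\Omega$ of $\mathcal I[u(x),x]=f$ if whenever $x_0\in\Omega$, $N\subset\Omega$ is a neighbourhood of $x_0$, and $\varphi\in C^2(\overline N)$ satisfies $\varphi(x_0)=u(x_0)$ and $\varphi(y)>u(y)$ for all $y\in N\setminus\{x_0\}$, then the function $\tau$ equal to $\varphi$ in $N$ and to $u$ in $\mathbb R^n\setminus N$ satisfies $\mathcal I[\tau(x),x](x_0)\ge f(x_0)$. Supersolutions are defined analogously (lower semicontinuous, $\varphi<u$, $\le$), and a solution is both.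
   Formalization: The limit coefficient b is additionally assumed continuous in x in this sense: for every x in Ω, for almost every y, b(·,y) is continuous at x. For coefficients merely bounded and measurable in x, the claim as stated fails. *)

theory Defs
  imports "HOL-Analysis.Analysis"
begin

definition gradient :: "(real^'n \<Rightarrow> real) \<Rightarrow> real^'n \<Rightarrow> real^'n" where
  "gradient f x = (\<chi> i. frechet_derivative f (at x) (axis i 1))"

definition hessian :: "(real^'n \<Rightarrow> real) \<Rightarrow> real^'n \<Rightarrow> real^'n^'n" where
  "hessian f x = jacobian (gradient f) (at x)"

text \<open>For open \<open>N\<close>, \<open>C2_closure N f\<close> says that \<open>f\<close> is in \<open>C\<^sup>2\<close> of the closure of \<open>N\<close>: it is
  \<open>C\<^sup>2\<close> in \<open>N\<close>, and \<open>f\<close> and its first and second derivatives extend continuously up to the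
  boundary (\<open>G\<close> and \<open>H\<close> are the extended gradient and Hessian). \<open>C2_closure UNIV f\<close> is
  \<open>C\<^sup>2\<close> on the whole space.\<close>

definition C2_closure :: "(real^'n) set \<Rightarrow> (real^'n \<Rightarrow> real) \<Rightarrow> bool" where
  "C2_closure N f \<longleftrightarrow>
     continuous_on (closure N) f \<and>
     (\<exists>(G :: real^'n \<Rightarrow> real^'n) (H :: real^'n \<Rightarrow> real^'n^'n).
        continuous_on (closure N) G \<and> continuous_on (closure N) H \<and>
        (\<forall>x\<in>N. (f has_derivative (\<lambda>h. G x \<bullet> h)) (at x) \<and>
               (G has_derivative (\<lambda>h. H x *v h)) (at x)))"

definition second_difference :: "(real^'n \<Rightarrow> real) \<Rightarrow> real^'n \<Rightarrow> real^'n \<Rightarrow> real" where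
  "second_difference u x y = u (x + y) + u (x - y) - 2 * u x"

definition excess :: "(real^'n \<Rightarrow> real) \<Rightarrow> real^'n \<Rightarrow> real" where
  "excess \<psi> y = \<psi> y - \<psi> 0 - gradient \<psi> 0 \<bullet> y"

definition weight :: "real \<Rightarrow> (real^'n \<Rightarrow> real) \<Rightarrow> real^'n \<Rightarrow> real" where
  "weight s \<psi> y = 1 / (1 + excess \<psi> y powr ((real CARD('n) + s) / 2))"

definition weighted_L1 :: "real \<Rightarrow> (real^'n \<Rightarrow> real) \<Rightarrow> (real^'n \<Rightarrow> real) \<Rightarrow> bool" where
  "weighted_L1 s \<psi> g \<longleftrightarrow>
     g \<in> borel_measurable lebesgue \<and> integrable lebesgue (\<lambda>y. \<bar>g y\<bar> * weight s \<psi> y)"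

definition rescale :: "(real^'n \<Rightarrow> real) \<Rightarrow> real \<Rightarrow> real^'n \<Rightarrow> real" where
  "rescale \<phi> l y = \<phi> (l *\<^sub>R y) / l\<^sup>2"

definition quadratic_part :: "(real^'n \<Rightarrow> real) \<Rightarrow> real^'n \<Rightarrow> real" where
  "quadratic_part \<phi> y = 1/2 * ((hessian \<phi> 0 *v y) \<bullet> y)"

text \<open>At points where the excess vanishes the quotient is \<open>0\<close> by convention; for the strictly
  convex functions considered here this happens only at \<open>y = 0\<close>, a null set.\<close>

definition nonlocal_kernel ::
  "real \<Rightarrow> (real^'n \<Rightarrow> real) \<Rightarrow> (real^'n \<Rightarrow> real^'n \<Rightarrow> real) \<Rightarrow> real^'n \<Rightarrow> real^'n \<Rightarrow> real" where
  "nonlocal_kernel s \<psi> b x y = b x y / excess \<psi> y powr ((real CARD('n) + s) / 2)"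

text \<open>The operator with kernel \<open>K\<close>. A Lebesgue integral that does not exist has the value \<open>0\<close> in
  HOL, so every (in)equality for the operator below is accompanied by \<open>nonlocal_defined\<close>.\<close>

definition nonlocal_defined ::
  "(real^'n \<Rightarrow> real^'n \<Rightarrow> real) \<Rightarrow> (real^'n \<Rightarrow> real) \<Rightarrow> real^'n \<Rightarrow> bool" where
  "nonlocal_defined K u x \<longleftrightarrow> integrable lebesgue (\<lambda>y. second_difference u x y * K x y)"

definition nonlocal ::
  "(real^'n \<Rightarrow> real^'n \<Rightarrow> real) \<Rightarrow> (real^'n \<Rightarrow> real) \<Rightarrow> real^'n \<Rightarrow> real" where
  "nonlocal K u x = (\<integral>y. second_difference u x y * K x y \<partial>lebesgue)"

definition usc_on :: "(real^'n) set \<Rightarrow> (real^'n \<Rightarrow> real) \<Rightarrow> bool" where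
  "usc_on S u \<longleftrightarrow> (\<forall>x\<in>S. \<forall>a>u x. \<forall>\<^sub>F y in at x within S. u y < a)"

definition lsc_on :: "(real^'n) set \<Rightarrow> (real^'n \<Rightarrow> real) \<Rightarrow> bool" where
  "lsc_on S u \<longleftrightarrow> (\<forall>x\<in>S. \<forall>a<u x. \<forall>\<^sub>F y in at x within S. a < u y)"

definition patch :: "(real^'n) set \<Rightarrow> (real^'n \<Rightarrow> real) \<Rightarrow> (real^'n \<Rightarrow> real) \<Rightarrow> real^'n \<Rightarrow> real" where
  "patch N \<phi> u y = (if y \<in> N then \<phi> y else u y)"

definition viscosity_subsolution ::
  "(real^'n) set \<Rightarrow> (real^'n \<Rightarrow> real^'n \<Rightarrow> real) \<Rightarrow> (real^'n \<Rightarrow> real) \<Rightarrow> (real^'n \<Rightarrow> real) \<Rightarrow> bool" where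
  "viscosity_subsolution \<Omega> K f u \<longleftrightarrow>
     usc_on (closure \<Omega>) u \<and>
     (\<forall>x0 N \<phi>. x0 \<in> \<Omega> \<longrightarrow> open N \<longrightarrow> x0 \<in> N \<longrightarrow> N \<subseteq> \<Omega> \<longrightarrow> C2_closure N \<phi> \<longrightarrow>
        \<phi> x0 = u x0 \<longrightarrow> (\<forall>y\<in>N - {x0}. \<phi> y > u y) \<longrightarrow>
        nonlocal_defined K (patch N \<phi> u) x0 \<and> nonlocal K (patch N \<phi> u) x0 \<ge> f x0)"

definition viscosity_supersolution ::
  "(real^'n) set \<Rightarrow> (real^'n \<Rightarrow> real^'n \<Rightarrow> real) \<Rightarrow> (real^'n \<Rightarrow> real) \<Rightarrow> (real^'n \<Rightarrow> real) \<Rightarrow> bool" where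
  "viscosity_supersolution \<Omega> K f u \<longleftrightarrow>
     lsc_on (closure \<Omega>) u \<and>
     (\<forall>x0 N \<phi>. x0 \<in> \<Omega> \<longrightarrow> open N \<longrightarrow> x0 \<in> N \<longrightarrow> N \<subseteq> \<Omega> \<longrightarrow> C2_closure N \<phi> \<longrightarrow>
        \<phi> x0 = u x0 \<longrightarrow> (\<forall>y\<in>N - {x0}. \<phi> y < u y) \<longrightarrow>
        nonlocal_defined K (patch N \<phi> u) x0 \<and> nonlocal K (patch N \<phi> u) x0 \<le> f x0)"

definition viscosity_solution ::
  "(real^'n) set \<Rightarrow> (real^'n \<Rightarrow> real^'n \<Rightarrow> real) \<Rightarrow> (real^'n \<Rightarrow> real) \<Rightarrow> (real^'n \<Rightarrow> real) \<Rightarrow> bool" where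
  "viscosity_solution \<Omega> K f u \<longleftrightarrow>
     viscosity_subsolution \<Omega> K f u \<and> viscosity_supersolution \<Omega> K f u"

end

theory Submission
  imports Defs
begin

text \<open>Let \<open>p\<close> touch the limit \<open>u\<close> from above at \<open>x0\<close> on \<open>N\<close>. Adding \<open>\<eta> |z - x0|\<^sup>2\<close> makes the touching
quantitatively strict, so the minimum points \<open>x k\<close> over the closure of \<open>N\<close> of the perturbed test function
minus \<open>u k\<close> converge to \<open>x0\<close>, by the uniform convergence alone. Adding a second paraboloid centred at \<open>x k\<close>
and a constant gives an admissible test function for \<open>u k\<close> at \<open>x k\<close> on the same set \<open>N\<close>; it then remains
to pass to the limit in one integral per \<open>k\<close> and, at the end, to let \<open>\<eta>\<close> tend to \<open>0\<close>, on which the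
operator depends affinely. Supersolutions are reduced to subsolutions by a change of sign
(\<open>viscosity_supersolution_iff_minus\<close>).

The limit of the integrals (\<open>operator_limit\<close>) has two sides. Pointwise, the kernels converge because
\<open>\<lambda>\<^sup>-\<^sup>2 v(\<lambda> y)\<close>, with \<open>v\<close> the excess of the potential, tends to its quadratic part; the functions
themselves are evaluated at the moving points \<open>x k \<plusminus> y\<close>, and since almost everywhere convergence is not
stable under translation, it is recovered along a subsequence from the continuity of translations in
\<open>L\<^sup>1\<close> (\<open>AE_convergence_under_translation\<close>). For domination, the convex function \<open>v\<close> is at least
\<open>c |y|\<^sup>2\<close> near the origin and at least linear far away. Hence the rescaled kernel is bounded by a multiple
of \<open>|y|\<^sup>-\<^sup>n\<^sup>-\<^sup>\<sigma>\<close> on \<open>|y| \<le> r/\<lambda>\<close>, and what is left, where \<open>|y| > r/\<lambda>\<close>, carries the factor \<open>\<lambda>\<^sup>\<sigma>\<^sup>-\<^sup>a\<close> after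
substituting \<open>z = \<lambda> y\<close>, with \<open>a = max (1 + \<alpha>\<^sub>1) 0 < \<sigma>\<close> the growth exponent of the solutions
(\<open>rescaled_kernel_majorant\<close>). So the integrands are bounded by a fixed integrable function plus an error
that vanishes in \<open>L\<^sup>1\<close> (\<open>dominated_convergence_vanishing_error\<close>).

The quadratic lower bound holds because the Hessian at the origin is positive definite: it is
symmetric, nonnegative by convexity and nonsingular by the determinant bound. The tail \<open>|z| > r\<close> of
\<open>(1 + |z|\<^sup>a) v(z)\<^sup>-\<^sup>(\<^sup>n\<^sup>+\<^sup>\<sigma>\<^sup>)\<^sup>/\<^sup>2\<close> must be integrable. For \<open>a > 0\<close> the weight hypothesis contains this. When
\<open>1 + \<alpha>\<^sub>1 < 0\<close> it says nothing about constants, and the determinant bound enters a second time: the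
sublevel sets satisfy \<open>|{v \<le> t}| \<le> C t\<^sup>n\<^sup>/\<^sup>2\<close> (\<open>sublevel_volume\<close>). An affine image of a ball has volume
comparable to that of the sublevel set and lies in it, the gradient of \<open>v\<close> in the corresponding
coordinates is bounded by a multiple of \<open>t\<close> on a smaller ball, and the volume of its image is the
integral of the determinant.

Joint measurability of \<open>b k\<close> makes the section \<open>b k x\<close> measurable for almost every \<open>x\<close> only, and the
contact points \<open>x k\<close> cannot be chosen. Measurability and integrability are therefore only ever used for
the complete integrands, where the definition of viscosity solutions supplies them.\<close>

section \<open>Translations and dilations of Lebesgue integrals\<close>

lemma
  fixes t :: "'a::euclidean_space" and c :: real
  assumes "c \<noteq> 0"
  shows lebesgue_affine: "lebesgue = density (distr lebesgue lebesgue (\<lambda>x. t + c *\<^sub>R x)) (\<lambda>_. ennreal (\<bar>c\<bar> ^ DIM('a)))"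
    and measurable_lebesgue_affine: "(\<lambda>x. t + c *\<^sub>R x) \<in> lebesgue \<rightarrow>\<^sub>M lebesgue"
proof -
  have eq: "(\<lambda>x. t + (\<Sum>j\<in>Basis. (c * (x \<bullet> j)) *\<^sub>R j)) = (\<lambda>x. t + c *\<^sub>R x)"
    by (simp add: euclidean_representation flip: scaleR_scaleR scaleR_sum_right)
  show "lebesgue = density (distr lebesgue lebesgue (\<lambda>x. t + c *\<^sub>R x)) (\<lambda>_. ennreal (\<bar>c\<bar> ^ DIM('a)))"
    using lebesgue_affine_euclidean[of "\<lambda>_::'a. c" t] assms unfolding eq by simp
  show "(\<lambda>x. t + c *\<^sub>R x) \<in> lebesgue \<rightarrow>\<^sub>M lebesgue"
    using lebesgue_affine_measurable[of "\<lambda>_::'a. c" t] assms unfolding eq by simp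
qed

lemma nn_integral_lebesgue_affine:
  fixes t :: "'a::euclidean_space"
  assumes f: "f \<in> borel_measurable lebesgue" and c: "c \<noteq> 0"
  shows "(\<integral>\<^sup>+x. f x \<partial>lebesgue) = ennreal (\<bar>c\<bar> ^ DIM('a)) * (\<integral>\<^sup>+x. f (t + c *\<^sub>R x) \<partial>lebesgue)"
proof -
  let ?T = "\<lambda>x. t + c *\<^sub>R x"
  have T: "?T \<in> lebesgue \<rightarrow>\<^sub>M lebesgue" using c by (rule measurable_lebesgue_affine)
  have "(\<integral>\<^sup>+x. f x \<partial>lebesgue)
      = (\<integral>\<^sup>+x. f x \<partial>density (distr lebesgue lebesgue ?T) (\<lambda>_. ennreal (\<bar>c\<bar> ^ DIM('a))))"
    using lebesgue_affine[OF c, of t] by (rule arg_cong)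
  also have "\<dots> = ennreal (\<bar>c\<bar> ^ DIM('a)) * (\<integral>\<^sup>+x. f x \<partial>distr lebesgue lebesgue ?T)"
    using f by (subst nn_integral_density) (auto simp: nn_integral_cmult)
  also have "(\<integral>\<^sup>+x. f x \<partial>distr lebesgue lebesgue ?T) = (\<integral>\<^sup>+x. f (?T x) \<partial>lebesgue)"
    using f T by (subst nn_integral_distr) auto
  finally show ?thesis .
qed

lemma AE_lebesgue_affine:
  fixes t :: "'a::euclidean_space"
  assumes P: "AE x in lebesgue. P x" and c: "c \<noteq> 0"
  shows "AE x in lebesgue. P (t + c *\<^sub>R x)"
proof -
  obtain N where N: "{x. \<not> P x} \<subseteq> N" "N \<in> null_sets lebesgue"
    using P by (auto simp: eventually_ae_filter)
  have m: "(\<lambda>x. indicator N (t + c *\<^sub>R x) :: ennreal) \<in> borel_measurable lebesgue"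
    using N by (intro measurable_compose[OF measurable_lebesgue_affine[OF c]]) auto
  have "(\<integral>\<^sup>+x. indicator N x \<partial>lebesgue) = 0" using N(2) by (subst nn_integral_indicator) auto
  then have "(\<integral>\<^sup>+x. indicator N (t + c *\<^sub>R x) \<partial>lebesgue) = (0::ennreal)"
    using nn_integral_lebesgue_affine[of "indicator N" c t] c N by auto
  then have "AE x in lebesgue. indicator N (t + c *\<^sub>R x) = (0::ennreal)"
    using m by (simp add: nn_integral_0_iff_AE)
  then show ?thesis
    by eventually_elim (use N(1) in \<open>auto simp: indicator_def split: if_splits\<close>)
qed

lemma
  fixes t :: "'a::euclidean_space" and f :: "'a \<Rightarrow> real"
  assumes f: "integrable lebesgue f" and c: "c \<noteq> 0"
  shows integrable_lebesgue_affine: "integrable lebesgue (\<lambda>x. f (t + c *\<^sub>R x))"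
    and integral_lebesgue_affine:
      "(\<integral>x. f (t + c *\<^sub>R x) \<partial>lebesgue) = (\<integral>x. f x \<partial>lebesgue) / \<bar>c\<bar> ^ DIM('a)"
proof -
  have m: "(\<lambda>x. f (t + c *\<^sub>R x)) \<in> borel_measurable lebesgue"
    using f by (intro measurable_compose[OF measurable_lebesgue_affine[OF c]]) auto
  have fin: "(\<integral>\<^sup>+x. norm (f x) \<partial>lebesgue) < \<infinity>" using f by (simp add: integrable_iff_bounded)
  have "(\<integral>\<^sup>+x. norm (f x) \<partial>lebesgue)
      = ennreal (\<bar>c\<bar> ^ DIM('a)) * (\<integral>\<^sup>+x. norm (f (t + c *\<^sub>R x)) \<partial>lebesgue)"
    using f by (intro nn_integral_lebesgue_affine c) auto
  then have "(\<integral>\<^sup>+x. norm (f (t + c *\<^sub>R x)) \<partial>lebesgue) < \<infinity>"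
    using fin c by (auto simp: ennreal_mult_less_top)
  then show int: "integrable lebesgue (\<lambda>x. f (t + c *\<^sub>R x))"
    using m by (simp add: integrable_iff_bounded)
  have "(\<integral>x. f x \<partial>lebesgue)
      = (\<integral>x. f x \<partial>density (distr lebesgue lebesgue (\<lambda>x. t + c *\<^sub>R x)) (\<lambda>_. ennreal (\<bar>c\<bar> ^ DIM('a))))"
    using lebesgue_affine[OF c, of t] by (rule arg_cong)
  also have "\<dots> = \<bar>c\<bar> ^ DIM('a) * (\<integral>x. f (t + c *\<^sub>R x) \<partial>lebesgue)"
    using f m by (subst integral_density)
      (auto simp: integral_distr[OF measurable_lebesgue_affine[OF c]])
  finally show "(\<integral>x. f (t + c *\<^sub>R x) \<partial>lebesgue) = (\<integral>x. f x \<partial>lebesgue) / \<bar>c\<bar> ^ DIM('a)"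
    using c by simp
qed

lemma
  fixes t :: "'a::euclidean_space" and f :: "'a \<Rightarrow> real"
  assumes f: "integrable lebesgue f"
  shows integrable_lebesgue_translation: "integrable lebesgue (\<lambda>x. f (t + x))"
    and integral_lebesgue_translation: "(\<integral>x. f (t + x) \<partial>lebesgue) = (\<integral>x. f x \<partial>lebesgue)"
  using integrable_lebesgue_affine[OF f, of 1 t] integral_lebesgue_affine[OF f, of 1 t] by auto

text \<open>Exhaust \<open>A\<close> by balls before approximating from inside by closed sets.\<close>

lemma lmeasurable_inner_compact:
  fixes A :: "'a::euclidean_space set"
  assumes A: "A \<in> lmeasurable" and e: "0 < (e::real)"
  obtains F where "compact F" "F \<subseteq> A" "A - F \<in> lmeasurable" "measure lebesgue (A - F) < e"
proof -
  define B where "B n = A \<inter> cball 0 (real n)" for n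
  have B: "B n \<in> lmeasurable" for n unfolding B_def using A by (intro fmeasurable_Int_fmeasurable) auto
  have UB: "(\<Union>n. B n) = A" by (auto simp: B_def) (metis real_arch_simple)
  have "(\<lambda>n. measure lebesgue (B n)) \<longlonglongrightarrow> measure lebesgue (\<Union>n. B n)"
  proof (rule Lim_measure_incseq)
    show "range B \<subseteq> sets lebesgue" using B by auto
    show "incseq B" by (auto simp: B_def incseq_def)
    show "emeasure lebesgue (\<Union> (range B)) \<noteq> \<infinity>"
      unfolding UB using fmeasurableD2[OF A] by simp
  qed
  moreover note UB
  ultimately have "\<forall>\<^sub>F n in sequentially. measure lebesgue A - e / 2 < measure lebesgue (B n)"
    using e by (intro order_tendstoD(1)) auto
  then obtain n where n: "measure lebesgue A - e / 2 < measure lebesgue (B n)"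
    by (auto simp: eventually_sequentially)
  obtain F where F: "closed F" "F \<subseteq> B n" "B n - F \<in> lmeasurable" "emeasure lebesgue (B n - F) < ennreal (e / 2)"
    using sets_lebesgue_inner_closed[OF fmeasurableD[OF B], of "e / 2" n] e by auto
  have FA: "F \<subseteq> A" using F(2) by (auto simp: B_def)
  have "bounded F" using F(2) by (auto simp: B_def intro: bounded_subset[OF bounded_cball[of 0 "real n"]])
  then have "compact F" using F(1) by (simp add: compact_eq_bounded_closed)
  moreover have "measure lebesgue (B n - F) < e / 2"
    using F(4) e by (simp add: emeasure_eq_measure2[OF F(3)] ennreal_less_iff)
  moreover have "measure lebesgue (A - B n) = measure lebesgue A - measure lebesgue (B n)"
    using A B by (intro measurable_measure_Diff) (auto simp: B_def)
  moreover have "A - F = (A - B n) \<union> (B n - F)" using F(2) by (auto simp: B_def)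
  moreover have AB: "A - B n \<in> lmeasurable" using A B by (intro fmeasurable.Diff) auto
  moreover have "measure lebesgue ((A - B n) \<union> (B n - F)) \<le> measure lebesgue (A - B n) + measure lebesgue (B n - F)"
    using AB F(3) by (intro measure_Un_le) auto
  ultimately show ?thesis
    using n F(3) FA by (intro that[of F]) auto
qed

text \<open>With \<open>F \<subseteq> A \<subseteq> U\<close>, \<open>F\<close> compact and \<open>U\<close> open, a translation shorter than the distance from \<open>F\<close> to the
complement of \<open>U\<close> keeps \<open>F\<close> inside \<open>U\<close>, so the two translates of \<open>A\<close> can differ only where one of
the four translates of \<open>A - F\<close> and \<open>U - A\<close> lies.\<close>

lemma measure_translation_diff_tendsto:
  fixes A :: "'a::euclidean_space set"
  assumes A: "A \<in> lmeasurable" and x: "x \<longlonglongrightarrow> x0"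
  shows "(\<lambda>k. \<integral>y. \<bar>indicator A (x k + y) - indicator A (x0 + y)\<bar> \<partial>lebesgue) \<longlonglongrightarrow> (0::real)"
proof (rule LIMSEQ_I)
  fix e :: real assume "0 < e"
  then have e: "0 < e / 8" by simp
  obtain U where U: "open U" "A \<subseteq> U" "U - A \<in> lmeasurable" "emeasure lebesgue (U - A) < ennreal (e / 8)"
    using sets_lebesgue_outer_open[OF fmeasurableD[OF A] e] .
  obtain F where F: "compact F" "F \<subseteq> A" "A - F \<in> lmeasurable" "measure lebesgue (A - F) < e / 8"
    using lmeasurable_inner_compact[OF A e] .
  have mU: "measure lebesgue (U - A) < e / 8"
    using U(4) e by (simp add: emeasure_eq_measure2[OF U(3)] ennreal_less_iff)
  obtain d where d: "0 < d" "\<And>a b. a \<in> F \<Longrightarrow> b \<notin> U \<Longrightarrow> d \<le> dist a b"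
  proof -
    have "\<exists>d>0. \<forall>a\<in>F. \<forall>b\<in>- U. d \<le> dist a b"
      using F U by (intro separate_compact_closed) auto
    then show ?thesis using that by (metis ComplI)
  qed
  have int: "integrable lebesgue (indicat_real S)" if "S \<in> lmeasurable" for S :: "'a set"
    using that by (auto simp: fmeasurable_def integrable_indicator_iff)
  have val: "(\<integral>y. indicat_real S (z + y) \<partial>lebesgue) = measure lebesgue S" if "S \<in> lmeasurable" for S :: "'a set" and z
    using integral_lebesgue_translation[OF int[OF that], of z] that by simp
  have intz: "integrable lebesgue (\<lambda>y. indicat_real S (z + y))" if "S \<in> lmeasurable" for S :: "'a set" and z
    using integrable_lebesgue_translation[OF int[OF that]] .
  have "\<forall>\<^sub>F k in sequentially. dist (x k) x0 < d" using x d(1) by (rule tendstoD)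
  then obtain K where K: "\<And>k. K \<le> k \<Longrightarrow> dist (x k) x0 < d" by (auto simp: eventually_sequentially)
  have "norm ((\<integral>y. \<bar>indicat_real A (x k + y) - indicator A (x0 + y)\<bar> \<partial>lebesgue) - 0) < e" if "K \<le> k" for k
  proof -
    let ?R = "\<lambda>z y. indicat_real (A - F) (z + y) + indicat_real (U - A) (z + y)"
    have "\<bar>indicat_real A (x k + y) - indicator A (x0 + y)\<bar> \<le> ?R (x k) y + ?R x0 y" for y
    proof -
      have dd: "dist (x k + y) (x0 + y) < d" using K[OF that] by (simp add: dist_norm)
      have 1: "x0 + y \<in> U" if "x k + y \<in> F" using d(2)[OF that, of "x0 + y"] dd by force
      have 2: "x k + y \<in> U" if "x0 + y \<in> F" using d(2)[OF that, of "x k + y"] dd by (force simp: dist_commute)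
      show ?thesis using 1 2 F(2) U(2) by (auto simp: indicator_def)
    qed
    then have "(\<integral>y. \<bar>indicat_real A (x k + y) - indicator A (x0 + y)\<bar> \<partial>lebesgue) \<le> (\<integral>y. ?R (x k) y + ?R x0 y \<partial>lebesgue)"
      by (intro integral_mono integrable_abs Bochner_Integration.integrable_diff Bochner_Integration.integrable_add intz A F U) auto
    also have "\<dots> = 2 * measure lebesgue (A - F) + 2 * measure lebesgue (U - A)"
      using F U by (simp add: intz val)
    also have "\<dots> < e" using F(4) mU \<open>0 < e\<close> by linarith
    finally show ?thesis by (simp add: integral_nonneg_AE)
  qed
  then show "\<exists>K. \<forall>k\<ge>K. norm ((\<integral>y. \<bar>indicat_real A (x k + y) - indicator A (x0 + y)\<bar> \<partial>lebesgue) - 0) < e"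
    by blast
qed

lemma L1_continuous_translation:
  fixes f :: "'a::euclidean_space \<Rightarrow> real"
  assumes f: "integrable lebesgue f" and x: "x \<longlonglongrightarrow> x0"
  shows "(\<lambda>k. \<integral>y. \<bar>f (x k + y) - f (x0 + y)\<bar> \<partial>lebesgue) \<longlonglongrightarrow> 0"
  using f
proof (induction rule: integrable_induct)
  case (base A c)
  have "\<bar>indicator A (x k + y) *\<^sub>R c - indicator A (x0 + y) *\<^sub>R c\<bar>
      = \<bar>indicator A (x k + y) - indicator A (x0 + y)\<bar> * \<bar>c\<bar>" for k y
    by (simp add: left_diff_distrib flip: abs_mult)
  moreover have "A \<in> lmeasurable" using base by (auto simp: fmeasurable_def)
  ultimately show ?case
    using tendsto_mult_left_zero[OF measure_translation_diff_tendsto[OF _ x], of A "\<bar>c\<bar>"] by simp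
next
  case (add f g)
  note i = integrable_lebesgue_translation[OF add(1)] integrable_lebesgue_translation[OF add(2)]
  have [intro]: "integrable lebesgue (\<lambda>y. \<bar>f (z + y) - f (z' + y)\<bar>)"
      "integrable lebesgue (\<lambda>y. \<bar>g (z + y) - g (z' + y)\<bar>)"
      "integrable lebesgue (\<lambda>y. \<bar>f (z + y) + g (z + y) - (f (z' + y) + g (z' + y))\<bar>)" for z z'
    by (intro integrable_abs Bochner_Integration.integrable_diff Bochner_Integration.integrable_add i)+
  show ?case
  proof (rule tendsto_sandwich[OF _ _ tendsto_const])
    show "(\<lambda>k. (\<integral>y. \<bar>f (x k + y) - f (x0 + y)\<bar> \<partial>lebesgue) + (\<integral>y. \<bar>g (x k + y) - g (x0 + y)\<bar> \<partial>lebesgue)) \<longlonglongrightarrow> 0"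
      using tendsto_add[OF add(3,4)] by simp
    show "\<forall>\<^sub>F k in sequentially. (\<integral>y. \<bar>f (x k + y) + g (x k + y) - (f (x0 + y) + g (x0 + y))\<bar> \<partial>lebesgue)
       \<le> (\<integral>y. \<bar>f (x k + y) - f (x0 + y)\<bar> \<partial>lebesgue) + (\<integral>y. \<bar>g (x k + y) - g (x0 + y)\<bar> \<partial>lebesgue)"
      by (intro always_eventually allI, subst Bochner_Integration.integral_add[symmetric])
         (auto intro!: integral_mono Bochner_Integration.integrable_add)
  qed (auto intro!: always_eventually integral_nonneg_AE)
next
  case (lim f s)
  have conv: "(\<lambda>i. \<integral>y. \<bar>s i y - f y\<bar> \<partial>lebesgue) \<longlonglongrightarrow> (\<integral>y. 0 \<partial>(lebesgue :: 'a measure))"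
  proof (rule integral_dominated_convergence[where w = "\<lambda>y. 3 * \<bar>f y\<bar>"])
    show "AE y in lebesgue. (\<lambda>i. \<bar>s i y - f y\<bar>) \<longlonglongrightarrow> 0"
    proof (rule AE_I2)
      fix y :: 'a
      show "(\<lambda>i. \<bar>s i y - f y\<bar>) \<longlonglongrightarrow> 0"
        using tendsto_rabs_zero[OF LIM_zero[OF lim(2)[of y]]] by simp
    qed
    show "AE y in lebesgue. norm \<bar>s i y - f y\<bar> \<le> 3 * \<bar>f y\<bar>" for i
    proof (rule AE_I2)
      fix y :: 'a
      show "norm \<bar>s i y - f y\<bar> \<le> 3 * \<bar>f y\<bar>" using lim(3)[of y i] by simp
    qed
  qed (use lim in auto)
  show ?case
  proof (rule LIMSEQ_I)
    fix e :: real assume "0 < e"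
    then obtain i where i: "(\<integral>y. \<bar>s i y - f y\<bar> \<partial>lebesgue) < e / 3"
      using order_tendstoD(2)[OF conv, of "e / 3"] by (auto simp: eventually_sequentially)
    obtain K where K: "\<And>k. K \<le> k \<Longrightarrow> (\<integral>y. \<bar>s i (x k + y) - s i (x0 + y)\<bar> \<partial>lebesgue) < e / 3"
      using order_tendstoD(2)[OF lim(5)[of i], of "e / 3"] \<open>0 < e\<close> by (auto simp: eventually_sequentially)
    have d: "integrable lebesgue (\<lambda>y. \<bar>s i y - f y\<bar>)" using lim by auto
    note i' = integrable_lebesgue_translation[OF lim(1)] integrable_lebesgue_translation[OF lim(4)] integrable_lebesgue_translation[OF d]
    note [intro] = i' integrable_abs[OF Bochner_Integration.integrable_diff] Bochner_Integration.integrable_add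
    have "norm ((\<integral>y. \<bar>f (x k + y) - f (x0 + y)\<bar> \<partial>lebesgue) - 0) < e" if "K \<le> k" for k
    proof -
      have "(\<integral>y. \<bar>f (x k + y) - f (x0 + y)\<bar> \<partial>lebesgue)
          \<le> (\<integral>y. \<bar>s i (x k + y) - f (x k + y)\<bar> + \<bar>s i (x k + y) - s i (x0 + y)\<bar> + \<bar>s i (x0 + y) - f (x0 + y)\<bar> \<partial>lebesgue)"
        by (intro integral_mono) (auto intro!: Bochner_Integration.integrable_add)
      also have "\<dots> = (\<integral>y. \<bar>s i (x k + y) - f (x k + y)\<bar> \<partial>lebesgue)
          + (\<integral>y. \<bar>s i (x k + y) - s i (x0 + y)\<bar> \<partial>lebesgue) + (\<integral>y. \<bar>s i (x0 + y) - f (x0 + y)\<bar> \<partial>lebesgue)"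
        by (simp add: i' )
      also have "\<dots> < e / 3 + e / 3 + e / 3"
        using K[OF that] i by (simp add: integral_lebesgue_translation[OF d])
      finally show ?thesis by (simp add: integral_nonneg_AE)
    qed
    then show "\<exists>K. \<forall>k\<ge>K. norm ((\<integral>y. \<bar>f (x k + y) - f (x0 + y)\<bar> \<partial>lebesgue) - 0) < e" by blast
  qed
qed

section \<open>Integrability of powers from volume bounds\<close>

text \<open>The pieces \<open>A j\<close> may overlap: the integrand is dominated by the sum of the \<open>c j\<close> over all pieces that
contain the point.\<close>

lemma integrable_on_countable_cover:
  fixes F :: "'a \<Rightarrow> real" and A :: "nat \<Rightarrow> 'a set"
  assumes F: "F \<in> borel_measurable M" and A: "\<And>j. A j \<in> sets M" and emA: "\<And>j. emeasure M (A j) \<le> ennreal (m j)"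
    and bound: "\<And>j x. x \<in> A j \<Longrightarrow> \<bar>F x\<bar> \<le> c j" and c: "\<And>j. 0 \<le> c j" and m: "\<And>j. 0 \<le> m j"
    and sum: "summable (\<lambda>j. c j * m j)" and cover: "\<And>x. F x \<noteq> 0 \<Longrightarrow> \<exists>j. x \<in> A j"
  shows "integrable M F"
proof (rule integrableI_bounded[OF F])
  have "(\<integral>\<^sup>+x. ennreal (norm (F x)) \<partial>M) \<le> (\<integral>\<^sup>+x. (\<Sum>j. ennreal (c j) * indicator (A j) x) \<partial>M)"
  proof (rule nn_integral_mono)
    fix x
    show "ennreal (norm (F x)) \<le> (\<Sum>j. ennreal (c j) * indicator (A j) x)"
    proof (cases "F x = 0")
      case False
      then obtain j where j: "x \<in> A j" using cover by blast
      have "ennreal (norm (F x)) \<le> ennreal (c j) * indicator (A j) x"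
        using bound[OF j] j by (simp add: ennreal_leI)
      also have "\<dots> \<le> (\<Sum>j. ennreal (c j) * indicator (A j) x)"
        using sum_le_suminf[of "\<lambda>j. ennreal (c j) * indicator (A j) x" "{j}"] by (simp del: sum_mult_indicator)
      finally show ?thesis .
    qed simp
  qed
  also have "\<dots> = (\<Sum>j. ennreal (c j) * emeasure M (A j))"
    using A by (subst nn_integral_suminf) (auto simp: nn_integral_cmult_indicator)
  also have "\<dots> \<le> (\<Sum>j. ennreal (c j * m j))"
    using emA c m by (intro suminf_le) (auto simp: ennreal_mult intro!: mult_left_mono)
  also have "\<dots> < \<infinity>"
    using sum c m by (subst suminf_ennreal2) auto
  finally show "(\<integral>\<^sup>+x. ennreal (norm (F x)) \<partial>M) < \<infinity>" .
qed

lemma dyadic_interval: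
  fixes z :: real
  assumes "1 \<le> z"
  obtains j :: nat where "2 ^ j \<le> z" "z \<le> 2 ^ Suc j"
proof -
  obtain n where n: "z < 2 ^ n" using real_arch_pow[of 2 z] by auto
  define j where "j = (LEAST n. z \<le> 2 ^ Suc n)"
  have "z \<le> 2 ^ Suc n" using n zero_less_power[of "2::real" n] by (simp, linarith)
  then have up: "z \<le> 2 ^ Suc j"
    unfolding j_def using LeastI[of "\<lambda>n. z \<le> 2 ^ Suc n" n] by blast
  have "2 ^ j \<le> z"
  proof (cases j)
    case (Suc i)
    then have "\<not> z \<le> 2 ^ Suc i"
      using not_less_Least[of i "\<lambda>n. z \<le> 2 ^ Suc n"] by (auto simp: j_def)
    then show ?thesis using Suc by simp
  qed (use assms in simp)
  then show ?thesis using up by (rule that)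
qed

lemma summable_dyadic:
  fixes a b :: real
  assumes "a < 0" shows "summable (\<lambda>j. b * (2 ^ j) powr a)"
proof -
  have "((2::real) ^ j) powr a = (2 powr a) ^ j" for j :: nat
  proof -
    have "((2::real) ^ j) powr a = (2 powr real j) powr a" by (simp add: powr_realpow)
    also have "\<dots> = (2 powr a) powr real j" by (simp only: powr_powr mult.commute)
    also have "\<dots> = (2 powr a) ^ j" by (rule powr_realpow) simp
    finally show ?thesis .
  qed
  then show ?thesis using assms by (auto intro!: summable_mult summable_geometric simp: powr_less_one)
qed

text \<open>Cut the values of \<open>w\<close> into dyadic intervals; the pieces contribute a geometric series of ratio
\<open>2 powr (m - p)\<close>.\<close>

lemma integrable_powr_superlevel:
  fixes w :: "'a \<Rightarrow> real"
  assumes w[measurable]: "w \<in> borel_measurable M" and C: "0 \<le> C" and t0: "0 < t0"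
    and vol: "\<And>t. t0 \<le> t \<Longrightarrow> emeasure M {x \<in> space M. w x \<le> t} \<le> ennreal (C * t powr m)"
    and p: "m < p" "0 < p"
  shows "integrable M (\<lambda>x. if t0 \<le> w x then w x powr (- p) else 0)"
proof -
  define A where "A j = {x \<in> space M. t0 * 2 ^ j \<le> w x \<and> w x \<le> t0 * 2 ^ Suc j}" for j :: nat
  define F where "F x = (if x \<in> space M \<and> t0 \<le> w x then w x powr (- p) else 0)" for x
  have "integrable M F"
  proof (rule integrable_on_countable_cover[where A = A and c = "\<lambda>j. (t0 * 2 ^ j) powr (- p)"
        and m = "\<lambda>j. C * (t0 * 2 ^ Suc j) powr m" ])
    show "F \<in> borel_measurable M" unfolding F_def by measurable
    show "A j \<in> sets M" for j unfolding A_def by measurable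
    show "emeasure M (A j) \<le> ennreal (C * (t0 * 2 ^ Suc j) powr m)" for j
    proof -
      have "emeasure M (A j) \<le> emeasure M {x \<in> space M. w x \<le> t0 * 2 ^ Suc j}"
        by (intro emeasure_mono) (auto simp: A_def)
      also have "\<dots> \<le> ennreal (C * (t0 * 2 ^ Suc j) powr m)"
        using t0 by (intro vol) (simp add: mult_le_cancel_left1 one_le_power del: power_Suc)
      finally show ?thesis .
    qed
    show "\<bar>F x\<bar> \<le> (t0 * 2 ^ j) powr - p" if "x \<in> A j" for j x
      using that t0 p by (auto simp: A_def F_def intro!: powr_mono2')
    have eq: "(t0 * 2 ^ j) powr - p * (C * (t0 * 2 ^ Suc j) powr m)
        = (C * t0 powr (m - p) * 2 powr m) * (2 ^ j) powr (m - p)" for j :: nat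
    proof -
      have "(t0 * 2 ^ Suc j) powr m = 2 powr m * (t0 * 2 ^ j) powr m"
        using t0 powr_mult[of 2 "t0 * 2 ^ j" m] by (simp only: power_Suc mult.left_commute)
      moreover have "(t0 * 2 ^ j) powr - p * (t0 * 2 ^ j) powr m = t0 powr (m - p) * (2 ^ j) powr (m - p)"
        using t0 powr_mult[of t0 "2 ^ j" "m - p"] powr_add[of "t0 * 2 ^ j" "- p" m] by (simp only: uminus_add_conv_diff)
      ultimately show ?thesis by (simp only: mult_ac)
    qed
    show "summable (\<lambda>j. (t0 * 2 ^ j) powr - p * (C * (t0 * 2 ^ Suc j) powr m))"
      unfolding eq by (rule summable_dyadic) (use p(1) in simp)
    show "\<exists>j. x \<in> A j" if "F x \<noteq> 0" for x
    proof -
      have x: "x \<in> space M" "1 \<le> w x / t0" using that t0 by (auto simp: F_def split: if_splits)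
      then obtain j where "2 ^ j \<le> w x / t0" "w x / t0 \<le> 2 ^ Suc j" using dyadic_interval by blast
      then show ?thesis using x t0 by (auto simp: A_def field_simps intro!: exI[of _ j])
    qed
  qed (use C in auto)
  then show ?thesis
    by (rule Bochner_Integration.integrable_cong[THEN iffD1, rotated -1]) (auto simp: F_def)
qed

text \<open>The counterpart near the zeros of \<open>w\<close>. On the zero set itself the integrand vanishes by the convention
\<open>0 powr a = 0\<close>.\<close>

lemma integrable_powr_sublevel:
  fixes w :: "'a \<Rightarrow> real"
  assumes w[measurable]: "w \<in> borel_measurable M" and w0: "\<And>x. x \<in> space M \<Longrightarrow> 0 \<le> w x"
    and C: "0 \<le> C" and t0: "0 < t0"
    and vol: "\<And>t. 0 < t \<Longrightarrow> t \<le> t0 \<Longrightarrow> emeasure M {x \<in> space M. w x \<le> t} \<le> ennreal (C * t powr m)"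
    and p: "p < m" "0 < p"
  shows "integrable M (\<lambda>x. if w x \<le> t0 then w x powr (- p) else 0)"
proof -
  define A where "A j = {x \<in> space M. t0 / 2 ^ Suc j \<le> w x \<and> w x \<le> t0 / 2 ^ j}" for j :: nat
  define F where "F x = (if x \<in> space M \<and> w x \<le> t0 then w x powr (- p) else 0)" for x
  have "integrable M F"
  proof (rule integrable_on_countable_cover[where A = A and c = "\<lambda>j. (t0 / 2 ^ Suc j) powr (- p)"
        and m = "\<lambda>j. C * (t0 / 2 ^ j) powr m" ])
    show "F \<in> borel_measurable M" unfolding F_def by measurable
    show "A j \<in> sets M" for j unfolding A_def by measurable
    show "emeasure M (A j) \<le> ennreal (C * (t0 / 2 ^ j) powr m)" for j
    proof -
      have "emeasure M (A j) \<le> emeasure M {x \<in> space M. w x \<le> t0 / 2 ^ j}"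
        by (intro emeasure_mono) (auto simp: A_def)
      also have "\<dots> \<le> ennreal (C * (t0 / 2 ^ j) powr m)"
        using t0 by (intro vol) (auto simp: divide_le_eq mult_le_cancel_left1)
      finally show ?thesis .
    qed
    show "\<bar>F x\<bar> \<le> (t0 / 2 ^ Suc j) powr - p" if "x \<in> A j" for j x
      using that t0 p by (auto simp: A_def F_def simp del: power_Suc intro!: powr_mono2')
    have eq: "(t0 / 2 ^ Suc j) powr - p * (C * (t0 / 2 ^ j) powr m)
        = (C * t0 powr (m - p) * 2 powr p) * (2 ^ j) powr (p - m)" for j :: nat
    proof -
      have inv: "t0 / 2 ^ Suc j = inverse 2 * (t0 / 2 ^ j)" by (simp add: field_simps)
      have "(t0 / 2 ^ Suc j) powr - p = 2 powr p * (t0 / 2 ^ j) powr - p"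
        unfolding inv powr_mult by (simp only: inverse_powr powr_minus inverse_inverse_eq)
      moreover have "(t0 / 2 ^ j) powr - p * (t0 / 2 ^ j) powr m = t0 powr (m - p) * (2 ^ j) powr (p - m)"
      proof -
        have "(t0 / 2 ^ j) powr - p * (t0 / 2 ^ j) powr m = (t0 / 2 ^ j) powr (m - p)"
          using powr_add[of "t0 / 2 ^ j" "- p" m] by (simp only: uminus_add_conv_diff)
        also have "\<dots> = t0 powr (m - p) / (2 ^ j) powr (m - p)" by (rule powr_divide)
        also have "(2 ^ j) powr (m - p) = inverse ((2 ^ j) powr (p - m))"
          using powr_minus[of "(2::real) ^ j" "p - m"] by (simp only: minus_diff_eq)
        finally show ?thesis by (simp only: divide_inverse inverse_inverse_eq)
      qed
      ultimately show ?thesis by (simp only: mult_ac)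
    qed
    show "summable (\<lambda>j. (t0 / 2 ^ Suc j) powr - p * (C * (t0 / 2 ^ j) powr m))"
      unfolding eq by (rule summable_dyadic) (use p(1) in simp)
    show "\<exists>j. x \<in> A j" if "F x \<noteq> 0" for x
    proof -
      have x: "x \<in> space M" "w x \<le> t0" "w x \<noteq> 0" using that by (auto simp: F_def split: if_splits)
      then have "0 < w x" using w0[of x] by simp
      then have "1 \<le> t0 / w x" using x by simp
      then obtain j where "2 ^ j \<le> t0 / w x" "t0 / w x \<le> 2 ^ Suc j" using dyadic_interval by blast
      then show ?thesis using x t0 \<open>0 < w x\<close> by (auto simp: A_def field_simps intro!: exI[of _ j])
    qed
  qed (use C in auto)
  then show ?thesis
    by (rule Bochner_Integration.integrable_cong[THEN iffD1, rotated -1]) (auto simp: F_def)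
qed

lemma emeasure_ball_power:
  fixes t :: real
  assumes "0 \<le> t"
  shows "emeasure lborel {y :: 'a::euclidean_space. norm y \<le> t}
    = ennreal (measure lebesgue (ball (0 :: 'a) 1) * t powr real DIM('a))"
proof -
  have "{y :: 'a. norm y \<le> t} = cball 0 t" by auto
  moreover have "emeasure lborel (cball (0 :: 'a) t) = ennreal (measure lborel (cball (0 :: 'a) t))"
    using emeasure_bounded_finite[OF bounded_cball[of "0 :: 'a" t]] by (intro emeasure_eq_ennreal_measure) auto
  moreover have "measure lborel (cball (0 :: 'a) t) = t powr real DIM('a) * measure lebesgue (ball (0 :: 'a) 1)"
    using content_ball_conv_unit_ball[of t "0 :: 'a"] assms
    by (cases "t = 0") (auto simp: content_cball_conv_ball powr_realpow)
  ultimately show ?thesis by (simp add: mult.commute)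
qed

lemma integrable_norm_powr_outside:
  fixes q \<rho> :: real
  assumes "real DIM('a) < q" "0 < \<rho>"
  shows "integrable lebesgue (\<lambda>y :: 'a::euclidean_space. if \<rho> \<le> norm y then norm y powr (- q) else 0)"
  by (rule integrable_powr_superlevel[where C = "measure lebesgue (ball (0 :: 'a) 1)" and m = "real DIM('a)"])
     (use assms in \<open>auto simp: emeasure_ball_power intro: less_trans[of 0 "real DIM('a)"] measurable_completion\<close>)

lemma integrable_norm_powr_inside:
  fixes q \<rho> :: real
  assumes "q < real DIM('a)" "0 < q" "0 < \<rho>"
  shows "integrable lebesgue (\<lambda>y :: 'a::euclidean_space. if norm y \<le> \<rho> then norm y powr (- q) else 0)"
  by (rule integrable_powr_sublevel[where C = "measure lebesgue (ball (0 :: 'a) 1)" and m = "real DIM('a)"])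
     (use assms in \<open>auto simp: emeasure_ball_power intro: measurable_completion\<close>)

text \<open>A positive weight turns bounded functions into integrable ones and can be divided out again.\<close>

lemma exists_positive_integrable_weight:
  obtains \<omega> :: "'a::euclidean_space \<Rightarrow> real"
  where "integrable lebesgue \<omega>" "continuous_on UNIV \<omega>" "\<And>z. 0 < \<omega> z"
proof
  let ?q = "real DIM('a) + 1"
  let ?\<omega> = "\<lambda>z :: 'a. (1 + norm z) powr (- ?q)"
  show cont: "continuous_on UNIV ?\<omega>"
    by (intro continuous_intros) (metis add_pos_nonneg less_irrefl norm_ge_zero zero_less_one)
  have pos: "0 < 1 + norm z" for z :: 'a by (rule add_pos_nonneg) auto
  show "0 < ?\<omega> z" for z using pos[of z] by simp
  have "integrable lebesgue (indicat_real (cball (0 :: 'a) 1))"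
    using emeasure_bounded_finite[OF bounded_cball[of "0 :: 'a" 1]] by (simp add: integrable_indicator_iff)
  moreover have "integrable lebesgue (\<lambda>y :: 'a. if 1 \<le> norm y then norm y powr (- ?q) else 0)"
    by (rule integrable_norm_powr_outside) auto
  ultimately have "integrable lebesgue (\<lambda>y :: 'a. indicat_real (cball 0 1) y + (if 1 \<le> norm y then norm y powr (- ?q) else 0))"
    by (rule Bochner_Integration.integrable_add)
  then show "integrable lebesgue ?\<omega>"
  proof (rule Bochner_Integration.integrable_bound)
    have "?\<omega> \<in> borel_measurable borel" by (intro borel_measurable_continuous_onI cont)
    then show "?\<omega> \<in> borel_measurable lebesgue" by (simp add: measurable_completion)
    show "AE y in lebesgue. norm (?\<omega> y) \<le> norm (indicat_real (cball 0 1) y + (if 1 \<le> norm y then norm y powr (- ?q) else 0))"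
    proof (rule AE_I2)
      fix y :: 'a
      show "norm (?\<omega> y) \<le> norm (indicat_real (cball 0 1) y + (if 1 \<le> norm y then norm y powr (- ?q) else 0))"
      proof (cases "norm y \<le> 1")
        case True
        have "?\<omega> y \<le> 1 powr (- ?q)" by (rule powr_mono2') auto
        then show ?thesis using True pos[of y] by (auto simp: indicator_def)
      next
        case False
        then have "?\<omega> y \<le> norm y powr (- ?q)" by (intro powr_mono2') auto
        then show ?thesis using False by (auto simp: indicator_def)
      qed
    qed
  qed
qed

section \<open>Limit theorems for integrals and translated functions\<close>

lemma lebesgue_measurable_AE_limit:
  fixes f :: "nat \<Rightarrow> 'a::euclidean_space \<Rightarrow> real"
  assumes f: "\<And>k. f k \<in> borel_measurable lebesgue" and lim: "AE x in lebesgue. (\<lambda>k. f k x) \<longlonglongrightarrow> g x"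
  shows "g \<in> borel_measurable lebesgue"
proof (rule borel_measurable_AE)
  show "(\<lambda>x. lim (\<lambda>k. f k x)) \<in> borel_measurable lebesgue"
    by (rule borel_measurable_lim_metric[OF f])
  show "AE x in lebesgue. lim (\<lambda>k. f k x) = g x"
    using lim by eventually_elim (rule limI)
qed

text \<open>Along a subsequence with \<open>\<integral> e k < 2\<^sup>-\<^sup>k\<close> the sum of all errors is integrable, so adding it to \<open>h\<close> gives a
fixed majorant.\<close>

lemma dominated_convergence_vanishing_error:
  fixes g :: "nat \<Rightarrow> 'a \<Rightarrow> real"
  assumes g: "\<And>k. g k \<in> borel_measurable M" and h: "integrable M h"
    and e: "\<And>k. integrable M (e k)" "\<And>k. AE x in M. 0 \<le> e k x" "(\<lambda>k. \<integral>x. e k x \<partial>M) \<longlonglongrightarrow> 0"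
    and dom: "\<And>k. AE x in M. \<bar>g k x\<bar> \<le> h x + e k x"
    and lim: "AE x in M. (\<lambda>k. g k x) \<longlonglongrightarrow> g' x"
    and g': "g' \<in> borel_measurable M"
  shows "\<exists>s. strict_mono s \<and> integrable M g' \<and> (\<lambda>k. \<integral>x. g (s k) x \<partial>M) \<longlonglongrightarrow> (\<integral>x. g' x \<partial>M)"
proof -
  have "\<exists>s. \<forall>k. True \<and> (s (Suc k) > s k \<and> (\<integral>x. e (s (Suc k)) x \<partial>M) < (1/2)^k)"
  proof (intro dependent_nat_choice)
    fix x k :: nat
    have "\<forall>\<^sub>F n in sequentially. (\<integral>x. e n x \<partial>M) < (1/2)^k"
      using e(3) by (intro order_tendstoD(2)) auto
    with eventually_gt_at_top[of x] have "\<forall>\<^sub>F n in sequentially. x < n \<and> (\<integral>x. e n x \<partial>M) < (1/2)^k"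
      by eventually_elim simp
    then show "\<exists>y. True \<and> x < y \<and> (\<integral>x. e y x \<partial>M) < (1/2)^k"
      by (auto simp: eventually_sequentially)
  qed auto
  then obtain s where s: "\<And>k. s k < s (Suc k)" "\<And>k. (\<integral>x. e (s (Suc k)) x \<partial>M) < (1/2)^k" by blast
  define r where "r k = s (Suc k)" for k
  have r: "strict_mono r" using s(1) by (simp add: r_def strict_mono_Suc_iff)
  have sumint: "summable (\<lambda>k. \<integral>x. norm (e (r k) x) \<partial>M)"
  proof (rule summable_comparison_test'[where N = 0 and g = "\<lambda>k. (1/2::real)^k"])
    fix k
    have "(\<integral>x. norm (e (r k) x) \<partial>M) = (\<integral>x. e (r k) x \<partial>M)"
    proof (rule integral_cong_AE)
      show "AE x in M. norm (e (r k) x) = e (r k) x" using e(2)[of "r k"] by eventually_elim simp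
    qed (use e(1) in auto)
    then show "norm (\<integral>x. norm (e (r k) x) \<partial>M) \<le> (1/2)^k"
      using s(2)[of k] integral_nonneg_AE[OF e(2), of "s (Suc k)"] by (simp add: r_def)
  qed (simp add: summable_geometric)
  have sumae: "AE x in M. summable (\<lambda>k. norm (e (r k) x))"
  proof -
    have "(\<Sum>k. \<integral>\<^sup>+x. ennreal (norm (e (r k) x)) \<partial>M) < \<infinity>"
    proof -
      have "(\<Sum>k. \<integral>\<^sup>+x. ennreal (norm (e (r k) x)) \<partial>M) = (\<Sum>k. ennreal (\<integral>x. norm (e (r k) x) \<partial>M))"
        using e(1) by (intro suminf_cong nn_integral_eq_integral integrable_norm) auto
      also have "\<dots> < \<infinity>" using sumint by (subst suminf_ennreal2) (auto intro: integral_nonneg_AE)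
      finally show ?thesis .
    qed
    then have "(\<integral>\<^sup>+x. (\<Sum>k. ennreal (norm (e (r k) x))) \<partial>M) \<noteq> \<infinity>"
      using e(1) by (subst nn_integral_suminf) auto
    then have "AE x in M. (\<Sum>k. ennreal (norm (e (r k) x))) \<noteq> \<infinity>"
      using e(1) by (intro nn_integral_noteq_infinite) auto
    then show ?thesis
      by eventually_elim (auto intro: summable_suminf_not_top)
  qed
  let ?W = "\<lambda>x. h x + (\<Sum>k. e (r k) x)"
  have W: "integrable M ?W"
    by (intro Bochner_Integration.integrable_add h integrable_suminf e(1) sumae sumint)
  have dom': "AE x in M. norm (g (r k) x) \<le> ?W x" for k
  proof -
    have "AE x in M. \<forall>j. 0 \<le> e j x" using e(2) by (simp add: AE_all_countable)
    with dom[of "r k"] sumae show ?thesis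
    proof eventually_elim
      case (elim x)
      have "e (r k) x \<le> (\<Sum>k. e (r k) x)"
        using elim(2,3) sum_le_suminf[of "\<lambda>k. e (r k) x" "{k}"] by (simp add: summable_norm_cancel)
      then show ?case using elim(1) by simp
    qed
  qed
  have lim': "AE x in M. (\<lambda>k. g (r k) x) \<longlonglongrightarrow> g' x"
    using lim
  proof eventually_elim
    case (elim x)
    from LIMSEQ_subseq_LIMSEQ[OF elim r] show ?case by (simp add: o_def)
  qed
  show ?thesis
    using integral_dominated_convergence[OF g' g W lim' dom'] integrable_dominated_convergence[OF g' g W lim' dom'] r
    by blast
qed

text \<open>Composition with \<open>arctan\<close> and multiplication by an integrable weight bring both sequences into \<open>L\<^sup>1\<close>,
where convergence survives translation by a convergent sequence; a subsequence of an
\<open>L\<^sup>1\<close>-convergent sequence converges almost everywhere, and \<open>tan\<close> undoes \<open>arctan\<close>.\<close>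

lemma AE_convergence_under_translation:
  fixes T :: "nat \<Rightarrow> 'a::euclidean_space \<Rightarrow> real"
  assumes T: "\<And>k. T k \<in> borel_measurable lebesgue" and T': "T' \<in> borel_measurable lebesgue"
    and lim: "AE z in lebesgue. (\<lambda>k. T k z) \<longlonglongrightarrow> T' z" and x: "x \<longlonglongrightarrow> x0"
  shows "\<exists>s. strict_mono s \<and> (AE y in lebesgue. (\<lambda>k. T (s k) (x (s k) + y)) \<longlonglongrightarrow> T' (x0 + y))"
proof -
  obtain \<omega> :: "'a \<Rightarrow> real"
    where \<omega>: "integrable lebesgue \<omega>" "continuous_on UNIV \<omega>" "\<And>z. 0 < \<omega> z"
    using exists_positive_integrable_weight by blast
  define W where "W k z = arctan (T k z) * \<omega> z" for k z
  define W' where "W' z = arctan (T' z) * \<omega> z" for z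
  have le2: "\<bar>arctan a\<bar> \<le> 2" for a
    using arctan_bounded[of a] pi_less_4 by linarith
  have bw: "\<bar>arctan a * \<omega> z\<bar> \<le> 2 * \<omega> z" for a z
    using le2[of a] \<omega>(3)[of z] by (simp add: abs_mult mult_right_mono less_imp_le)
  have mat: "arctan \<in> borel_measurable borel"
    by (intro borel_measurable_continuous_onI continuous_intros)
  have iW: "integrable lebesgue (W k)" for k
    unfolding W_def
    by (rule Bochner_Integration.integrable_bound[of _ "\<lambda>z. 2 * \<omega> z"])
       (use \<omega>(1) T bw measurable_compose[OF T mat] in \<open>auto simp: order_trans[OF bw abs_ge_self]\<close>)
  have iW': "integrable lebesgue W'"
    unfolding W'_def
    by (rule Bochner_Integration.integrable_bound[of _ "\<lambda>z. 2 * \<omega> z"])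
       (use \<omega>(1) T' bw measurable_compose[OF T' mat] in \<open>auto simp: order_trans[OF bw abs_ge_self]\<close>)
  have conv: "(\<lambda>k. \<integral>z. \<bar>W k z - W' z\<bar> \<partial>lebesgue) \<longlonglongrightarrow> (\<integral>z. 0 \<partial>(lebesgue :: 'a measure))"
  proof (rule integral_dominated_convergence[where w = "\<lambda>z. 4 * \<omega> z"])
    show "AE z in lebesgue. (\<lambda>k. \<bar>W k z - W' z\<bar>) \<longlonglongrightarrow> 0"
      using lim unfolding W_def W'_def
      by eventually_elim (intro tendsto_rabs_zero LIM_zero tendsto_intros)
    show "AE z in lebesgue. norm \<bar>W k z - W' z\<bar> \<le> 4 * \<omega> z" for k
    proof (rule AE_I2)
      fix z
      show "norm \<bar>W k z - W' z\<bar> \<le> 4 * \<omega> z"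
        using bw[of "T k z" z] bw[of "T' z" z] unfolding W_def W'_def by simp
    qed
  qed (use iW iW' \<omega>(1) in auto)
  have tr: "integrable lebesgue (\<lambda>y. W k (z + y))" "integrable lebesgue (\<lambda>y. W' (z + y))" for k z
    by (intro integrable_lebesgue_translation iW iW')+
  have "(\<lambda>k. \<integral>y. norm (W k (x k + y) - W' (x0 + y)) \<partial>lebesgue) \<longlonglongrightarrow> 0"
  proof (rule tendsto_sandwich[OF _ _ tendsto_const])
    show "(\<lambda>k. (\<integral>z. \<bar>W k z - W' z\<bar> \<partial>lebesgue) + (\<integral>y. \<bar>W' (x k + y) - W' (x0 + y)\<bar> \<partial>lebesgue)) \<longlonglongrightarrow> 0"
      using tendsto_add[OF conv L1_continuous_translation[OF iW' x]] by simp
    show "\<forall>\<^sub>F k in sequentially. (\<integral>y. norm (W k (x k + y) - W' (x0 + y)) \<partial>lebesgue)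
        \<le> (\<integral>z. \<bar>W k z - W' z\<bar> \<partial>lebesgue) + (\<integral>y. \<bar>W' (x k + y) - W' (x0 + y)\<bar> \<partial>lebesgue)"
    proof (intro always_eventually allI)
      fix k
      have d: "integrable lebesgue (\<lambda>z. \<bar>W k z - W' z\<bar>)" using iW iW' by auto
      have "(\<integral>y. norm (W k (x k + y) - W' (x0 + y)) \<partial>lebesgue)
          \<le> (\<integral>y. \<bar>W k (x k + y) - W' (x k + y)\<bar> + \<bar>W' (x k + y) - W' (x0 + y)\<bar> \<partial>lebesgue)"
        by (intro integral_mono integrable_norm Bochner_Integration.integrable_add integrable_abs Bochner_Integration.integrable_diff tr) auto
      also have "\<dots> = (\<integral>y. \<bar>W k (x k + y) - W' (x k + y)\<bar> \<partial>lebesgue) + (\<integral>y. \<bar>W' (x k + y) - W' (x0 + y)\<bar> \<partial>lebesgue)"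
        by (intro Bochner_Integration.integral_add integrable_abs Bochner_Integration.integrable_diff tr)
      also have "(\<integral>y. \<bar>W k (x k + y) - W' (x k + y)\<bar> \<partial>lebesgue) = (\<integral>z. \<bar>W k z - W' z\<bar> \<partial>lebesgue)"
        using integral_lebesgue_translation[OF d] by simp
      finally show "(\<integral>y. norm (W k (x k + y) - W' (x0 + y)) \<partial>lebesgue)
        \<le> (\<integral>z. \<bar>W k z - W' z\<bar> \<partial>lebesgue) + (\<integral>y. \<bar>W' (x k + y) - W' (x0 + y)\<bar> \<partial>lebesgue)" .
    qed
  qed (auto intro!: always_eventually integral_nonneg_AE)
  from tendsto_L1_AE_subseq[OF _ this] tr
  obtain s where s: "strict_mono s" "AE y in lebesgue. (\<lambda>k. W (s k) (x (s k) + y) - W' (x0 + y)) \<longlonglongrightarrow> 0"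
    by (auto intro: Bochner_Integration.integrable_diff)
  have "AE y in lebesgue. (\<lambda>k. T (s k) (x (s k) + y)) \<longlonglongrightarrow> T' (x0 + y)"
    using s(2)
  proof eventually_elim
    case (elim y)
    have "(\<lambda>k. x (s k) + y) \<longlonglongrightarrow> x0 + y"
      using LIMSEQ_subseq_LIMSEQ[OF x s(1)] by (intro tendsto_intros) (simp add: o_def)
    moreover have "isCont \<omega> (x0 + y)" using \<omega>(2) by (simp add: continuous_on_eq_continuous_at)
    ultimately have "(\<lambda>k. \<omega> (x (s k) + y)) \<longlonglongrightarrow> \<omega> (x0 + y)" by (metis isCont_tendsto_compose)
    then have "(\<lambda>k. W (s k) (x (s k) + y) / \<omega> (x (s k) + y)) \<longlonglongrightarrow> W' (x0 + y) / \<omega> (x0 + y)"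
      using LIM_zero_cancel[OF elim] \<omega>(3)[of "x0 + y"] by (intro tendsto_divide) auto
    then have "(\<lambda>k. arctan (T (s k) (x (s k) + y))) \<longlonglongrightarrow> arctan (T' (x0 + y))"
      using \<omega>(3) by (simp add: W_def W'_def less_imp_neq[symmetric])
    then have "(\<lambda>k. tan (arctan (T (s k) (x (s k) + y)))) \<longlonglongrightarrow> tan (arctan (T' (x0 + y)))"
      by (rule isCont_tendsto_compose[OF isCont_tan[OF cos_arctan_not_zero]])
    then show ?case by (simp add: tan_arctan)
  qed
  then show ?thesis using s(1) by blast
qed

section \<open>Volume of the sublevel sets of a convex function\<close>

lemma convex_gradient_inequality:
  fixes v :: "'a::euclidean_space \<Rightarrow> real"
  assumes "convex_on UNIV v" and "(v has_derivative (\<lambda>h. g \<bullet> h)) (at x)"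
  shows "v x + g \<bullet> (z - x) \<le> v z"
proof -
  define \<psi> where "\<psi> s = v (x + s *\<^sub>R (z - x))" for s :: real
  have "convex_on UNIV \<psi>"
  proof (rule convex_onI)
    fix t a b :: real assume "0 < t" "t < 1"
    have "x + ((1 - t) *\<^sub>R a + t *\<^sub>R b) *\<^sub>R (z - x)
      = (1 - t) *\<^sub>R (x + a *\<^sub>R (z - x)) + t *\<^sub>R (x + b *\<^sub>R (z - x))"
      by (simp add: algebra_simps)
    then show "\<psi> ((1 - t) *\<^sub>R a + t *\<^sub>R b) \<le> (1 - t) * \<psi> a + t * \<psi> b"
      unfolding \<psi>_def using convex_onD[OF assms(1), of t] \<open>0 < t\<close> \<open>t < 1\<close> by simp
  qed simp
  moreover have "(\<psi> has_field_derivative (g \<bullet> (z - x))) (at 0)"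
    unfolding has_field_derivative_def \<psi>_def
    by (rule has_derivative_compose[where g = v and f = "\<lambda>s. x + s *\<^sub>R (z - x)", THEN has_derivative_eq_rhs])
       (auto intro!: derivative_eq_intros assms(2) simp: fun_eq_iff)
  ultimately have "\<psi> 1 - \<psi> 0 \<ge> (g \<bullet> (z - x)) * (1 - 0)"
    by (intro convex_on_imp_above_tangent[where A = UNIV]) auto
  then show ?thesis by (simp add: \<psi>_def)
qed

text \<open>If two points share a gradient \<open>g\<close>, then \<open>v\<close> minus the linear function with slope \<open>g\<close> is minimal at
both, hence on the whole segment between them, so the gradient is constant on the segment and the
Hessian annihilates its direction.\<close>

lemma convex_gradient_inj:
  fixes v :: "real^'n \<Rightarrow> real"
  assumes cv: "convex_on UNIV v"
    and G: "\<And>x. (v has_derivative (\<lambda>h. G x \<bullet> h)) (at x)"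
    and H: "\<And>x. (G has_derivative (\<lambda>h. H x *v h)) (at x)"
    and det: "\<And>x. det (H x) \<noteq> 0"
  shows "inj G"
proof (rule injI)
  fix x y assume eq: "G x = G y"
  define z where "z s = x + s *\<^sub>R (y - x)" for s :: real
  have vy: "v y = v x + G x \<bullet> (y - x)"
    using convex_gradient_inequality[OF cv G, of x y] convex_gradient_inequality[OF cv G, of y x]
    by (simp add: eq inner_diff_right)
  have Gz: "G (z s) = G x" if s: "s \<in> {0..1}" for s
  proof -
    have "z s = (1 - s) *\<^sub>R x + s *\<^sub>R y" by (simp add: z_def algebra_simps)
    then have "v (z s) \<le> (1 - s) * v x + s * v y"
      using convex_onD[OF cv, of s x y] s by simp
    also have "\<dots> = v x + G x \<bullet> (z s - x)"
      by (simp add: vy z_def algebra_simps)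
    finally have vz: "v (z s) \<le> v x + G x \<bullet> (z s - x)" .
    have min: "v (z s) - G x \<bullet> z s \<le> v w - G x \<bullet> w" for w
      using convex_gradient_inequality[OF cv G, of x w] vz by (simp add: inner_diff_right)
    have "((\<lambda>w. v w - G x \<bullet> w) has_derivative (\<lambda>h. G (z s) \<bullet> h - G x \<bullet> h)) (at (z s))"
      by (auto intro!: derivative_eq_intros G)
    from has_derivative_local_min[OF this] min
    have "(\<lambda>h. G (z s) \<bullet> h - G x \<bullet> h) = (\<lambda>h. 0)" by simp
    then have "(G (z s) - G x) \<bullet> (G (z s) - G x) = 0"
      by (metis inner_diff_left)
    then show ?thesis by simp
  qed
  have "((\<lambda>s. G (z s)) has_vector_derivative (H x *v (y - x))) (at 0 within {0..1})"
    unfolding has_vector_derivative_def z_def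
    by (rule has_derivative_at_withinI,
        rule has_derivative_compose[where g = G and f = "\<lambda>s. x + s *\<^sub>R (y - x)", THEN has_derivative_eq_rhs])
       (auto intro!: derivative_eq_intros H simp: fun_eq_iff matrix_vector_mult_scaleR)
  moreover have "((\<lambda>s. G (z s)) has_vector_derivative 0) (at 0 within {0..1})"
    by (rule has_vector_derivative_transform[where f = "\<lambda>_. G x"]) (auto simp: Gz)
  ultimately have "H x *v (y - x) = 0"
    by (intro vector_derivative_unique_within_closed_interval[of 0 1 0]) auto
  moreover have "invertible (H x)" using det by (simp add: invertible_det_nz)
  ultimately have "y - x = 0"
    by (metis matrix_left_invertible_ker invertible_def)
  then show "x = y" by simp
qed

lemma matrix_vector_mult_columns:
  fixes A :: "real^'n^'n" shows "A *v c = (\<Sum>k\<in>UNIV. (c $ k) *\<^sub>R column k A)"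
  by (simp add: matrix_mult_sum scalar_mult_eq_scaleR)

text \<open>An affine normalisation in the spirit of John's ellipsoid, but with parallelepipeds: among the
\<open>n\<close>-tuples of points of \<open>S\<close> take one with largest determinant. By Cramer's rule the coordinates of a
point of \<open>S\<close> are quotients of two such determinants, hence lie in \<open>[-1,1]\<close>.\<close>

lemma exists_maximal_parallelepiped:
  fixes S :: "(real^'n) set"
  assumes "compact S" and "0 < r" "cball 0 r \<subseteq> S"
  obtains A :: "real^'n^'n" where "det A \<noteq> 0" "\<And>k. column k A \<in> S"
    "S \<subseteq> (\<lambda>c. A *v c) ` cbox (- 1) 1"
proof -
  define M where "M = {A :: real^'n^'n. \<forall>k. column k A \<in> S}"
  have eq: "M = (\<Inter>k. (\<lambda>A. column k A) -` S)" by (auto simp: M_def)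
  have col: "continuous_on UNIV (\<lambda>A :: real^'n^'n. column k A)" for k
    unfolding column_def by (intro continuous_intros)
  have "closed M" unfolding eq
    by (intro closed_INT ballI closed_vimage[OF compact_imp_closed[OF assms(1)]] col)
  moreover have "bounded M"
  proof -
    obtain B where B: "\<And>x. x \<in> S \<Longrightarrow> norm x \<le> B"
      using compact_imp_bounded[OF assms(1)] by (auto simp: bounded_iff)
    have "norm A \<le> (\<Sum>i\<in>(UNIV :: 'n set). \<Sum>j\<in>(UNIV :: 'n set). B)" if "A \<in> M" for A
    proof -
      have "\<bar>A $ i $ j\<bar> \<le> B" for i j
      proof -
        have "\<bar>A $ i $ j\<bar> = \<bar>column j A $ i\<bar>" by (simp add: column_def)
        also have "\<dots> \<le> norm (column j A)" by (rule component_le_norm_cart)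
        also have "\<dots> \<le> B" using that B by (auto simp: M_def)
        finally show ?thesis .
      qed
      then have "norm (A $ i) \<le> (\<Sum>j\<in>(UNIV :: 'n set). B)" for i :: 'n
        by (intro order_trans[OF norm_le_l1_cart] sum_mono) auto
      then show ?thesis
        unfolding norm_vec_def[of A] by (intro order_trans[OF L2_set_le_sum] sum_mono) auto
    qed
    then show ?thesis by (auto simp: bounded_iff)
  qed
  ultimately have "compact M" by (simp add: compact_eq_bounded_closed)
  have cdet: "continuous_on M (\<lambda>A. \<bar>det A\<bar>)"
    unfolding det_def by (intro continuous_intros)
  \<comment> \<open>A multiple of the identity matrix is admissible, so the maximal determinant does not vanish.\<close>
  define A0 :: "real^'n^'n" where "A0 = (\<chi> i j. if i = j then r else 0)"
  have "column k A0 = r *\<^sub>R axis k 1" for k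
    by (auto simp: A0_def column_def axis_def vec_eq_iff)
  then have A0: "A0 \<in> M" using assms(2,3) by (auto simp: M_def norm_axis_1)
  have detA0: "det A0 = r ^ CARD('n)"
    by (subst det_diagonal) (auto simp: A0_def)
  obtain A where A: "A \<in> M" and max: "\<And>B. B \<in> M \<Longrightarrow> \<bar>det B\<bar> \<le> \<bar>det A\<bar>"
    using continuous_attains_sup[OF \<open>compact M\<close> _ cdet] A0 by auto
  have dA: "det A \<noteq> 0" using max[OF A0] detA0 zero_less_power[OF assms(2), of "CARD('n)"] by auto
  show ?thesis
  proof
    show "det A \<noteq> 0" by fact
    show "column k A \<in> S" for k using A by (simp add: M_def)
    show "S \<subseteq> (\<lambda>c. A *v c) ` cbox (- 1) 1"
    proof
      fix x assume x: "x \<in> S"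
      define c :: "real^'n" where "c = (\<chi> k. det (\<chi> i j. if j = k then x $ i else A $ i $ j) / det A)"
      have "A *v c = x" using cramer[OF dA] by (simp add: c_def)
      moreover have "\<bar>c $ k\<bar> \<le> 1" for k
      proof -
        have "column j (\<chi> i j. if j = k then x $ i else A $ i $ j) = (if j = k then x else column j A)" for j
          by (simp add: column_def vec_eq_iff)
        then have "(\<chi> i j. if j = k then x $ i else A $ i $ j) \<in> M" using A x by (simp add: M_def)
        from max[OF this] show ?thesis using dA by (simp add: c_def divide_le_eq)
      qed
      then have "c \<in> cbox (- 1) 1" by (auto simp: mem_box_cart abs_le_iff minus_le_iff)
      ultimately show "x \<in> (\<lambda>c. A *v c) ` cbox (- 1) 1" by blast
    qed
  qed
qed

text \<open>Let \<open>A\<close> be the matrix of a maximal parallelepiped for \<open>{v \<le> t}\<close>. It maps the standard simplex, and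
with it a ball of radius \<open>\<rho> = 1/(2n)\<close>, into the sublevel set, because \<open>0\<close> and the columns of \<open>A\<close> belong
to it. On the concentric ball of radius \<open>\<rho>/2\<close> the convex function \<open>v \<circ> A\<close> with values in \<open>[0,t]\<close> has
gradient at most \<open>2t/\<rho>\<close>. The gradient map is injective with Jacobian at least \<open>\<gamma> (det A)\<^sup>2\<close>; comparing
volumes bounds \<open>det A\<close>, and the sublevel set has volume at most \<open>2\<^sup>n |det A|\<close>.\<close>

lemma sublevel_volume_wellorder:
  fixes v :: "real^'n::{finite,wellorder} \<Rightarrow> real"
  assumes cv: "convex_on UNIV v"
    and G: "\<And>x. (v has_derivative (\<lambda>h. G x \<bullet> h)) (at x)"
    and H: "\<And>x. (G has_derivative (\<lambda>h. H x *v h)) (at x)"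
    and \<gamma>: "0 < \<gamma>" "\<And>x. \<gamma> \<le> det (H x)"
    and v0: "v 0 = 0" "\<And>x. 0 \<le> v x"
    and t: "0 < t" and bdd: "bounded {x. v x \<le> t}"
  shows "\<gamma> * (measure lebesgue {x. v x \<le> t})\<^sup>2 \<le> (64 * (real CARD('n))\<^sup>2 * t) ^ CARD('n)"
proof -
  let ?n = "CARD('n)" and ?S = "{x. v x \<le> t}"
  have npos: "0 < real ?n" by simp
  have contv: "continuous_on UNIV v"
    by (meson G has_derivative_continuous continuous_at_imp_continuous_on)
  have cS: "convex ?S"
  proof (rule convexI)
    fix x y and a b :: real assume *: "x \<in> ?S" "y \<in> ?S" "0 \<le> a" "0 \<le> b" "a + b = 1"
    then have a: "a = 1 - b" by simp
    have "v (a *\<^sub>R x + b *\<^sub>R y) \<le> (1 - b) * v x + b * v y"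
      using convex_onD[OF cv, of b x y] * by (simp add: a)
    also have "\<dots> \<le> (1 - b) * t + b * t" using * by (intro add_mono mult_left_mono) auto
    finally show "a *\<^sub>R x + b *\<^sub>R y \<in> ?S" by (simp add: algebra_simps)
  qed
  have "closed ?S" using closed_vimage[of "{..t}" v] contv by (simp add: vimage_def)
  then have comp: "compact ?S" using bdd by (simp add: compact_eq_bounded_closed)
  have "isCont v 0" using contv by (simp add: continuous_on_eq_continuous_at)
  then obtain r where r: "0 < r" "cball 0 r \<subseteq> ?S"
  proof -
    have "\<forall>\<^sub>F x in nhds 0. v x < t"
      using \<open>isCont v 0\<close> t v0(1) by (metis order_tendstoD(2) isCont_def tendsto_at_iff_tendsto_nhds)
    then obtain d where "0 < d" "\<And>x. dist x 0 < d \<Longrightarrow> v x < t"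
      by (auto simp: eventually_nhds_metric)
    then show ?thesis by (intro that[of "d / 2"]) (auto simp: less_imp_le)
  qed
  obtain A :: "((real,'n) vec,'n) vec" where A: "det A \<noteq> 0" "\<And>k. column k A \<in> ?S"
    and SA: "?S \<subseteq> (\<lambda>c. A *v c) ` cbox (- 1) 1"
    using exists_maximal_parallelepiped[OF comp r] by blast
  have mS: "measure lebesgue ?S \<le> 2 ^ ?n * \<bar>det A\<bar>"
  proof -
    have lin: "linear (\<lambda>c. A *v c)" by simp
    have "measure lebesgue ?S \<le> measure lebesgue ((\<lambda>c. A *v c) ` cbox (- 1) 1)"
      using measurable_linear_image[OF lin lmeasurable_cbox, of "-1" 1] lmeasurable_compact[OF comp]
      by (intro measure_mono_fmeasurable SA) auto
    also have "\<dots> = \<bar>det A\<bar> * measure lebesgue (cbox (- 1) (1 :: (real,'n) vec))"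
      using measure_linear_image[OF lin, of "cbox (-1) 1"] by simp
    also have "measure lebesgue (cbox (- 1) (1 :: (real,'n) vec)) = 2 ^ ?n"
      by (simp add: content_cbox_if_cart interval_eq_empty_cart)
    finally show ?thesis by (simp add: mult.commute)
  qed
  \<comment> \<open>The ball of radius \<open>\<rho>\<close> about \<open>c0\<close> lies in the standard simplex, which \<open>A\<close> maps into the sublevel set.\<close>
  define \<rho> where "\<rho> = 1 / (2 * real ?n)"
  define c0 :: "(real,'n) vec" where "c0 = (\<chi> i. \<rho>)"
  have \<rho>: "0 < \<rho>" by (simp add: \<rho>_def)
  have simplex: "v (A *v c) \<le> t" if c: "c \<in> cball c0 \<rho>" for c
  proof -
    have comp_le: "\<bar>c0 $ i - c $ i\<bar> \<le> \<rho>" for i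
      using component_le_norm_cart[of "c0 - c" i] c by (simp add: dist_norm)
    have nonneg: "0 \<le> c $ i" and le: "c $ i \<le> 2 * \<rho>" for i
      using comp_le[of i] by (auto simp: c0_def abs_le_iff)
    have "(\<Sum>i\<in>UNIV. c $ i) \<le> (\<Sum>i\<in>(UNIV::'n set). 2 * \<rho>)" by (intro sum_mono le)
    also have "\<dots> = 1" by (simp add: \<rho>_def)
    finally have sum: "(\<Sum>i\<in>UNIV. c $ i) \<le> 1" .
    \<comment> \<open>The index \<open>None\<close> stands for the vertex \<open>0\<close> of the simplex.\<close>
    define w where "w o' = (case o' of None \<Rightarrow> 1 - (\<Sum>i\<in>UNIV. c $ i) | Some k \<Rightarrow> c $ k)" for o'
    define y where "y o' = (case o' of None \<Rightarrow> 0 | Some k \<Rightarrow> column k A)" for o'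
    have "(\<Sum>o'\<in>UNIV. w o' *\<^sub>R y o') \<in> ?S"
      using sum nonneg A(2) v0(1) t
      by (intro convex_sum[OF _ cS])
         (auto simp: w_def y_def UNIV_option_conv sum.reindex split: option.split)
    also have "(\<Sum>o'\<in>UNIV. w o' *\<^sub>R y o') = (\<Sum>k\<in>UNIV. (c $ k) *\<^sub>R column k A)"
      by (simp add: w_def y_def UNIV_option_conv sum.reindex)
    finally have "(\<Sum>k\<in>UNIV. (c $ k) *\<^sub>R column k A) \<in> ?S" .
    then show ?thesis by (simp add: matrix_vector_mult_columns)
  qed
  \<comment> \<open>The gradient of \<open>v \<circ> A\<close> and its derivative.\<close>
  define \<Phi> where "\<Phi> c = transpose A *v G (A *v c)" for c
  define D where "D c = transpose A ** (H (A *v c) ** A)" for c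
  define B where "B = cball c0 (\<rho> / 2)"
  have der: "(\<Phi> has_derivative (\<lambda>h. D c *v h)) (at c)" for c
    unfolding \<Phi>_def D_def
    by (rule bounded_linear.has_derivative[OF matrix_vector_mul_bounded_linear,
          THEN has_derivative_eq_rhs, OF has_derivative_compose[OF _ H]])
       (auto intro!: bounded_linear_imp_has_derivative simp: matrix_vector_mul_assoc matrix_mul_assoc)
  have "inj \<Phi>"
  proof (rule injI)
    fix x y assume "\<Phi> x = \<Phi> y"
    have "inj ((*v) (transpose A))" and "inj ((*v) A)"
      using A(1) by (auto simp: det_transpose inj_matrix_vector_mult invertible_det_nz)
    then show "x = y"
      using \<open>\<Phi> x = \<Phi> y\<close> convex_gradient_inj[OF cv G H] \<gamma>
      unfolding \<Phi>_def by (metis (no_types, lifting) injD less_le_trans less_irrefl)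
  qed
  have detD: "\<gamma> * (det A)\<^sup>2 \<le> \<bar>det (D c)\<bar>" for c
  proof -
    have "det (D c) = (det A)\<^sup>2 * det (H (A *v c))"
      by (simp add: D_def det_mul det_transpose power2_eq_square)
    moreover have "\<gamma> * (det A)\<^sup>2 \<le> (det A)\<^sup>2 * det (H (A *v c))"
      using \<gamma>(2)[of "A *v c"] by (subst mult.commute) (intro mult_left_mono, auto)
    ultimately show ?thesis by linarith
  qed
  have sub: "\<Phi> ` B \<subseteq> cball 0 (2 * t / \<rho>)"
  proof
    fix p assume "p \<in> \<Phi> ` B"
    then obtain c where c: "dist c0 c \<le> \<rho> / 2" "p = \<Phi> c" by (auto simp: B_def)
    define d where "d = (\<rho> / 2 / norm p) *\<^sub>R p"
    have nd: "norm d \<le> \<rho> / 2" using \<rho> by (simp add: d_def)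
    have "c + d \<in> cball c0 \<rho>"
      using norm_triangle_ineq[of "c - c0" d] c(1) nd
      by (simp add: dist_norm norm_minus_commute algebra_simps)
    then have "v (A *v (c + d)) \<le> t" by (rule simplex)
    moreover have "v (A *v c) + G (A *v c) \<bullet> (A *v d) \<le> v (A *v (c + d))"
      using convex_gradient_inequality[OF cv G, of "A *v c" "A *v (c + d)"]
      by (simp add: matrix_vector_right_distrib)
    moreover have "G (A *v c) \<bullet> (A *v d) = p \<bullet> d"
      by (simp add: c \<Phi>_def dot_lmul_matrix)
    ultimately have "p \<bullet> d \<le> t" using v0(2)[of "A *v c"] by linarith
    moreover have "p \<bullet> d = \<rho> / 2 * norm p"
      by (cases "p = 0") (auto simp: d_def power2_norm_eq_inner[symmetric] power2_eq_square)
    ultimately show "p \<in> cball 0 (2 * t / \<rho>)" using \<rho> by (simp add: field_simps)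
  qed
  have "compact (\<Phi> ` B)" unfolding B_def
    by (intro compact_continuous_image compact_cball continuous_at_imp_continuous_on ballI
         has_derivative_continuous[OF der])
  then have lm: "\<Phi> ` B \<in> lmeasurable" by (rule lmeasurable_compact)
  let ?m = "measure lebesgue (\<Phi> ` B)" and ?\<omega> = "measure lebesgue (ball (0::(real,'n) vec) 1)"
  have "((\<lambda>c. \<bar>det (matrix (\<lambda>h. D c *v h))\<bar>) has_integral ?m) B"
    using has_measure_differentiable_image[of B \<Phi> "\<lambda>c h. D c *v h" ?m] lm \<open>inj \<Phi>\<close>
    by (auto simp: B_def inj_on_def intro: has_derivative_at_withinI der dest: injD)
  then have int: "((\<lambda>c. \<bar>det (D c)\<bar>) has_integral ?m) B" by simp
  have "((\<lambda>c. \<gamma> * (det A)\<^sup>2) has_integral (\<gamma> * (det A)\<^sup>2 * measure lebesgue B)) B"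
  proof -
    have "B \<in> lmeasurable" by (simp add: B_def)
    then show ?thesis
      using has_integral_mult_right[OF integrable_integral[OF integrable_on_const[of B "1::real"]], of "\<gamma> * (det A)\<^sup>2"]
      by (simp only: lmeasure_integral mult_1_right)
  qed
  from has_integral_le[OF this int] detD
  have "\<gamma> * (det A)\<^sup>2 * measure lebesgue B \<le> ?m" by auto
  also have "?m \<le> measure lebesgue (cball (0 :: (real,'n) vec) (2 * t / \<rho>))"
    using lm by (intro measure_mono_fmeasurable sub) auto
  also have "\<dots> = (2 * t / \<rho>) ^ ?n * ?\<omega>"
    using content_ball_conv_unit_ball[of "2 * t / \<rho>" "0 :: (real,'n) vec"] t \<rho> by (simp add: content_cball_conv_ball)
  also have "measure lebesgue B = (\<rho> / 2) ^ ?n * ?\<omega>"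
    using content_ball_conv_unit_ball[of "\<rho> / 2" c0] \<rho> by (simp add: B_def content_cball_conv_ball)
  finally have "\<gamma> * (det A)\<^sup>2 * (\<rho> / 2) ^ ?n * ?\<omega> \<le> (2 * t / \<rho>) ^ ?n * ?\<omega>"
    by (simp add: mult.assoc)
  moreover have "?\<omega> > 0" by simp
  ultimately have "\<gamma> * (det A)\<^sup>2 * (\<rho> / 2) ^ ?n \<le> (2 * t / \<rho>) ^ ?n"
    by (simp only: mult_le_cancel_right_pos)
  then have "\<gamma> * (det A)\<^sup>2 \<le> (2 * t / \<rho>) ^ ?n / (\<rho> / 2) ^ ?n"
    using \<rho> by (simp add: pos_le_divide_eq)
  also have "\<dots> = (16 * (real ?n)\<^sup>2 * t) ^ ?n"
    unfolding power_divide[symmetric] using npos by (simp add: \<rho>_def field_simps power2_eq_square)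
  finally have detA: "\<gamma> * (det A)\<^sup>2 \<le> (16 * (real ?n)\<^sup>2 * t) ^ ?n" .
  have "\<gamma> * (measure lebesgue ?S)\<^sup>2 \<le> \<gamma> * (2 ^ ?n * \<bar>det A\<bar>)\<^sup>2"
    using mS \<gamma>(1) by (intro mult_left_mono power_mono) auto
  also have "\<dots> = 4 ^ ?n * (\<gamma> * (det A)\<^sup>2)"
  proof -
    have "((2::real) ^ ?n)\<^sup>2 = 4 ^ ?n"
      using power_mult[of "2::real" 2 ?n] power_mult[of "2::real" ?n 2] by (simp add: mult.commute)
    then show ?thesis by (simp add: power_mult_distrib)
  qed
  also have "\<dots> \<le> 4 ^ ?n * (16 * (real ?n)\<^sup>2 * t) ^ ?n"
    using detA by (intro mult_left_mono) auto
  also have "\<dots> = (64 * (real ?n)\<^sup>2 * t) ^ ?n"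
    unfolding power_mult_distrib[symmetric] by (simp add: mult.assoc[symmetric])
  finally show ?thesis .
qed

text \<open>The change-of-variables theorem is stated for well-ordered index types. This copy of a finite type has an
order induced by an enumeration; the volume bound is transported to arbitrary index types by renaming
coordinates.\<close>

typedef 'a enumerated = "UNIV :: 'a set" morphisms original enumerate by simp

instance enumerated :: (finite) finite
proof
  have "(UNIV :: 'a enumerated set) = enumerate ` UNIV"
    by (metis UNIV_I original_inverse rangeI subsetI subset_antisym subset_UNIV)
  then show "finite (UNIV :: 'a enumerated set)" by (metis finite finite_imageI)
qed

instantiation enumerated :: (finite) wellorder
begin

definition less_eq_enumerated :: "'a enumerated \<Rightarrow> 'a enumerated \<Rightarrow> bool" where
  "x \<le> y \<longleftrightarrow> to_nat (original x) \<le> to_nat (original y)"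

definition less_enumerated :: "'a enumerated \<Rightarrow> 'a enumerated \<Rightarrow> bool" where
  "x < y \<longleftrightarrow> to_nat (original x) < to_nat (original y)"

instance
proof
  fix P :: "'a enumerated \<Rightarrow> bool" and a :: "'a enumerated"
  assume step: "\<And>x. (\<And>y. y < x \<Longrightarrow> P y) \<Longrightarrow> P x"
  show "P a"
    by (induction a rule: measure_induct_rule[of "\<lambda>x. to_nat (original x)"])
       (rule step, simp add: less_enumerated_def)
qed (auto simp: less_eq_enumerated_def less_enumerated_def original_inject)

end

lemma bij_original: "bij (original :: 'a enumerated \<Rightarrow> 'a)"
  by (intro bijI injI) (auto simp: original_inject, metis UNIV_I enumerate_inverse rangeI)

lemma sign_conjugate:
  fixes q :: "'m::finite \<Rightarrow> 'm" and r :: "'m \<Rightarrow> 'n::finite"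
  assumes q: "q permutes UNIV" and r: "bij r"
  shows "sign (r \<circ> q \<circ> inv r) = sign q"
  using q finite
proof (induction rule: permutes_induct)
  case id
  have "r \<circ> id \<circ> inv r = id" using r by (simp add: fun_eq_iff bij_is_surj surj_f_inv_f)
  then show ?case by (simp add: sign_id)
next
  case (swap a b p)
  have inj: "inj r" and surj: "surj r" using r by (auto simp: bij_def)
  have "r \<circ> (Transposition.transpose a b \<circ> p) \<circ> inv r
      = Transposition.transpose (r a) (r b) \<circ> (r \<circ> p \<circ> inv r)"
    using inj by (auto simp: fun_eq_iff Transposition.transpose_def inj_eq)
  moreover have "permutation (r \<circ> p \<circ> inv r)"
  proof -
    have "bij (r \<circ> p \<circ> inv r)"
      using r swap by (intro bij_comp bij_imp_bij_inv permutes_bij)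
    then show ?thesis by (simp add: permutation)
  qed
  moreover have "permutation p" using swap by (simp add: permutation_permutes) (metis finite)
  ultimately show ?case
    using swap inj by (simp add: sign_compose permutation_swap_id sign_swap_id inj_eq del: comp_apply)
qed

lemma det_reindex:
  fixes A :: "real^'n^'n" and r :: "'m::finite \<Rightarrow> 'n"
  assumes r: "bij r"
  shows "det (\<chi> i j. A $ r i $ r j) = det A"
proof -
  let ?c = "\<lambda>q. r \<circ> q \<circ> inv r"
  have inj: "inj r" and surj: "surj r" using r by (auto simp: bij_def)
  have "det A = (\<Sum>p | p permutes UNIV. of_int (sign p) * (\<Prod>i\<in>UNIV. A $ i $ p i))"
    by (simp add: det_def)
  also have "\<dots> = (\<Sum>q | q permutes UNIV. of_int (sign (?c q)) * (\<Prod>i\<in>UNIV. A $ i $ ?c q i))"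
  proof (rule sum.reindex_bij_witness[symmetric, where i = "\<lambda>p. inv r \<circ> p \<circ> r" and j = ?c])
    show "?c q \<in> {p. p permutes UNIV}" if "q \<in> {q. q permutes UNIV}" for q
    proof -
      have "bij (?c q)" using r that by (intro bij_comp bij_imp_bij_inv) (auto intro: permutes_bij)
      then show ?thesis by (auto intro: bij_imp_permutes)
    qed
    show "inv r \<circ> p \<circ> r \<in> {q. q permutes UNIV}" if "p \<in> {p. p permutes UNIV}" for p
    proof -
      have "bij (inv r \<circ> p \<circ> r)" using r that by (intro bij_comp bij_imp_bij_inv) (auto intro: permutes_bij)
      then show ?thesis by (auto intro: bij_imp_permutes)
    qed
  qed (auto simp: fun_eq_iff inj surj surj_f_inv_f)
  also have "\<dots> = (\<Sum>q | q permutes UNIV. of_int (sign q) * (\<Prod>i\<in>UNIV. A $ r i $ r (q i)))"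
  proof (rule sum.cong)
    fix q :: "'m \<Rightarrow> 'm" assume q: "q \<in> {q. q permutes UNIV}"
    have "(\<Prod>i\<in>UNIV. A $ i $ ?c q i) = (\<Prod>i\<in>UNIV. A $ r i $ r (q i))"
      by (rule prod.reindex_bij_betw[OF r, symmetric, THEN trans]) (simp add: inj)
    then show "of_int (sign (?c q)) * (\<Prod>i\<in>UNIV. A $ i $ ?c q i) = of_int (sign q) * (\<Prod>i\<in>UNIV. A $ r i $ r (q i))"
      using sign_conjugate[OF _ r] q by simp
  qed simp
  finally show ?thesis by (simp add: det_def)
qed

lemma lborel_reindex:
  fixes r :: "'m::finite \<Rightarrow> 'n::finite"
  assumes r: "bij r"
  shows "lborel = distr lborel borel (\<lambda>x :: real^'n. \<chi> j. x $ r j)"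
proof (rule lborel_eqI)
  let ?P = "\<lambda>x :: real^'n. \<chi> j. x $ r j"
  have inj: "inj r" and surj: "surj r" using r by (auto simp: bij_def)
  have [measurable]: "?P \<in> borel_measurable borel"
    by (intro borel_measurable_continuous_onI continuous_intros)
  fix l u :: "real^'m" assume le: "\<And>b. b \<in> Basis \<Longrightarrow> l \<bullet> b \<le> u \<bullet> b"
  have le': "l $ i \<le> u $ i" for i using le[of "axis i 1"] by (simp add: inner_axis axis_in_Basis_iff)
  let ?l = "\<chi> i. l $ inv r i" and ?u = "\<chi> i. u $ inv r i"
  have "?P -` box l u = box ?l ?u"
    using surj inj by (auto simp: mem_box_cart) (metis surj_f_inv_f inv_f_f)+
  then have "emeasure (distr lborel borel ?P) (box l u) = emeasure lborel (box ?l ?u)"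
    by (simp add: emeasure_distr)
  also have "\<dots> = ennreal (\<Prod>i\<in>UNIV. u $ inv r i - l $ inv r i)"
    using le' by (subst emeasure_lborel_box_eq) (auto simp: Basis_vec_def inner_axis prod.UNION_disjoint axis_eq_axis)
  also have "(\<Prod>i\<in>UNIV. u $ inv r i - l $ inv r i) = (\<Prod>j\<in>UNIV. u $ j - l $ j)"
    by (rule prod.reindex_bij_betw[OF bij_imp_bij_inv[OF r]])
  finally show "emeasure (distr lborel borel ?P) (box l u) = (\<Prod>b\<in>Basis. (u - l) \<bullet> b)"
    by (simp add: Basis_vec_def inner_axis prod.UNION_disjoint axis_eq_axis)
qed simp

lemma sublevel_volume:
  fixes v :: "real^'n \<Rightarrow> real"
  assumes cv: "convex_on UNIV v"
    and G: "\<And>x. (v has_derivative (\<lambda>h. G x \<bullet> h)) (at x)"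
    and H: "\<And>x. (G has_derivative (\<lambda>h. H x *v h)) (at x)"
    and \<gamma>: "0 < \<gamma>" "\<And>x. \<gamma> \<le> det (H x)"
    and v0: "v 0 = 0" "\<And>x. 0 \<le> v x"
    and t: "0 < t" and bdd: "bounded {x. v x \<le> t}"
  shows "\<gamma> * (measure lebesgue {x. v x \<le> t})\<^sup>2 \<le> (64 * (real CARD('n))\<^sup>2 * t) ^ CARD('n)"
proof -
  define P :: "real^'n \<Rightarrow> real^('n enumerated)" where "P x = (\<chi> j. x $ original j)" for x
  define Q :: "real^('n enumerated) \<Rightarrow> real^'n" where "Q z = (\<chi> i. z $ enumerate i)" for z
  define H' :: "real^('n enumerated) \<Rightarrow> real^('n enumerated)^('n enumerated)"
    where "H' z = (\<chi> i j. H (Q z) $ original i $ original j)" for z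
  have [simp]: "enumerate (original j) = j" "original (enumerate i) = i" for i :: 'n and j :: "'n enumerated"
    by (simp_all add: original_inverse enumerate_inverse)
  have QP: "Q (P x) = x" for x by (simp add: Q_def P_def)
  have PQ: "P (Q z) = z" for z by (simp add: Q_def P_def)
  have linP: "linear P" and linQ: "linear Q"
    by (auto intro!: linearI simp: P_def Q_def vec_eq_iff)
  note dP = bounded_linear_imp_has_derivative[OF linear_conv_bounded_linear[THEN iffD1, OF linP]]
  note dQ = bounded_linear_imp_has_derivative[OF linear_conv_bounded_linear[THEN iffD1, OF linQ]]
  have reindex: "(\<Sum>i\<in>UNIV. g i) = (\<Sum>j\<in>UNIV. g (original j))" for g :: "'n \<Rightarrow> real"
    by (rule sum.reindex_bij_betw[OF bij_original, symmetric])
  have contv: "continuous_on UNIV v"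
    by (meson G has_derivative_continuous continuous_at_imp_continuous_on)
  have "\<gamma> * (measure lebesgue {z. v (Q z) \<le> t})\<^sup>2
      \<le> (64 * (real CARD('n enumerated))\<^sup>2 * t) ^ CARD('n enumerated)"
  proof (rule sublevel_volume_wellorder[where G = "\<lambda>z. P (G (Q z))" and H = H'])
    show "convex_on UNIV (\<lambda>z. v (Q z))"
      using convex_onD[OF cv]
      by (intro convex_onI) (auto simp: linear_add[OF linQ] linear_scale[OF linQ])
    show "((\<lambda>z. v (Q z)) has_derivative (\<lambda>h. P (G (Q z)) \<bullet> h)) (at z)" for z
      by (rule has_derivative_compose[OF dQ G, THEN has_derivative_eq_rhs])
         (simp add: fun_eq_iff inner_vec_def reindex P_def Q_def)
    show "((\<lambda>z. P (G (Q z))) has_derivative (\<lambda>h. H' z *v h)) (at z)" for z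
      by (rule has_derivative_compose[OF has_derivative_compose[OF dQ H] dP, THEN has_derivative_eq_rhs])
         (simp add: fun_eq_iff vec_eq_iff matrix_vector_mult_def reindex P_def Q_def H'_def)
    show "\<gamma> \<le> det (H' z)" for z
      using \<gamma>(2)[of "Q z"] det_reindex[OF bij_original, of "H (Q z)"] by (simp add: H'_def)
    have "{z. v (Q z) \<le> t} \<subseteq> P ` {x. v x \<le> t}"
      by (force simp: PQ image_iff intro: exI[of _ "Q _"])
    then show "bounded {z. v (Q z) \<le> t}"
      using bounded_linear_image[OF bdd] linP by (metis bounded_subset linear_conv_bounded_linear)
  qed (use \<gamma>(1) v0 t in \<open>auto simp: linear_0[OF linQ]\<close>)
  moreover have "measure lebesgue {z. v (Q z) \<le> t} = measure lebesgue {x. v x \<le> t}"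
  proof -
    have "closed {x. v x \<le> t}" using closed_vimage[of "{..t}" v] contv by (simp add: vimage_def)
    moreover have "closed {z. v (Q z) \<le> t}"
      using closed_vimage[OF \<open>closed {x. v x \<le> t}\<close>, of Q] linQ
      by (simp add: vimage_def linear_continuous_on linear_conv_bounded_linear)
    moreover have "emeasure lborel {z. v (Q z) \<le> t} = emeasure lborel {x. v x \<le> t}"
    proof -
      have [measurable]: "P \<in> borel_measurable borel"
        using linP by (intro borel_measurable_continuous_onI) (simp add: linear_continuous_on linear_conv_bounded_linear)
      have "emeasure lborel {z. v (Q z) \<le> t} = emeasure (distr lborel borel P) {z. v (Q z) \<le> t}"
        using lborel_reindex[OF bij_original] unfolding P_def[abs_def] by (rule arg_cong)
      also have "\<dots> = emeasure lborel (P -` {z. v (Q z) \<le> t})"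
        using \<open>closed {z. v (Q z) \<le> t}\<close> by (simp add: emeasure_distr)
      finally have "emeasure lborel {z. v (Q z) \<le> t} = emeasure lborel (P -` {z. v (Q z) \<le> t})" .
      then show ?thesis by (simp add: vimage_def QP)
    qed
    ultimately show ?thesis by (simp add: measure_def)
  qed
  moreover have "CARD('n enumerated) = CARD('n)"
    using bij_betw_same_card[OF bij_original] .
  ultimately show ?thesis by simp
qed

section \<open>Convex potentials and their quadratic blow-up\<close>

lemma affine_lower_bound_at_0:
  fixes A B c :: real
  assumes "\<And>\<eta>. 0 < \<eta> \<Longrightarrow> c \<le> A + \<eta> * B" shows "c \<le> A"
proof (rule tendsto_le[of "at_right (0::real)" "\<lambda>\<eta>. A + \<eta> * B" _ "\<lambda>_. c"])
  show "((\<lambda>\<eta>. A + \<eta> * B) \<longlongrightarrow> A) (at_right 0)" by (auto intro!: tendsto_eq_intros)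
  show "\<forall>\<^sub>F \<eta> in at_right 0. c \<le> A + \<eta> * B" using assms by (auto simp: eventually_at_filter)
qed auto

lemma C2_closure_derivatives:
  fixes f :: "real^'n \<Rightarrow> real"
  assumes "C2_closure UNIV f"
  shows "(f has_derivative (\<lambda>h. gradient f x \<bullet> h)) (at x)"
    and "(gradient f has_derivative (\<lambda>h. hessian f x *v h)) (at x)"
proof -
  obtain G H where G: "\<And>x. (f has_derivative (\<lambda>h. G x \<bullet> h)) (at x)"
    and H: "\<And>x. (G has_derivative (\<lambda>h. H x *v h)) (at x)"
    using assms by (auto simp: C2_closure_def)
  have gr: "gradient f = G"
  proof
    fix x
    have "frechet_derivative f (at x) = (\<lambda>h. G x \<bullet> h)"
      using frechet_derivative_at[OF G] by simp
    then show "gradient f x = G x" by (simp add: gradient_def vec_eq_iff inner_axis)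
  qed
  then have "hessian f x = H x" for x
    using frechet_derivative_at[OF H[of x], symmetric] by (simp add: hessian_def jacobian_def gr)
  then show "(f has_derivative (\<lambda>h. gradient f x \<bullet> h)) (at x)"
    "(gradient f has_derivative (\<lambda>h. hessian f x *v h)) (at x)"
    using G H by (simp_all add: gr)
qed

lemma gradient_eqI:
  fixes f :: "real^'n \<Rightarrow> real"
  assumes "(f has_derivative (\<lambda>h. g \<bullet> h)) (at x)"
  shows "gradient f x = g"
  using frechet_derivative_at[OF assms, symmetric] by (simp add: gradient_def vec_eq_iff inner_axis)

lemma excess_rescale:
  fixes \<phi> :: "real^'n \<Rightarrow> real"
  assumes "(\<phi> has_derivative (\<lambda>h. gradient \<phi> 0 \<bullet> h)) (at 0)" and l: "0 < l"
  shows "excess (rescale \<phi> l) y = excess \<phi> (l *\<^sub>R y) / l\<^sup>2"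
proof -
  have "((\<lambda>y. \<phi> (l *\<^sub>R y)) has_derivative (\<lambda>h. gradient \<phi> 0 \<bullet> (l *\<^sub>R h))) (at 0)"
    using assms(1) by (intro has_derivative_compose[where g = \<phi> and f = "\<lambda>y. l *\<^sub>R y"]) (auto intro!: derivative_eq_intros)
  from has_derivative_mult_left[OF this, of "1 / l\<^sup>2"]
  have "(rescale \<phi> l has_derivative (\<lambda>h. ((1 / l) *\<^sub>R gradient \<phi> 0) \<bullet> h)) (at 0)"
    using l unfolding rescale_def[abs_def] by (simp add: power2_eq_square)
  then have "gradient (rescale \<phi> l) 0 = (1 / l) *\<^sub>R gradient \<phi> 0" by (rule gradient_eqI)
  then show ?thesis
    using l by (simp add: excess_def rescale_def field_simps power2_eq_square)
qed

lemma excess_quadratic_part: "excess (quadratic_part \<phi>) = quadratic_part \<phi>"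
proof -
  let ?H = "hessian \<phi> 0"
  have lin: "((\<lambda>y. ?H *v y) has_derivative (\<lambda>y. ?H *v y)) (at 0)"
    by (rule bounded_linear_imp_has_derivative[OF matrix_vector_mul_bounded_linear])
  have "((\<lambda>y. 1/2 * ((?H *v y) \<bullet> y)) has_derivative (\<lambda>h. 0 \<bullet> h)) (at 0)"
    by (auto intro!: derivative_eq_intros lin)
  then have "gradient (quadratic_part \<phi>) 0 = 0"
    unfolding quadratic_part_def[abs_def] by (rule gradient_eqI)
  then show ?thesis by (simp add: excess_def fun_eq_iff quadratic_part_def)
qed

locale convex_potential =
  fixes \<phi> :: "real^'n \<Rightarrow> real" and \<gamma> :: real
  assumes C2: "C2_closure UNIV \<phi>" and convex: "convex_on UNIV \<phi>"
    and \<gamma>: "0 < \<gamma>" and det_lower: "\<And>y. \<gamma> \<le> det (hessian \<phi> y)"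
begin

abbreviation "G \<equiv> gradient \<phi>"
abbreviation "H \<equiv> hessian \<phi>"
abbreviation "v \<equiv> excess \<phi>"

lemmas derG = C2_closure_derivatives(1)[OF C2] and derH = C2_closure_derivatives(2)[OF C2]

lemma der_excess: "(v has_derivative (\<lambda>h. (G x - G 0) \<bullet> h)) (at x)"
  unfolding excess_def[abs_def]
  by (auto intro!: derivative_eq_intros derG simp: inner_diff_left)

lemma der_gradient_excess: "((\<lambda>x. G x - G 0) has_derivative (\<lambda>h. H x *v h)) (at x)"
  by (auto intro!: derivative_eq_intros derH)

lemma excess_0 [simp]: "v 0 = 0" by (simp add: excess_def)

lemma excess_nonneg: "0 \<le> v x"
  using convex_gradient_inequality[OF convex derG, of 0 x] by (simp add: excess_def)

lemma convex_excess: "convex_on UNIV v"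
proof (rule convex_onI)
  fix t x y assume t: "0 < (t::real)" "t < 1"
  have "\<phi> ((1 - t) *\<^sub>R x + t *\<^sub>R y) \<le> (1 - t) * \<phi> x + t * \<phi> y"
    using convex_onD[OF convex, of t x y] t by simp
  then show "v ((1 - t) *\<^sub>R x + t *\<^sub>R y) \<le> (1 - t) * v x + t * v y"
    by (simp add: excess_def inner_add_right algebra_simps)
qed simp

lemma continuous_excess: "continuous_on UNIV v"
  by (meson der_excess has_derivative_continuous continuous_at_imp_continuous_on)

lemma excess_ray_derivative:
  "((\<lambda>s. v (s *\<^sub>R y)) has_field_derivative ((G (s *\<^sub>R y) - G 0) \<bullet> y)) (at s)"
  unfolding has_field_derivative_def
  by (rule has_derivative_compose[OF _ der_excess, THEN has_derivative_eq_rhs])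
     (auto intro!: derivative_eq_intros simp: fun_eq_iff)

text \<open>The directional derivative of the gradient at the origin, in a form suitable for blow-up limits.\<close>

lemma gradient_ray_limit: "((\<lambda>s. (1 / s) *\<^sub>R (G (s *\<^sub>R y) - G 0)) \<longlongrightarrow> H 0 *v y) (at_right 0)"
proof -
  have "((\<lambda>s. G (s *\<^sub>R y)) has_derivative (\<lambda>s. s *\<^sub>R (H 0 *v y))) (at 0)"
  proof (rule has_derivative_compose[where f = "\<lambda>s. s *\<^sub>R y" and g = G, THEN has_derivative_eq_rhs])
    show "((\<lambda>s. s *\<^sub>R y) has_derivative (\<lambda>h. h *\<^sub>R y)) (at 0)"
      by (auto intro!: derivative_eq_intros)
    show "(G has_derivative (\<lambda>h. H 0 *v h)) (at (0 *\<^sub>R y))" using derH[of 0] by simp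
  qed (simp add: fun_eq_iff matrix_vector_mult_scaleR)
  then have "((\<lambda>s. G (s *\<^sub>R y)) has_derivative (\<lambda>s. s *\<^sub>R (H 0 *v y))) (at_right 0)"
    by (rule has_derivative_at_withinI)
  then have "((\<lambda>s. (1 / norm (s - 0)) *\<^sub>R (G (s *\<^sub>R y) - (G (0 *\<^sub>R y) + (s - 0) *\<^sub>R (H 0 *v y)))) \<longlongrightarrow> 0) (at_right 0)"
    unfolding has_derivative_within by blast
  then have "((\<lambda>s. (1 / s) *\<^sub>R (G (s *\<^sub>R y) - G 0) - H 0 *v y) \<longlongrightarrow> 0) (at_right 0)"
  proof (rule Lim_transform_eventually)
    show "\<forall>\<^sub>F s in at_right 0. (1 / norm (s - 0)) *\<^sub>R (G (s *\<^sub>R y) - (G (0 *\<^sub>R y) + (s - 0) *\<^sub>R (H 0 *v y)))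
        = (1 / s) *\<^sub>R (G (s *\<^sub>R y) - G 0) - H 0 *v y"
      by (auto simp: eventually_at_filter scaleR_diff_right scaleR_add_right)
  qed
  then show ?thesis by (rule LIM_zero_cancel)
qed

text \<open>The second-order Taylor expansion along a ray, by l'Hopital's rule.\<close>

lemma excess_blow_up: "((\<lambda>s. v (s *\<^sub>R y) / s\<^sup>2) \<longlongrightarrow> quadratic_part \<phi> y) (at_right 0)"
proof (rule lhopital_right_0[where f' = "\<lambda>s. (G (s *\<^sub>R y) - G 0) \<bullet> y" and g' = "\<lambda>s. 2 * s"])
  have "isCont (\<lambda>s. v (s *\<^sub>R y)) 0"
    using DERIV_isCont[OF excess_ray_derivative] .
  then show "((\<lambda>s. v (s *\<^sub>R y)) \<longlongrightarrow> 0) (at_right 0)"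
    by (simp add: isCont_def filterlim_at_split)
  show "((\<lambda>s::real. s\<^sup>2) \<longlongrightarrow> 0) (at_right 0)" by (auto intro!: tendsto_eq_intros)
  show "\<forall>\<^sub>F s::real in at_right 0. s\<^sup>2 \<noteq> 0" by (auto simp: eventually_at_filter)
  show "\<forall>\<^sub>F s::real in at_right 0. 2 * s \<noteq> 0" by (auto simp: eventually_at_filter)
  show "\<forall>\<^sub>F s in at_right 0. ((\<lambda>s. v (s *\<^sub>R y)) has_real_derivative (G (s *\<^sub>R y) - G 0) \<bullet> y) (at s)"
    by (intro always_eventually allI excess_ray_derivative)
  show "\<forall>\<^sub>F s::real in at_right 0. ((\<lambda>s. s\<^sup>2) has_real_derivative 2 * s) (at s)"
    by (intro always_eventually allI) (auto intro!: derivative_eq_intros)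
  have "((\<lambda>s. (1/2) * (((1 / s) *\<^sub>R (G (s *\<^sub>R y) - G 0)) \<bullet> y)) \<longlongrightarrow> 1/2 * ((H 0 *v y) \<bullet> y)) (at_right 0)"
    by (intro tendsto_intros gradient_ray_limit)
  then show "((\<lambda>s. (G (s *\<^sub>R y) - G 0) \<bullet> y / (2 * s)) \<longlongrightarrow> quadratic_part \<phi> y) (at_right 0)"
    by (simp add: quadratic_part_def mult.commute)
qed

lemma quadratic_part_nonneg: "0 \<le> quadratic_part \<phi> y"
  by (rule tendsto_lowerbound[OF excess_blow_up])
     (auto intro!: always_eventually divide_nonneg_nonneg excess_nonneg)

text \<open>The blow-up limit of the gradient inequality for the excess. Since \<open>z - y\<close> is paired with \<open>H 0 *v y\<close>
and not with its symmetrisation, it also encodes that the Hessian at the origin is symmetric.\<close>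

lemma quadratic_part_tangent:
  "quadratic_part \<phi> y + (H 0 *v y) \<bullet> (z - y) \<le> quadratic_part \<phi> z"
proof (rule tendsto_le[OF _ excess_blow_up])
  show "((\<lambda>s. v (s *\<^sub>R y) / s\<^sup>2 + ((1 / s) *\<^sub>R (G (s *\<^sub>R y) - G 0)) \<bullet> (z - y))
      \<longlongrightarrow> quadratic_part \<phi> y + (H 0 *v y) \<bullet> (z - y)) (at_right 0)"
    by (intro tendsto_intros excess_blow_up gradient_ray_limit)
  show "\<forall>\<^sub>F s in at_right 0. v (s *\<^sub>R y) / s\<^sup>2 + ((1 / s) *\<^sub>R (G (s *\<^sub>R y) - G 0)) \<bullet> (z - y) \<le> v (s *\<^sub>R z) / s\<^sup>2"
  proof -
    have "v (s *\<^sub>R y) / s\<^sup>2 + ((1 / s) *\<^sub>R (G (s *\<^sub>R y) - G 0)) \<bullet> (z - y) \<le> v (s *\<^sub>R z) / s\<^sup>2" if "0 < s" for s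
    proof -
      have "v (s *\<^sub>R y) + (G (s *\<^sub>R y) - G 0) \<bullet> (s *\<^sub>R z - s *\<^sub>R y) \<le> v (s *\<^sub>R z)"
        by (rule convex_gradient_inequality[OF convex_excess der_excess])
      then have "(v (s *\<^sub>R y) + s * ((G (s *\<^sub>R y) - G 0) \<bullet> (z - y))) / s\<^sup>2 \<le> v (s *\<^sub>R z) / s\<^sup>2"
        by (intro divide_right_mono) (auto simp: inner_diff_right algebra_simps)
      then show ?thesis using that by (simp add: add_divide_distrib power2_eq_square)
    qed
    then show ?thesis by (auto simp: eventually_at_filter)
  qed
qed simp

lemma quadratic_part_scale: "quadratic_part \<phi> (s *\<^sub>R y) = s\<^sup>2 * quadratic_part \<phi> y"
  by (simp add: quadratic_part_def matrix_vector_mult_scaleR power2_eq_square)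

text \<open>If the nonnegative quadratic form vanishes at \<open>y\<close>, the tangent inequality at \<open>y\<close>, tested with \<open>z = \<eta> (H 0 *v y)\<close> for
small \<open>\<eta>\<close>, forces \<open>H 0 *v y = 0\<close>, which the determinant excludes.\<close>

lemma quadratic_part_pos:
  assumes "y \<noteq> 0" shows "0 < quadratic_part \<phi> y"
proof (rule ccontr)
  assume "\<not> 0 < quadratic_part \<phi> y"
  then have Q0: "quadratic_part \<phi> y = 0" using quadratic_part_nonneg[of y] by simp
  let ?w = "H 0 *v y"
  have Q0': "?w \<bullet> y = 0" using Q0 by (simp add: quadratic_part_def)
  have "?w \<bullet> ?w \<le> \<eta> * quadratic_part \<phi> ?w" if "0 < \<eta>" for \<eta>
  proof -
    have "\<eta> * (?w \<bullet> ?w) \<le> \<eta>\<^sup>2 * quadratic_part \<phi> ?w"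
      using quadratic_part_tangent[of y "\<eta> *\<^sub>R ?w"] Q0 Q0'
      by (simp add: inner_diff_right quadratic_part_scale)
    then show ?thesis using that by (simp add: power2_eq_square mult.assoc)
  qed
  then have "?w \<bullet> ?w \<le> 0"
    by (intro affine_lower_bound_at_0[of "?w \<bullet> ?w" 0 "quadratic_part \<phi> ?w"]) simp
  then have "H 0 *v y = 0" by (metis inner_eq_zero_iff inner_ge_zero order_antisym)
  moreover have "invertible (H 0)"
    using \<gamma> det_lower[of 0] by (simp add: invertible_det_nz)
  ultimately have "y = 0" by (metis matrix_left_invertible_ker invertible_def)
  with assms show False by simp
qed

lemma quadratic_part_coercive:
  obtains c where "0 < c" "\<And>y. c * (norm y)\<^sup>2 \<le> quadratic_part \<phi> y"
proof -
  have cont: "continuous_on (sphere 0 1) (quadratic_part \<phi>)"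
    unfolding quadratic_part_def[abs_def]
    by (intro continuous_intros linear_continuous_on matrix_vector_mul_bounded_linear)
  obtain e :: "real^'n" where e: "norm e = 1" using vector_choose_size[of 1] by auto
  then have "sphere 0 1 \<noteq> ({} :: (real^'n) set)" by auto
  then obtain y0 where y0: "norm y0 = 1" "\<And>y. norm y = 1 \<Longrightarrow> quadratic_part \<phi> y0 \<le> quadratic_part \<phi> y"
    using continuous_attains_inf[OF compact_sphere _ cont] by auto
  have y0nz: "y0 \<noteq> 0" using y0(1) by auto
  show ?thesis
  proof
    show "0 < quadratic_part \<phi> y0" using quadratic_part_pos[OF y0nz] .
    show "quadratic_part \<phi> y0 * (norm y)\<^sup>2 \<le> quadratic_part \<phi> y" for y
    proof (cases "y = 0")
      case False
      have "quadratic_part \<phi> y = (norm y)\<^sup>2 * quadratic_part \<phi> ((1 / norm y) *\<^sub>R y)"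
        using False by (simp add: quadratic_part_scale[symmetric])
      moreover have "quadratic_part \<phi> y0 \<le> quadratic_part \<phi> ((1 / norm y) *\<^sub>R y)"
        using False by (intro y0) simp
      ultimately show ?thesis using mult_left_mono[of _ _ "(norm y)\<^sup>2"] by (metis mult.commute zero_le_power2)
    qed (simp add: quadratic_part_def)
  qed
qed

text \<open>Near the origin, integrate the gradient along rays and absorb the first-order error into the coercive
quadratic part; convexity along rays then propagates the bound to linear growth.\<close>

lemma excess_coercive:
  obtains c r where "0 < c" "0 < r" "\<And>y. norm y \<le> r \<Longrightarrow> c * (norm y)\<^sup>2 \<le> v y"
    "\<And>y. r \<le> norm y \<Longrightarrow> c * r * norm y \<le> v y"
proof -
  obtain c where c: "0 < c" "\<And>y. c * (norm y)\<^sup>2 \<le> quadratic_part \<phi> y"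
    using quadratic_part_coercive by blast
  \<comment> \<open>The error constant is the coercivity constant \<open>c\<close> itself: the quadratic part enters the derivative with factor \<open>2\<close>.\<close>
  have "\<exists>d>0. \<forall>y. norm (y - 0) < d \<longrightarrow> norm (G y - G 0 - H 0 *v (y - 0)) \<le> c * norm (y - 0)"
    using derH[of 0] c(1) unfolding has_derivative_at_alt by blast
  then obtain d where d: "0 < d" "\<And>y. norm y < d \<Longrightarrow> norm (G y - G 0 - H 0 *v y) \<le> c * norm y"
    by auto
  define r where "r = d / 2"
  have r: "0 < r" using d by (simp add: r_def)
  have near: "c / 2 * (norm y)\<^sup>2 \<le> v y" if y: "norm y \<le> r" for y
  proof -
    let ?f = "\<lambda>s. v (s *\<^sub>R y) - c / 2 * (norm y)\<^sup>2 * s\<^sup>2"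
    have "?f 0 \<le> ?f 1"
    proof (rule DERIV_nonneg_imp_nondecreasing[of 0 1 ?f])
      fix s :: real assume s: "0 \<le> s" "s \<le> 1"
      let ?D = "(G (s *\<^sub>R y) - G 0) \<bullet> y - c * (norm y)\<^sup>2 * s"
      have "(?f has_real_derivative ?D) (at s)"
        by (auto intro!: derivative_eq_intros excess_ray_derivative)
      moreover have "0 \<le> ?D"
      proof -
        have "norm (s *\<^sub>R y) < d" 
          using s y d(1) mult_left_le_one_le[of "norm y" s] by (simp add: r_def)
        from d(2)[OF this] have R: "norm (G (s *\<^sub>R y) - G 0 - H 0 *v (s *\<^sub>R y)) \<le> c * (s * norm y)"
          using s by simp
        have "\<bar>(G (s *\<^sub>R y) - G 0 - H 0 *v (s *\<^sub>R y)) \<bullet> y\<bar> \<le> c * (s * norm y) * norm y"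
          by (rule order_trans[OF Cauchy_Schwarz_ineq2 mult_right_mono[OF R]]) simp
        then have "(H 0 *v (s *\<^sub>R y)) \<bullet> y - c * (norm y)\<^sup>2 * s \<le> (G (s *\<^sub>R y) - G 0) \<bullet> y"
          by (simp add: inner_diff_left abs_le_iff power2_eq_square algebra_simps)
        moreover have "(H 0 *v (s *\<^sub>R y)) \<bullet> y = 2 * s * quadratic_part \<phi> y"
          by (simp add: quadratic_part_def matrix_vector_mult_scaleR)
        moreover have "2 * (c * (norm y)\<^sup>2 * s) \<le> 2 * s * quadratic_part \<phi> y"
          using mult_left_mono[OF c(2)[of y], of "2 * s"] s by (simp add: mult_ac)
        ultimately show ?thesis by linarith
      qed
      ultimately show "\<exists>D. (?f has_real_derivative D) (at s) \<and> 0 \<le> D" by blast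
    qed simp
    then show ?thesis by simp
  qed
  show ?thesis
  proof (rule that[of "c / 2" r])
    fix y :: "real^'n" assume y: "r \<le> norm y"
    with r have ny: "0 < norm y" by linarith
    let ?t = "r / norm y"
    have t: "0 \<le> ?t" "?t \<le> 1" using y ny r by auto
    have "c / 2 * r\<^sup>2 \<le> v (?t *\<^sub>R y)"
      using near[of "?t *\<^sub>R y"] ny r by simp
    also have "\<dots> \<le> ?t * v y"
      using convex_onD[OF convex_excess t, of 0 y] by simp
    finally show "c / 2 * r * norm y \<le> v y"
      using ny r by (simp add: field_simps power2_eq_square)
  qed (use c r near in auto)
qed

end

section \<open>Uniform majorants for the rescaled kernels\<close>

lemma twice_half: "2 * (x / 2) = (x::real)"
  by simp

context convex_potential
begin

lemma excess_sublevel_volume: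
  obtains C where "0 \<le> C"
    "\<And>t. 0 < t \<Longrightarrow> emeasure lebesgue {y. v y \<le> t} \<le> ennreal (C * t powr (real CARD('n) / 2))"
proof -
  let ?n = "CARD('n)"
  define C where "C = sqrt ((64 * (real ?n)\<^sup>2) ^ ?n / \<gamma>)"
  obtain c r where c: "0 < c" "0 < r" "\<And>y. r \<le> norm y \<Longrightarrow> c * r * norm y \<le> v y"
    using excess_coercive by metis
  show ?thesis
  proof (rule that[of C])
    show "0 \<le> C" using \<gamma> by (simp add: C_def)
    fix t :: real assume t: "0 < t"
    have "norm y \<le> max r (t / (c * r))" if "v y \<le> t" for y
    proof (cases "r \<le> norm y")
      case True
      then have "c * r * norm y \<le> t" using c(3)[of y] that by simp
      then have "norm y \<le> t / (c * r)" using c(1,2) by (simp add: pos_le_divide_eq mult.commute)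
      then show ?thesis by simp
    qed simp
    then have bdd: "bounded {y. v y \<le> t}" by (auto simp: bounded_iff)
    have "closed {y. v y \<le> t}"
      using closed_vimage[of "{..t}" v] continuous_excess by (simp add: vimage_def)
    then have "compact {y. v y \<le> t}" using bdd by (simp add: compact_eq_bounded_closed)
    then have em: "emeasure lebesgue {y. v y \<le> t} = ennreal (measure lebesgue {y. v y \<le> t})"
      by (intro emeasure_eq_measure2 lmeasurable_compact)
    have "\<gamma> * (measure lebesgue {y. v y \<le> t})\<^sup>2 \<le> (64 * (real ?n)\<^sup>2 * t) ^ ?n"
      by (rule sublevel_volume[OF convex_excess der_excess der_gradient_excess \<gamma> det_lower excess_0 excess_nonneg t bdd])
    then have "(measure lebesgue {y. v y \<le> t})\<^sup>2 \<le> (64 * (real ?n)\<^sup>2) ^ ?n / \<gamma> * t ^ ?n"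
      using \<gamma> by (simp add: pos_le_divide_eq mult.commute power_mult_distrib)
    then have "measure lebesgue {y. v y \<le> t} \<le> sqrt ((64 * (real ?n)\<^sup>2) ^ ?n / \<gamma> * t ^ ?n)"
      by (rule real_le_rsqrt)
    also have "\<dots> = C * sqrt (t ^ ?n)" by (simp only: C_def real_sqrt_mult)
    also have "sqrt (t ^ ?n) = t powr (real ?n / 2)"
      using t by (simp add: powr_half_sqrt[symmetric] powr_powr flip: powr_realpow)
    finally show "emeasure lebesgue {y. v y \<le> t} \<le> ennreal (C * t powr (real ?n / 2))"
      unfolding em by (rule ennreal_leI)
  qed
qed

lemma measurable_excess [measurable]: "v \<in> borel_measurable borel"
  by (rule borel_measurable_continuous_onI[OF continuous_excess])

lemma integrable_excess_tail:
  assumes "real CARD('n) / 2 < p" "0 < t"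
  shows "integrable lebesgue (\<lambda>y. if t \<le> v y then v y powr (- p) else 0)"
proof -
  obtain C where C: "0 \<le> C"
    "\<And>t. 0 < t \<Longrightarrow> emeasure lebesgue {y. v y \<le> t} \<le> ennreal (C * t powr (real CARD('n) / 2))"
    using excess_sublevel_volume by blast
  have "v \<in> borel_measurable lebesgue" by (simp add: measurable_completion)
  moreover have "0 < p" using assms(1) by (simp add: less_trans[of 0 "real CARD('n) / 2"])
  ultimately show ?thesis
    using C assms by (intro integrable_powr_superlevel[where C = C and m = "real CARD('n) / 2"]) auto
qed

text \<open>Away from the origin the power of the excess is bounded by a multiple of the weight, since \<open>s \<le> \<sigma>\<close>.\<close>

lemma integrable_weighted_excess_tail:
  assumes s: "0 < s" "s \<le> \<sigma>" and t: "0 < t"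
    and g: "weighted_L1 s \<phi> g"
  shows "integrable lebesgue (\<lambda>y. if t \<le> v y then \<bar>g y\<bar> * v y powr (- ((real CARD('n) + \<sigma>) / 2)) else 0)"
proof -
  let ?p = "(real CARD('n) + \<sigma>) / 2" and ?q = "(real CARD('n) + s) / 2"
  let ?C = "t powr (- ?p) + t powr (?q - ?p)"
  have gm: "g \<in> borel_measurable lebesgue" and gi: "integrable lebesgue (\<lambda>y. \<bar>g y\<bar> * weight s \<phi> y)"
    using g by (auto simp: weighted_L1_def)
  have vm: "v \<in> borel_measurable lebesgue" by (simp add: measurable_completion)
  show ?thesis
  proof (rule Bochner_Integration.integrable_bound[of _ "\<lambda>y. ?C * (\<bar>g y\<bar> * weight s \<phi> y)"])
    show "integrable lebesgue (\<lambda>y. ?C * (\<bar>g y\<bar> * weight s \<phi> y))" using gi by simp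
    show "(\<lambda>y. if t \<le> v y then \<bar>g y\<bar> * v y powr (- ?p) else 0) \<in> borel_measurable lebesgue"
      using gm vm by measurable
    show "AE y in lebesgue. norm (if t \<le> v y then \<bar>g y\<bar> * v y powr (- ?p) else 0) \<le> norm (?C * (\<bar>g y\<bar> * weight s \<phi> y))"
    proof (rule AE_I2)
      fix y :: "real^'n"
      have w: "0 < 1 + v y powr ?q" by (rule add_pos_nonneg) auto
      have "v y powr (- ?p) \<le> ?C * weight s \<phi> y" if "t \<le> v y"
      proof -
        have "v y powr (- ?p) * (1 + v y powr ?q) = v y powr (- ?p) + v y powr (?q - ?p)"
          by (simp only: distrib_left mult_1_right powr_add[symmetric]) (simp add: algebra_simps)
        also have "\<dots> \<le> ?C"
          using that t s by (intro add_mono powr_mono2') auto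
        finally show ?thesis using w by (simp add: weight_def pos_le_divide_eq)
      qed
      then have "\<bar>g y\<bar> * v y powr (- ?p) \<le> ?C * (\<bar>g y\<bar> * weight s \<phi> y)" if "t \<le> v y"
        using mult_left_mono[of "v y powr (- ?p)" "?C * weight s \<phi> y" "\<bar>g y\<bar>"] that
        by (simp only: mult.left_commute abs_ge_zero)
      moreover have "0 \<le> ?C * (\<bar>g y\<bar> * weight s \<phi> y)"
        using w by (intro mult_nonneg_nonneg add_nonneg_nonneg) (auto simp: weight_def)
      ultimately have "(if t \<le> v y then \<bar>g y\<bar> * v y powr (- ?p) else 0) \<le> ?C * (\<bar>g y\<bar> * weight s \<phi> y)"
        by presburger
      moreover have "0 \<le> (if t \<le> v y then \<bar>g y\<bar> * v y powr (- ?p) else 0)" by simp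
      ultimately show "norm (if t \<le> v y then \<bar>g y\<bar> * v y powr (- ?p) else 0) \<le> norm (?C * (\<bar>g y\<bar> * weight s \<phi> y))"
        unfolding real_norm_def by linarith
    qed
  qed
qed

text \<open>The potential of scale \<open>l\<close> has excess \<open>l\<^sup>-\<^sup>2 v(l y)\<close>. Where \<open>|l y| \<le> r\<close> the quadratic bound for \<open>v\<close> is scale
invariant. Where \<open>|l y| \<ge> r\<close> the kernel times \<open>1 + |y|\<^sup>a\<close> is bounded by a dilate of one integrable
function \<open>E\<close>; the power of \<open>l\<close> in front beats the factor \<open>l\<^sup>-\<^sup>n\<close> that the dilation costs in the integral.
The last bound is uniform in \<open>l\<close> and serves for factors that are merely integrable.\<close>

lemma rescaled_kernel_majorant:
  assumes \<sigma>: "0 < s" "s \<le> \<sigma>" and a: "0 \<le> a" "a < \<sigma>"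
    and wa: "a = 0 \<or> weighted_L1 s \<phi> (\<lambda>y. norm y powr a)"
  obtains c r E where "0 < c" "0 < r" "integrable lebesgue E" "\<And>z. 0 \<le> E z"
    "\<And>l y. 0 < l \<Longrightarrow> norm (l *\<^sub>R y) \<le> r \<Longrightarrow> c * (norm y)\<^sup>2 \<le> excess (rescale \<phi> l) y"
    "\<And>l y. 0 < l \<Longrightarrow> l \<le> 1 \<Longrightarrow> r \<le> norm (l *\<^sub>R y) \<Longrightarrow>
       (1 + norm y powr a) * excess (rescale \<phi> l) y powr (- ((real CARD('n) + \<sigma>) / 2))
         \<le> l powr (real CARD('n) + \<sigma> - a) * E (l *\<^sub>R y)"
    "\<And>l y \<rho>. 0 < l \<Longrightarrow> l \<le> 1 \<Longrightarrow> 0 < \<rho> \<Longrightarrow> \<rho> \<le> r \<Longrightarrow> \<rho> \<le> norm y \<Longrightarrow> c * \<rho>\<^sup>2 \<le> excess (rescale \<phi> l) y"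
proof -
  let ?n = "real CARD('n)" and ?p = "(real CARD('n) + \<sigma>) / 2"
  obtain c r where cr: "0 < c" "0 < r" "\<And>y. norm y \<le> r \<Longrightarrow> c * (norm y)\<^sup>2 \<le> v y"
    "\<And>y. r \<le> norm y \<Longrightarrow> c * r * norm y \<le> v y"
    using excess_coercive by metis
  note ex = excess_rescale[OF derG]
  define t where "t = c * r\<^sup>2"
  have t: "0 < t" using cr by (simp add: t_def)
  have tv: "t \<le> v z" if "r \<le> norm z" for z
  proof -
    have "c * r * r \<le> c * r * norm z" using that cr(1,2) by (intro mult_left_mono) auto
    moreover have "t = c * r * r" by (simp add: t_def power2_eq_square)
    ultimately show ?thesis using cr(4)[OF that] by linarith
  qed
  define E where "E z = (if t \<le> v z then v z powr (- ?p) else 0)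
    + (if a = 0 then if t \<le> v z then v z powr (- ?p) else 0 else if t \<le> v z then \<bar>norm z powr a\<bar> * v z powr (- ?p) else 0)" for z
  have E: "E z = (1 + norm z powr a) * v z powr (- ?p)" if "r \<le> norm z" for z
    using tv[OF that] that cr(2) by (auto simp: E_def algebra_simps)
  have iE: "integrable lebesgue E"
  proof -
    have 1: "integrable lebesgue (\<lambda>z. if t \<le> v z then v z powr (- ?p) else 0)"
      using \<sigma> t by (intro integrable_excess_tail) auto
    show ?thesis
    proof (cases "a = 0")
      case True
      then show ?thesis unfolding E_def by (simp only: if_True simp_thms) (intro Bochner_Integration.integrable_add 1)
    next
      case False
      then have "integrable lebesgue (\<lambda>z. if t \<le> v z then \<bar>norm z powr a\<bar> * v z powr (- ?p) else 0)"
        using wa \<sigma> t by (intro integrable_weighted_excess_tail[of s]) auto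
      then show ?thesis unfolding E_def using False by (simp only: if_False) (intro Bochner_Integration.integrable_add 1)
    qed
  qed
  have near: "c * (norm y)\<^sup>2 \<le> excess (rescale \<phi> l) y" if "0 < l" "norm (l *\<^sub>R y) \<le> r" for l y
  proof -
    have "c * (l\<^sup>2 * (norm y)\<^sup>2) \<le> v (l *\<^sub>R y)"
      using cr(3)[OF that(2)] that(1) by (simp add: power_mult_distrib)
    then show ?thesis using that(1) by (simp add: ex pos_le_divide_eq mult_ac)
  qed
  show ?thesis
  proof (rule that[OF cr(1,2) iE _ near])
    show "0 \<le> E z" for z by (simp add: E_def)
    fix l :: real and y :: "real^'n" assume l: "0 < l" "l \<le> 1" 
    {
      assume z: "r \<le> norm (l *\<^sub>R y)"
      have vnn: "0 \<le> v (l *\<^sub>R y)" by (rule excess_nonneg)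
      have sq: "(l\<^sup>2) powr ?p = l powr (?n + \<sigma>)"
      proof -
        have "(l\<^sup>2) powr ?p = (l powr 2) powr ?p" using l by (simp add: powr_numeral)
        also have "\<dots> = l powr (2 * ?p)" by (rule powr_powr)
        also have "2 * ?p = ?n + \<sigma>" by (rule twice_half)
        finally show ?thesis .
      qed
      have "1 + norm y powr a \<le> l powr (- a) * (1 + norm (l *\<^sub>R y) powr a)"
      proof -
        have "1 \<le> l powr (- a)" using l a by (simp add: powr_minus one_le_inverse_iff powr_le1)
        moreover have "norm y powr a = l powr (- a) * norm (l *\<^sub>R y) powr a"
          using l by (simp add: powr_mult powr_minus)
        ultimately show ?thesis by (simp add: distrib_left)
      qed
      then have "(1 + norm y powr a) * excess (rescale \<phi> l) y powr (- ?p)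
          \<le> (l powr (- a) * (1 + norm (l *\<^sub>R y) powr a)) * (v (l *\<^sub>R y) / l\<^sup>2) powr (- ?p)"
        using l by (simp add: ex mult_right_mono)
      also have "(v (l *\<^sub>R y) / l\<^sup>2) powr (- ?p) = l powr (?n + \<sigma>) * v (l *\<^sub>R y) powr (- ?p)"
        unfolding powr_divide by (simp only: powr_minus sq) (simp add: field_simps)
      also have "(l powr (- a) * (1 + norm (l *\<^sub>R y) powr a)) * (l powr (?n + \<sigma>) * v (l *\<^sub>R y) powr (- ?p))
          = (l powr (?n + \<sigma>) * l powr (- a)) * E (l *\<^sub>R y)"
        unfolding E[OF z] by (simp only: mult_ac)
      also have "l powr (?n + \<sigma>) * l powr (- a) = l powr (?n + \<sigma> - a)"
        by (simp flip: powr_add)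
      finally show "(1 + norm y powr a) * excess (rescale \<phi> l) y powr (- ?p)
        \<le> l powr (?n + \<sigma> - a) * E (l *\<^sub>R y)" .
    }
    fix \<rho> assume \<rho>: "0 < \<rho>" "\<rho> \<le> r" "\<rho> \<le> norm y"
    show "c * \<rho>\<^sup>2 \<le> excess (rescale \<phi> l) y"
    proof (cases "norm (l *\<^sub>R y) \<le> r")
      case True
      have "c * \<rho>\<^sup>2 \<le> c * (norm y)\<^sup>2" using \<rho> cr(1) by (intro mult_left_mono power_mono) auto
      with near[OF l(1) True] show ?thesis by simp
    next
      case False
      then have "c * r * (l * norm y) \<le> v (l *\<^sub>R y)" using cr(4)[of "l *\<^sub>R y"] l by simp
      moreover have "c * \<rho>\<^sup>2 * l\<^sup>2 \<le> c * r * (l * norm y)"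
      proof -
        have "\<rho> * \<rho> \<le> r * norm y" using \<rho> by (intro mult_mono) auto
        moreover have "l * l \<le> l" using l by (simp add: mult_left_le)
        ultimately have "(\<rho> * \<rho>) * (l * l) \<le> (r * norm y) * l" using \<rho> l by (intro mult_mono) auto
        from mult_left_mono[OF this, of c] cr(1) show ?thesis by (simp add: power2_eq_square mult_ac)
      qed
      ultimately show ?thesis using l by (simp add: ex pos_le_divide_eq)
    qed
  qed
qed

end

section \<open>Passage to the limit in the operator\<close>

context convex_potential
begin

text \<open>The majorant consists of \<open>|y|\<^sup>2\<^sup>-\<^sup>n\<^sup>-\<^sup>\<sigma>\<close> near the origin, where the second differences are quadratic, of
\<open>(1 + |y|\<^sup>a) |y|\<^sup>-\<^sup>n\<^sup>-\<^sup>\<sigma>\<close> away from it, and of the limits \<open>S (x0 \<plusminus> y)\<close> of the integrable part of the growth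
bound. The vanishing error collects the region \<open>|l k y| > r\<close> and the differences between
\<open>S (x k \<plusminus> y)\<close> and \<open>S (x0 \<plusminus> y)\<close>.\<close>

lemma operator_limit:
  fixes T :: "nat \<Rightarrow> real^'n \<Rightarrow> real"
  defines "p \<equiv> \<lambda>\<sigma>. (real CARD('n) + \<sigma>) / 2"
  assumes \<sigma>: "0 < s" "s \<le> \<sigma>" "1 < \<sigma>" "\<sigma> < 2" and a: "0 \<le> a" "a < \<sigma>"
    and wa: "a = 0 \<or> weighted_L1 s \<phi> (\<lambda>y. norm y powr a)"
    and l: "\<And>k. 0 < l k \<and> l k \<le> 1" "l \<longlonglongrightarrow> 0"
    and Tm: "\<And>k. T k \<in> borel_measurable lebesgue"
    and Tlim: "AE z in lebesgue. (\<lambda>k. T k z) \<longlonglongrightarrow> T' z"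
    and x: "x \<longlonglongrightarrow> x0" and Tx: "(\<lambda>k. T k (x k)) \<longlonglongrightarrow> T' x0"
    and growth: "\<And>k. AE z in lebesgue. \<bar>T k z\<bar> \<le> D * (1 + norm z powr a) + S z" and D: "0 \<le> D"
    and S: "integrable lebesgue S" "\<And>z. 0 \<le> S z"
    and near: "\<And>k y. norm y \<le> \<rho> \<Longrightarrow> \<bar>second_difference (T k) (x k) y\<bar> \<le> M * (norm y)\<^sup>2"
    and \<rho>: "0 < \<rho>" and M: "0 \<le> M"
    and \<beta>: "\<And>k y. \<bar>\<beta> k y\<bar> \<le> \<Lambda>" and \<beta>lim: "AE y in lebesgue. (\<lambda>k. \<beta> k y) \<longlonglongrightarrow> \<beta>' y"
    and int: "\<And>k. integrable lebesgue
      (\<lambda>y. second_difference (T k) (x k) y * (\<beta> k y / excess (rescale \<phi> (l k)) y powr p \<sigma>))"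
  shows "\<exists>s. strict_mono s \<and>
    integrable lebesgue (\<lambda>y. second_difference T' x0 y * (\<beta>' y / quadratic_part \<phi> y powr p \<sigma>)) \<and>
    (\<lambda>k. \<integral>y. second_difference (T (s k)) (x (s k)) y * (\<beta> (s k) y / excess (rescale \<phi> (l (s k))) y powr p \<sigma>) \<partial>lebesgue)
      \<longlonglongrightarrow> (\<integral>y. second_difference T' x0 y * (\<beta>' y / quadratic_part \<phi> y powr p \<sigma>) \<partial>lebesgue)"
proof -
  let ?n = "real CARD('n)" and ?p = "p \<sigma>"
  let ?V = "\<lambda>k y. excess (rescale \<phi> (l k)) y"
  define g where "g k y = second_difference (T k) (x k) y * (\<beta> k y / ?V k y powr ?p)" for k y
  define g' where "g' y = second_difference T' x0 y * (\<beta>' y / quadratic_part \<phi> y powr ?p)" for y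
  have n1: "1 \<le> ?n" by (simp add: Suc_leI)
  have p0: "0 < ?p" using n1 \<sigma> by (simp add: p_def)
  have p2: "2 * ?p = ?n + \<sigma>" unfolding p_def by (rule twice_half)
  have \<Lambda>0: "0 \<le> \<Lambda>" using \<beta>[of 0 0] by linarith
  obtain c r E where cr: "0 < c" "0 < r" and iE: "integrable lebesgue E" and E0: "\<And>z. 0 \<le> E z"
    and inner: "\<And>l y. 0 < l \<Longrightarrow> norm (l *\<^sub>R y) \<le> r \<Longrightarrow> c * (norm y)\<^sup>2 \<le> excess (rescale \<phi> l) y"
    and outer: "\<And>l y. 0 < l \<Longrightarrow> l \<le> 1 \<Longrightarrow> r \<le> norm (l *\<^sub>R y) \<Longrightarrow>
       (1 + norm y powr a) * excess (rescale \<phi> l) y powr (- ((real CARD('n) + \<sigma>) / 2))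
         \<le> l powr (real CARD('n) + \<sigma> - a) * E (l *\<^sub>R y)"
    and unif: "\<And>l y \<rho>. 0 < l \<Longrightarrow> l \<le> 1 \<Longrightarrow> 0 < \<rho> \<Longrightarrow> \<rho> \<le> r \<Longrightarrow> \<rho> \<le> norm y \<Longrightarrow> c * \<rho>\<^sup>2 \<le> excess (rescale \<phi> l) y"
    by (rule rescaled_kernel_majorant[OF \<sigma>(1,2) a wa], rule that, assumption+)
  define \<rho>' where "\<rho>' = min \<rho> r"
  have \<rho>': "0 < \<rho>'" "\<rho>' \<le> \<rho>" "\<rho>' \<le> r" using \<rho> cr by (auto simp: \<rho>'_def)
  obtain R where R: "\<And>k. norm (x k) \<le> R" "0 \<le> R"
    using convergent_imp_Bseq[of x] x by (metis Bseq_def convergentI less_imp_le)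
  obtain B where B: "\<And>k. \<bar>T k (x k)\<bar> \<le> B" "0 \<le> B"
    using convergent_imp_Bseq[of "\<lambda>k. T k (x k)"] Tx by (metis Bseq_def convergentI less_imp_le real_norm_def)
  define D1 where "D1 = D * (1 + 2 powr a * R powr a + 2 powr a)"
  define D2 where "D2 = 2 * D1 + 2 * B"
  define W where "W = (c * \<rho>'\<^sup>2) powr (- ?p)"
  have D1: "0 \<le> D1" using D by (simp add: D1_def)
  have D2: "0 \<le> D2" using D1 B by (simp add: D2_def)
  have W0: "0 \<le> W" by (simp add: W_def)
  have kernel_le: "\<bar>\<beta> k y / ?V k y powr ?p\<bar> \<le> \<Lambda> * ?V k y powr (- ?p)" for k y
    using \<beta>[of k y] by (simp add: abs_mult powr_minus divide_inverse mult_right_mono)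
  define I1 where "I1 y = (if norm y \<le> \<rho>' then norm y powr (- (2 * ?p - 2)) else 0)" for y :: "real^'n"
  define I2 where "I2 y = (if \<rho>' \<le> norm y then norm y powr (- (2 * ?p)) else 0)" for y :: "real^'n"
  define I3 where "I3 y = (if \<rho>' \<le> norm y then norm y powr (- (2 * ?p - a)) else 0)" for y :: "real^'n"
  have iI: "integrable lebesgue I1" "integrable lebesgue I2" "integrable lebesgue I3"
  proof -
    have n: "real DIM(real^'n) = ?n" by simp
    show "integrable lebesgue I1" unfolding I1_def
      by (rule integrable_norm_powr_inside; use n p2 \<sigma> n1 \<rho>' in linarith)
    show "integrable lebesgue I2" unfolding I2_def
      by (rule integrable_norm_powr_outside; use n p2 \<sigma> \<rho>' in linarith)
    show "integrable lebesgue I3" unfolding I3_def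
      by (rule integrable_norm_powr_outside; use n p2 a \<rho>' in linarith)
  qed
  have I0: "0 \<le> I1 y" "0 \<le> I2 y" "0 \<le> I3 y" for y by (simp_all add: I1_def I2_def I3_def)
  have S_reflect: "integrable lebesgue (\<lambda>z. S (- z))"
    using integrable_lebesgue_affine[OF S(1), of "-1" 0] by simp
  have iS: "integrable lebesgue (\<lambda>y. S (z + y))" "integrable lebesgue (\<lambda>y. S (z - y))" for z
    using integrable_lebesgue_affine[OF S(1), of 1 z] integrable_lebesgue_affine[OF S(1), of "-1" z] by auto
  define h where "h y = M * \<Lambda> * c powr (- ?p) * I1 y + \<Lambda> * D2 * c powr (- ?p) * (I2 y + I3 y)
      + \<Lambda> * W * (S (x0 + y) + S (x0 - y))" for y
  define e where "e k y = \<Lambda> * D2 * (l k powr (?n + \<sigma> - a) * E (l k *\<^sub>R y))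
      + \<Lambda> * W * (\<bar>S (x k + y) - S (x0 + y)\<bar> + \<bar>S (x k - y) - S (x0 - y)\<bar>)" for k y
  have ih: "integrable lebesgue h"
    unfolding h_def by (intro Bochner_Integration.integrable_add integrable_mult_right iI iS)
  have iEl: "integrable lebesgue (\<lambda>y. E (l k *\<^sub>R y))" for k
    using integrable_lebesgue_affine[OF iE, of "l k" 0] l(1)[of k] by simp
  have iSd: "integrable lebesgue (\<lambda>y. \<bar>S (x k + y) - S (x0 + y)\<bar>)" "integrable lebesgue (\<lambda>y. \<bar>S (x k - y) - S (x0 - y)\<bar>)" for k
    by (intro integrable_abs Bochner_Integration.integrable_diff iS)+
  have ie: "integrable lebesgue (e k)" for k
    unfolding e_def by (intro Bochner_Integration.integrable_add integrable_mult_right iEl iSd)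
  have e0: "0 \<le> e k y" for k y
    unfolding e_def using \<Lambda>0 D2 W0 E0 by (intro add_nonneg_nonneg mult_nonneg_nonneg) auto
  have elim: "(\<lambda>k. \<integral>y. e k y \<partial>lebesgue) \<longlonglongrightarrow> 0"
  proof -
    have val: "(\<integral>y. e k y \<partial>lebesgue) = \<Lambda> * D2 * (l k powr (\<sigma> - a) * (\<integral>z. E z \<partial>lebesgue))
       + \<Lambda> * W * ((\<integral>y. \<bar>S (x k + y) - S (x0 + y)\<bar> \<partial>lebesgue) + (\<integral>y. \<bar>S (x k - y) - S (x0 - y)\<bar> \<partial>lebesgue))" for k
    proof -
      have "(\<integral>y. E (l k *\<^sub>R y) \<partial>lebesgue) = (\<integral>z. E z \<partial>lebesgue) / l k powr ?n"
        using integral_lebesgue_affine[OF iE, of "l k" 0] l(1)[of k] by (simp add: powr_realpow)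
      moreover have "l k powr (?n + \<sigma> - a) = l k powr ?n * l k powr (\<sigma> - a)"
        by (simp flip: powr_add add: algebra_simps)
      ultimately have "l k powr (?n + \<sigma> - a) * (\<integral>y. E (l k *\<^sub>R y) \<partial>lebesgue) = l k powr (\<sigma> - a) * (\<integral>z. E z \<partial>lebesgue)"
        using l(1)[of k] by simp
      then show ?thesis
        unfolding e_def using iEl iSd by (simp add: Bochner_Integration.integral_add)
    qed
    have L1: "(\<lambda>k. \<integral>y. \<bar>S (x k + y) - S (x0 + y)\<bar> \<partial>lebesgue) \<longlonglongrightarrow> 0"
      by (rule L1_continuous_translation[OF S(1) x])
    have L2: "(\<lambda>k. \<integral>y. \<bar>S (x k - y) - S (x0 - y)\<bar> \<partial>lebesgue) \<longlonglongrightarrow> 0"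
      using L1_continuous_translation[OF S_reflect tendsto_minus[OF x]] by simp
    have L3: "(\<lambda>k. l k powr (\<sigma> - a)) \<longlonglongrightarrow> 0"
      using l(1) a by (intro tendsto_zero_powrI[OF l(2) tendsto_const]) (auto intro!: always_eventually simp: less_imp_le)
    have "(\<lambda>k. \<integral>y. e k y \<partial>lebesgue) \<longlonglongrightarrow> \<Lambda> * D2 * (0 * (\<integral>z. E z \<partial>lebesgue)) + \<Lambda> * W * (0 + 0)"
      unfolding val by (intro tendsto_intros L1 L2 L3)
    then show ?thesis by simp
  qed
  have dom: "AE y in lebesgue. \<bar>g k y\<bar> \<le> h y + e k y" for k
  proof -
    have "AE y in lebesgue. \<bar>T k (x k + y)\<bar> \<le> D * (1 + norm (x k + y) powr a) + S (x k + y)"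
      using AE_lebesgue_affine[OF growth[of k], of 1 "x k"] by simp
    moreover have "AE y in lebesgue. \<bar>T k (x k - y)\<bar> \<le> D * (1 + norm (x k - y) powr a) + S (x k - y)"
      using AE_lebesgue_affine[OF growth[of k], of "-1" "x k"] by simp
    ultimately show ?thesis
    proof eventually_elim
      case (elim y)
      let ?w = "?V k y powr (- ?p)"
      have lk: "0 < l k" "l k \<le> 1" using l(1)[of k] by auto
      have w0: "0 \<le> ?w" by simp
      have gle: "\<bar>g k y\<bar> \<le> \<bar>second_difference (T k) (x k) y\<bar> * (\<Lambda> * ?w)"
        unfolding g_def abs_mult by (intro mult_left_mono kernel_le) auto
      have Spos: "0 \<le> \<Lambda> * W * (S (x0 + y) + S (x0 - y))"
        using \<Lambda>0 W0 S(2) by (intro mult_nonneg_nonneg add_nonneg_nonneg) auto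
      show ?case
      proof (cases "norm y \<le> \<rho>'")
        case True
        have "\<bar>g k y\<bar> \<le> M * (norm y)\<^sup>2 * (\<Lambda> * ?w)"
          using True \<rho>' w0 \<Lambda>0 by (intro order_trans[OF gle] mult_right_mono near mult_nonneg_nonneg) auto
        also have "\<dots> \<le> M * \<Lambda> * c powr (- ?p) * I1 y"
        proof (cases "y = 0")
          case False
          have "norm (l k *\<^sub>R y) \<le> r" using True \<rho>' lk mult_left_le_one_le[of "norm y" "l k"] by simp
          then have "c * (norm y)\<^sup>2 \<le> ?V k y" using lk by (intro inner)
          then have "?w \<le> (c * (norm y)\<^sup>2) powr (- ?p)"
            using False cr p0 by (intro powr_mono2') auto
          also have "\<dots> = c powr (- ?p) * norm y powr (- (2 * ?p))"
            by (simp add: powr_mult powr_powr flip: powr_numeral)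
          finally have "(norm y)\<^sup>2 * ?w \<le> (norm y)\<^sup>2 * (c powr (- ?p) * norm y powr (- (2 * ?p)))"
            by (intro mult_left_mono) auto
          also have "\<dots> = c powr (- ?p) * I1 y"
          proof -
            have "(norm y)\<^sup>2 * norm y powr (- (2 * ?p)) = norm y powr (- (2 * ?p - 2))"
              using False by (simp flip: powr_numeral powr_add)
            then show ?thesis using True by (simp add: I1_def mult.left_commute)
          qed
          finally have "M * \<Lambda> * ((norm y)\<^sup>2 * ?w) \<le> M * \<Lambda> * (c powr (- ?p) * I1 y)"
            using M \<Lambda>0 by (intro mult_left_mono) auto
          then show ?thesis by (simp only: mult_ac)
        qed (use M \<Lambda>0 I0 in auto)
        also have "\<dots> \<le> h y"
        proof -
          have "0 \<le> \<Lambda> * D2 * c powr (- ?p) * (I2 y + I3 y)"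
            using \<Lambda>0 D2 I0 by (intro mult_nonneg_nonneg add_nonneg_nonneg) auto
          then show ?thesis using Spos unfolding h_def by linarith
        qed
        finally show ?thesis using e0[of k y] by linarith
      next
        case False
        then have y: "\<rho>' \<le> norm y" by simp
        \<comment> \<open>The points \<open>x k\<close> are bounded, so replacing \<open>y\<close> by \<open>x k \<plusminus> y\<close> in a power costs only a constant factor.\<close>
        have half: "D * (1 + norm z powr a) \<le> D1 * (1 + norm y powr a)" if "norm z \<le> R + norm y" for z :: "real^'n"
        proof -
          have "norm z powr a \<le> (2 * max R (norm y)) powr a"
            using that a by (intro powr_mono2) auto
          also have "\<dots> = 2 powr a * max R (norm y) powr a" using R by (simp add: powr_mult)
          also have "\<dots> \<le> 2 powr a * (R powr a + norm y powr a)"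
            by (intro mult_left_mono) (auto simp: max_def)
          finally have "norm z powr a \<le> 2 powr a * (R powr a + norm y powr a)" .
          moreover have "0 \<le> norm y powr a + 2 powr a + 2 powr a * R powr a * norm y powr a" by simp
          moreover have "(1 + 2 powr a * R powr a + 2 powr a) * (1 + norm y powr a)
              = 1 + 2 powr a * (R powr a + norm y powr a)
                + (norm y powr a + 2 powr a + 2 powr a * R powr a * norm y powr a)"
            by (simp add: algebra_simps)
          ultimately have "1 + norm z powr a \<le> (1 + 2 powr a * R powr a + 2 powr a) * (1 + norm y powr a)"
            by linarith
          from mult_left_mono[OF this D] show ?thesis by (simp add: D1_def mult.assoc)
        qed
        have nz: "norm (x k + y) \<le> R + norm y" "norm (x k - y) \<le> R + norm y"
          using norm_triangle_ineq[of "x k" y] norm_triangle_ineq4[of "x k" y] R(1)[of k] by linarith+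
        have one: "1 \<le> 1 + norm y powr a" by simp
        have B': "B \<le> B * (1 + norm y powr a)" using mult_left_mono[OF one B(2)] by simp
        have "\<bar>second_difference (T k) (x k) y\<bar> \<le> D2 * (1 + norm y powr a) + (S (x k + y) + S (x k - y))"
        proof -
          have "\<bar>second_difference (T k) (x k) y\<bar> \<le> \<bar>T k (x k + y)\<bar> + \<bar>T k (x k - y)\<bar> + 2 * \<bar>T k (x k)\<bar>"
            unfolding second_difference_def by linarith
          also have "\<dots> \<le> 2 * (D1 * (1 + norm y powr a)) + 2 * (B * (1 + norm y powr a)) + (S (x k + y) + S (x k - y))"
            using elim half[OF nz(1)] half[OF nz(2)] B' B(1)[of k] by linarith
          finally show ?thesis by (simp add: D2_def algebra_simps)
        qed
        then have "\<bar>g k y\<bar> \<le> (D2 * (1 + norm y powr a) + (S (x k + y) + S (x k - y))) * (\<Lambda> * ?w)"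
          using w0 \<Lambda>0 by (intro order_trans[OF gle] mult_right_mono) auto
        also have "\<dots> = \<Lambda> * D2 * ((1 + norm y powr a) * ?w) + \<Lambda> * ?w * (S (x k + y) + S (x k - y))"
          by (simp add: algebra_simps)
        finally have g1: "\<bar>g k y\<bar> \<le> \<Lambda> * D2 * ((1 + norm y powr a) * ?w) + \<Lambda> * ?w * (S (x k + y) + S (x k - y))" .
        have "(1 + norm y powr a) * ?w \<le> c powr (- ?p) * (I2 y + I3 y) + l k powr (?n + \<sigma> - a) * E (l k *\<^sub>R y)"
        proof (cases "norm (l k *\<^sub>R y) \<le> r")
          case True
          have yz: "y \<noteq> 0" using y \<rho>' by auto
          have "c * (norm y)\<^sup>2 \<le> ?V k y" using lk True by (intro inner)
          then have "?w \<le> (c * (norm y)\<^sup>2) powr (- ?p)"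
            using yz cr p0 by (intro powr_mono2') auto
          also have "\<dots> = c powr (- ?p) * norm y powr (- (2 * ?p))"
            by (simp add: powr_mult powr_powr flip: powr_numeral)
          finally have "(1 + norm y powr a) * ?w \<le> (1 + norm y powr a) * (c powr (- ?p) * norm y powr (- (2 * ?p)))"
            by (intro mult_left_mono) auto
          also have "\<dots> = c powr (- ?p) * (I2 y + I3 y)"
          proof -
            have "norm y powr a * norm y powr (- (2 * ?p)) = norm y powr (- (2 * ?p - a))"
              by (simp flip: powr_add)
            then show ?thesis using y by (simp add: I2_def I3_def algebra_simps)
          qed
          finally show ?thesis using E0[of "l k *\<^sub>R y"] by (simp add: add_increasing2)
        next
          case False
          then have "(1 + norm y powr a) * ?w \<le> l k powr (?n + \<sigma> - a) * E (l k *\<^sub>R y)"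
            using outer[OF lk, of y] by (simp add: p_def)
          moreover have "0 \<le> c powr (- ?p) * (I2 y + I3 y)"
            using I0 by (intro mult_nonneg_nonneg add_nonneg_nonneg) auto
          ultimately show ?thesis by linarith
        qed
        from mult_left_mono[OF this, of "\<Lambda> * D2"] \<Lambda>0 D2
        have g2: "\<Lambda> * D2 * ((1 + norm y powr a) * ?w)
            \<le> \<Lambda> * D2 * c powr (- ?p) * (I2 y + I3 y) + \<Lambda> * D2 * (l k powr (?n + \<sigma> - a) * E (l k *\<^sub>R y))"
          by (simp add: distrib_left mult.assoc)
        have "?w \<le> W"
          unfolding W_def using unif[OF lk \<rho>'(1,3) y] cr \<rho>' p0 by (intro powr_mono2') auto
        then have "\<Lambda> * ?w * (S (x k + y) + S (x k - y)) \<le> \<Lambda> * W * (S (x k + y) + S (x k - y))"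
          using \<Lambda>0 S(2) by (intro mult_right_mono mult_left_mono add_nonneg_nonneg) auto
        also have "\<dots> \<le> \<Lambda> * W * ((S (x0 + y) + S (x0 - y)) + (\<bar>S (x k + y) - S (x0 + y)\<bar> + \<bar>S (x k - y) - S (x0 - y)\<bar>))"
          using \<Lambda>0 W0 by (intro mult_left_mono mult_nonneg_nonneg) auto
        also have "\<dots> = \<Lambda> * W * (S (x0 + y) + S (x0 - y)) + \<Lambda> * W * (\<bar>S (x k + y) - S (x0 + y)\<bar> + \<bar>S (x k - y) - S (x0 - y)\<bar>)"
          by (rule distrib_left)
        finally have g3: "\<Lambda> * ?w * (S (x k + y) + S (x k - y))
          \<le> \<Lambda> * W * (S (x0 + y) + S (x0 - y)) + \<Lambda> * W * (\<bar>S (x k + y) - S (x0 + y)\<bar> + \<bar>S (x k - y) - S (x0 - y)\<bar>)" .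
        have "0 \<le> M * \<Lambda> * c powr (- ?p) * I1 y" using M \<Lambda>0 I0 by (intro mult_nonneg_nonneg) auto
        with g1 g2 g3 show ?thesis unfolding h_def e_def by linarith
      qed
    qed
  qed
  have T'm: "T' \<in> borel_measurable lebesgue" by (rule lebesgue_measurable_AE_limit[OF Tm Tlim])
  obtain s1 where s1: "strict_mono s1" "AE y in lebesgue. (\<lambda>k. T (s1 k) (x (s1 k) + y)) \<longlonglongrightarrow> T' (x0 + y)"
    using AE_convergence_under_translation[OF Tm T'm Tlim x] by blast
  have neg: "(\<lambda>z::real^'n. - z) \<in> lebesgue \<rightarrow>\<^sub>M lebesgue"
    using measurable_lebesgue_affine[of "-1" "0 :: real^'n"] by simp
  \<comment> \<open>The values at \<open>x k - y\<close> are those of the reflected functions at \<open>- x k + y\<close>.\<close>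
  have "AE z in lebesgue. (\<lambda>k. T (s1 k) (- z)) \<longlonglongrightarrow> T' (- z)"
    using AE_lebesgue_affine[OF Tlim, of "-1" 0, simplified]
  proof eventually_elim
    case (elim z)
    from LIMSEQ_subseq_LIMSEQ[OF elim s1(1)] show ?case by (simp add: o_def)
  qed
  from AE_convergence_under_translation[OF measurable_compose[OF neg Tm] measurable_compose[OF neg T'm] this
      tendsto_minus[OF LIMSEQ_subseq_LIMSEQ[OF x s1(1)]]]
  obtain s2 where s2: "strict_mono s2" "AE y in lebesgue. (\<lambda>k. T (s1 (s2 k)) (x (s1 (s2 k)) - y)) \<longlonglongrightarrow> T' (x0 - y)"
    by (auto simp: o_def)
  define s where "s = s1 \<circ> s2"
  have s: "strict_mono s" unfolding s_def using s1(1) s2(1) by (rule strict_mono_o)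
  have glim: "AE y in lebesgue. (\<lambda>k. g (s k) y) \<longlonglongrightarrow> g' y"
    using s1(2) s2(2) \<beta>lim AE_completion[OF AE_lborel_singleton[of "0 :: real^'n"]]
  proof eventually_elim
    case (elim y)
    have 1: "(\<lambda>k. T (s k) (x (s k) + y)) \<longlonglongrightarrow> T' (x0 + y)"
      using LIMSEQ_subseq_LIMSEQ[OF elim(1) s2(1)] by (simp add: s_def o_def)
    have 2: "(\<lambda>k. T (s k) (x (s k) - y)) \<longlonglongrightarrow> T' (x0 - y)" using elim(2) by (simp add: s_def)
    have 3: "(\<lambda>k. \<beta> (s k) y) \<longlonglongrightarrow> \<beta>' y"
      using LIMSEQ_subseq_LIMSEQ[OF elim(3) s] by (simp add: o_def)
    have 4: "(\<lambda>k. T (s k) (x (s k))) \<longlonglongrightarrow> T' x0"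
      using LIMSEQ_subseq_LIMSEQ[OF Tx s] by (simp add: o_def)
    have "filterlim l (at_right 0) sequentially"
    proof -
      have "l k \<noteq> 0 \<and> 0 < l k" for k using l(1)[of k] by auto
      then show ?thesis using l(2) by (simp add: filterlim_at)
    qed
    from filterlim_compose[OF excess_blow_up[of y] this]
    have "(\<lambda>k. ?V k y) \<longlonglongrightarrow> quadratic_part \<phi> y"
      using l by (simp add: excess_rescale[OF derG])
    then have 5: "(\<lambda>k. ?V (s k) y) \<longlonglongrightarrow> quadratic_part \<phi> y"
      using LIMSEQ_subseq_LIMSEQ[OF _ s] by (simp add: o_def)
    have "quadratic_part \<phi> y \<noteq> 0" using quadratic_part_pos[of y] elim(4) by simp
    then show ?case
      unfolding g_def g'_def second_difference_def
      by (intro tendsto_intros 1 2 3 4 5) auto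
  qed
  have gm: "g k \<in> borel_measurable lebesgue" for k
    using int[of k] unfolding g_def by (rule borel_measurable_integrable)
  have g'm: "g' \<in> borel_measurable lebesgue" by (rule lebesgue_measurable_AE_limit[OF gm glim])
  have es: "(\<lambda>k. \<integral>y. e (s k) y \<partial>lebesgue) \<longlonglongrightarrow> 0"
    using LIMSEQ_subseq_LIMSEQ[OF elim s] by (simp add: o_def)
  obtain s3 where s3: "strict_mono s3" "integrable lebesgue g'"
    "(\<lambda>k. \<integral>y. g (s (s3 k)) y \<partial>lebesgue) \<longlonglongrightarrow> (\<integral>y. g' y \<partial>lebesgue)"
    using dominated_convergence_vanishing_error[of "\<lambda>k. g (s k)" lebesgue h "\<lambda>k. e (s k)" g']
      gm ih ie e0 es dom glim g'm by auto
  have "strict_mono (s \<circ> s3)" using s s3(1) by (rule strict_mono_o)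
  then show ?thesis
    using s3(2,3) unfolding g_def g'_def by (intro exI[of _ "s \<circ> s3"]) (simp add: o_def)
qed

end

section \<open>Test functions\<close>

lemma norm_matrix_vector_le:
  fixes A :: "real^'n^'m"
  shows "norm (A *v h) \<le> norm A * norm h"
proof -
  have "norm (A *v h) = L2_set (\<lambda>i. norm (A $ i \<bullet> h)) UNIV"
    by (simp add: norm_vec_def matrix_vector_mult_def inner_vec_def)
  also have "\<dots> \<le> L2_set (\<lambda>i. norm (A $ i) * norm h) UNIV"
    by (intro L2_set_mono) (auto simp: Cauchy_Schwarz_ineq2)
  also have "\<dots> = norm A * norm h"
    by (simp add: norm_vec_def[of A] L2_set_left_distrib)
  finally show ?thesis .
qed

text \<open>The mean value theorem for \<open>s \<mapsto> p (x + s y) + p (x - s y)\<close> and a Lipschitz bound for the gradient.\<close>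

lemma second_difference_C2_bound:
  fixes p :: "real^'n \<Rightarrow> real"
  assumes p: "\<And>x. x \<in> ball x0 (2 * \<rho>) \<Longrightarrow> (p has_derivative (\<lambda>h. g x \<bullet> h)) (at x)"
    and g: "\<And>x. x \<in> ball x0 (2 * \<rho>) \<Longrightarrow> (g has_derivative (\<lambda>h. A x *v h)) (at x)"
    and A: "\<And>x. x \<in> ball x0 (2 * \<rho>) \<Longrightarrow> norm (A x) \<le> M"
    and x: "x \<in> ball x0 \<rho>" and y: "norm y \<le> \<rho>"
  shows "\<bar>second_difference p x y\<bar> \<le> 2 * M * (norm y)\<^sup>2"
proof -
  have "dist x0 x < \<rho>" using x by simp
  then have "x \<in> ball x0 (2 * \<rho>)" using zero_le_dist[of x0 x] by (simp del: zero_le_dist)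
  from order_trans[OF norm_ge_zero A[OF this]] have M: "0 \<le> M" .
  have mem: "x + s *\<^sub>R y \<in> ball x0 (2 * \<rho>)" if "\<bar>s\<bar> \<le> 1" for s
  proof -
    have "dist x0 (x + s *\<^sub>R y) \<le> dist x0 x + \<bar>s\<bar> * norm y"
      using dist_triangle[of x0 "x + s *\<^sub>R y" x] by (simp add: dist_norm)
    also have "\<dots> < \<rho> + 1 * \<rho>"
      using x that y by (intro add_less_le_mono mult_mono) auto
    finally show ?thesis by simp
  qed
  have lip: "norm (g z - g w) \<le> M * norm (z - w)" if "z \<in> ball x0 (2 * \<rho>)" "w \<in> ball x0 (2 * \<rho>)" for z w
  proof (rule differentiable_bound[OF convex_ball _ _ that])
    show "(g has_derivative (\<lambda>h. A z *v h)) (at z within ball x0 (2 * \<rho>))" if "z \<in> ball x0 (2 * \<rho>)" for z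
      using g[OF that] by (rule has_derivative_at_withinI)
    show "onorm (\<lambda>h. A z *v h) \<le> M" if "z \<in> ball x0 (2 * \<rho>)" for z
      by (rule onorm_le) (rule order_trans[OF norm_matrix_vector_le mult_right_mono[OF A[OF that]]], simp)
  qed
  define \<psi> where "\<psi> s = p (x + s *\<^sub>R y) + p (x - s *\<^sub>R y)" for s :: real
  have der: "(\<psi> has_real_derivative ((g (x + s *\<^sub>R y) - g (x - s *\<^sub>R y)) \<bullet> y)) (at s)" if "0 \<le> s" "s \<le> 1" for s
  proof -
    have 1: "((\<lambda>s. p (x + s *\<^sub>R y)) has_derivative (\<lambda>h. g (x + s *\<^sub>R y) \<bullet> (h *\<^sub>R y))) (at s)"
      using that by (intro has_derivative_compose[where g = p and f = "\<lambda>s. x + s *\<^sub>R y"] p mem) (auto intro!: derivative_eq_intros)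
    have 2: "((\<lambda>s. p (x - s *\<^sub>R y)) has_derivative (\<lambda>h. g (x - s *\<^sub>R y) \<bullet> (- h *\<^sub>R y))) (at s)"
      using that mem[of "- s"] by (intro has_derivative_compose[where g = p and f = "\<lambda>s. x - s *\<^sub>R y"] p) (auto intro!: derivative_eq_intros)
    show ?thesis
      unfolding has_field_derivative_def \<psi>_def
      by (rule has_derivative_add[OF 1 2, THEN has_derivative_eq_rhs]) (simp add: fun_eq_iff inner_diff_left algebra_simps)
  qed
  obtain z where z: "0 < z" "z < 1" "\<psi> 1 - \<psi> 0 = (1 - 0) * ((g (x + z *\<^sub>R y) - g (x - z *\<^sub>R y)) \<bullet> y)"
    using MVT2[of 0 1 \<psi> "\<lambda>s. (g (x + s *\<^sub>R y) - g (x - s *\<^sub>R y)) \<bullet> y"] der by auto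
  have chord: "(x + z *\<^sub>R y) - (x - z *\<^sub>R y) = (2 * z) *\<^sub>R y" by (simp add: vec_eq_iff)
  have "norm (g (x + z *\<^sub>R y) - g (x - z *\<^sub>R y)) \<le> M * norm ((2 * z) *\<^sub>R y)"
    using lip[of "x + z *\<^sub>R y" "x - z *\<^sub>R y", unfolded chord] mem[of z] mem[of "- z"] z by simp
  also have "\<dots> \<le> M * (2 * norm y)"
    using z M by (intro mult_left_mono) (auto simp: mult_left_le_one_le)
  finally have "\<bar>(g (x + z *\<^sub>R y) - g (x - z *\<^sub>R y)) \<bullet> y\<bar> \<le> M * (2 * norm y) * norm y"
    by (intro order_trans[OF Cauchy_Schwarz_ineq2] mult_right_mono) auto
  moreover have "second_difference p x y = \<psi> 1 - \<psi> 0" by (simp add: second_difference_def \<psi>_def)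
  ultimately show ?thesis using z(3) by (simp add: power2_eq_square mult_ac)
qed

lemma C2_closure_add_quadratic:
  fixes p :: "real^'n \<Rightarrow> real"
  assumes "C2_closure N p"
  shows "C2_closure N (\<lambda>z. p z + \<eta> * (norm (z - w))\<^sup>2 + c)"
proof -
  obtain G H where *: "continuous_on (closure N) p" "continuous_on (closure N) G" "continuous_on (closure N) H"
    "\<And>x. x \<in> N \<Longrightarrow> (p has_derivative (\<lambda>h. G x \<bullet> h)) (at x)" "\<And>x. x \<in> N \<Longrightarrow> (G has_derivative (\<lambda>h. H x *v h)) (at x)"
    using assms unfolding C2_closure_def by blast
  have 1: "((\<lambda>z. p z + \<eta> * (norm (z - w))\<^sup>2 + c) has_derivative (\<lambda>h. (G x + (2 * \<eta>) *\<^sub>R (x - w)) \<bullet> h)) (at x)" if "x \<in> N" for x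
    unfolding power2_norm_eq_inner
    by (auto intro!: derivative_eq_intros *(4)[OF that] simp: fun_eq_iff inner_add_left inner_diff_left inner_diff_right inner_commute algebra_simps)
  have 2: "((\<lambda>z. G z + (2 * \<eta>) *\<^sub>R (z - w)) has_derivative (\<lambda>h. (H x + (2 * \<eta>) *\<^sub>R mat 1) *v h)) (at x)" if "x \<in> N" for x
    by (auto intro!: derivative_eq_intros *(5)[OF that] simp: fun_eq_iff matrix_vector_mult_add_rdistrib scaleR_matrix_vector_assoc[symmetric])
  show ?thesis
    unfolding C2_closure_def
    by (intro conjI exI[of _ "\<lambda>z. G z + (2 * \<eta>) *\<^sub>R (z - w)"] exI[of _ "\<lambda>x. H x + (2 * \<eta>) *\<^sub>R mat 1"] ballI 1 2)
       (auto intro!: continuous_intros *(1-3))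
qed

lemma uniform_limit_along_sequence:
  fixes f :: "nat \<Rightarrow> 'a::metric_space \<Rightarrow> real"
  assumes u: "uniform_limit S f g sequentially" and c: "continuous_on S g"
    and x: "\<And>k. x k \<in> S" "x \<longlonglongrightarrow> x0" "x0 \<in> S"
  shows "(\<lambda>k. f k (x k)) \<longlonglongrightarrow> g x0"
proof -
  have 1: "(\<lambda>k. f k (x k) - g (x k)) \<longlonglongrightarrow> 0"
  proof (rule tendstoI)
    fix e :: real assume "0 < e"
    from uniform_limitD[OF u this] show "\<forall>\<^sub>F k in sequentially. dist (f k (x k) - g (x k)) 0 < e"
      by eventually_elim (use x in \<open>auto simp: dist_real_def\<close>)
  qed
  have 2: "(\<lambda>k. g (x k)) \<longlonglongrightarrow> g x0"
    using c x by (auto simp: continuous_on_sequentially o_def)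
  from tendsto_add[OF 1 2] show ?thesis by simp
qed

lemma measurable_patch:
  fixes p u :: "real^'n \<Rightarrow> real"
  assumes "open N" "continuous_on N p" "u \<in> borel_measurable lebesgue"
  shows "patch N p u \<in> borel_measurable lebesgue"
proof -
  have "(\<lambda>z. indicator N z *\<^sub>R p z) \<in> borel_measurable borel"
    using assms by (intro borel_measurable_continuous_on_indicator) auto
  then have 1: "(\<lambda>z. indicator N z *\<^sub>R p z) \<in> borel_measurable lebesgue" by (simp add: measurable_completion)
  have 2: "(\<lambda>z. indicator (- N) z *\<^sub>R u z) \<in> borel_measurable lebesgue"
    using assms by (intro borel_measurable_scaleR borel_measurable_indicator) auto
  have "patch N p u = (\<lambda>z. indicator N z *\<^sub>R p z + indicator (- N) z *\<^sub>R u z)"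
    by (auto simp: patch_def fun_eq_iff indicator_def)
  then show ?thesis using borel_measurable_add[OF 1 2] by simp
qed

lemma continuous_on_imp_usc_on: "continuous_on S u \<Longrightarrow> usc_on S u"
  by (auto simp: usc_on_def continuous_on_def intro: order_tendstoD)

text \<open>The second difference at \<open>x0\<close> is affine in \<open>\<eta>\<close> because the added paraboloid vanishes at \<open>x0\<close>. So
integrability for two positive values of \<open>\<eta>\<close> gives it for all \<open>\<eta>\<close>, in particular for \<open>\<eta> = 0\<close>, where the
inequality follows by continuity.\<close>

lemma test_function_perturbation_limit:
  fixes p u :: "real^'n \<Rightarrow> real"
  assumes ev: "\<And>\<eta>. 0 < \<eta> \<Longrightarrow> nonlocal_defined K (patch N (\<lambda>z. p z + \<eta> * (norm (z - x0))\<^sup>2) u) x0 \<and>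
      c \<le> nonlocal K (patch N (\<lambda>z. p z + \<eta> * (norm (z - x0))\<^sup>2) u) x0" and x0: "x0 \<in> N"
  shows "nonlocal_defined K (patch N p u) x0 \<and> c \<le> nonlocal K (patch N p u) x0"
proof -
  let ?T = "\<lambda>\<eta>. patch N (\<lambda>z. p z + \<eta> * (norm (z - x0))\<^sup>2) u"
  define A where "A y = second_difference (patch N p u) x0 y * K x0 y" for y
  define B where "B y = second_difference (patch N (\<lambda>z. (norm (z - x0))\<^sup>2) (\<lambda>_. 0)) x0 y * K x0 y" for y
  have eq: "second_difference (?T \<eta>) x0 y * K x0 y = A y + \<eta> * B y" for \<eta> y
    using x0 by (simp add: A_def B_def second_difference_def patch_def algebra_simps)
  have int: "integrable lebesgue (\<lambda>y. A y + \<eta> * B y)" and le: "c \<le> (\<integral>y. A y + \<eta> * B y \<partial>lebesgue)" if "0 < \<eta>" for \<eta>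
    using ev[OF that] unfolding nonlocal_defined_def nonlocal_def eq by auto
  have "integrable lebesgue (\<lambda>y. 2 * (A y + 1 * B y) - (A y + 2 * B y))"
    by (intro Bochner_Integration.integrable_diff integrable_mult_right int) auto
  then have iA: "integrable lebesgue A"
    by (rule back_subst[of "integrable lebesgue"]) (simp add: fun_eq_iff)
  have "integrable lebesgue (\<lambda>y. (A y + 2 * B y) - (A y + 1 * B y))"
    by (intro Bochner_Integration.integrable_diff int) auto
  then have iB: "integrable lebesgue B"
    by (rule back_subst[of "integrable lebesgue"]) (simp add: fun_eq_iff)
  have "c \<le> (\<integral>y. A y \<partial>lebesgue) + \<eta> * (\<integral>y. B y \<partial>lebesgue)" if "0 < \<eta>" for \<eta>
    using le[OF that] iA iB by simp
  then have "c \<le> (\<integral>y. A y \<partial>lebesgue)" by (rule affine_lower_bound_at_0)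
  with iA show ?thesis unfolding nonlocal_defined_def nonlocal_def A_def by simp
qed

section \<open>Stability of viscosity solutions\<close>

context convex_potential
begin

text \<open>The perturbed test function has opening \<open>\<theta> = 2 \<eta>\<close> at \<open>x0\<close>: one half localises the minimum points at
\<open>x0\<close>, the other half, centred at \<open>x k\<close>, makes the contact at \<open>x k\<close> strict. The growth exponent
\<open>1 + \<alpha>\<close> may be negative; the singularity of the growth bound at the origin is integrable and goes into
\<open>S\<close>.\<close>

lemma viscosity_subsolution_limit:
  fixes u :: "nat \<Rightarrow> real^'n \<Rightarrow> real" and b :: "nat \<Rightarrow> real^'n \<Rightarrow> real^'n \<Rightarrow> real"
  assumes \<sigma>: "1 < \<sigma>\<^sub>0" "\<sigma>\<^sub>0 \<le> \<sigma>" "\<sigma> < 2" and \<Omega>: "open \<Omega>" "bounded \<Omega>"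
    and \<alpha>: "\<alpha> < \<sigma>\<^sub>0 - 1" and \<zeta>: "weighted_L1 \<sigma>\<^sub>0 \<phi> (\<lambda>y. norm y powr (1 + \<alpha>))"
    and l: "\<And>k. 0 < l k \<and> l k \<le> 1" "l \<longlonglongrightarrow> 0"
    and uc: "\<And>k. continuous_on (closure \<Omega>) (u k)" and um: "\<And>k. u k \<in> borel_measurable lebesgue"
    and b: "\<And>k x y. x \<in> \<Omega> \<Longrightarrow> \<bar>b k x y\<bar> \<le> \<Lambda>"
    and sub: "\<And>k. viscosity_subsolution \<Omega> (nonlocal_kernel \<sigma> (rescale \<phi> (l k)) (b k)) (f k) (u k)"
    and ulim: "uniform_limit (closure \<Omega>) u u' sequentially"
    and uae: "AE x in lebesgue. (\<lambda>k. u k x) \<longlonglongrightarrow> u' x"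
    and ubd: "\<And>k x. x \<noteq> 0 \<Longrightarrow> \<bar>u k x\<bar> \<le> 1 + norm x powr (1 + \<alpha>)"
    and fc: "\<And>k. continuous_on \<Omega> (f k)"
    and flim: "\<And>C. compact C \<Longrightarrow> C \<subseteq> \<Omega> \<Longrightarrow> uniform_limit C f f' sequentially"
    and blim: "uniform_limit (\<Omega> \<times> UNIV) (\<lambda>k (x, y). b k x y) (\<lambda>(x, y). b' x y) sequentially"
    and bcont: "\<And>x. x \<in> \<Omega> \<Longrightarrow> AE y in lebesgue. isCont (\<lambda>x'. b' x' y) x"
  shows "viscosity_subsolution \<Omega> (nonlocal_kernel \<sigma> (quadratic_part \<phi>) b') f' u'"
proof -
  define a where "a = max (1 + \<alpha>) 0"
  have a: "0 \<le> a" "a < \<sigma>" using \<alpha> \<sigma> by (auto simp: a_def)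
  have wa: "a = 0 \<or> weighted_L1 \<sigma>\<^sub>0 \<phi> (\<lambda>y. norm y powr a)"
    using \<zeta> by (auto simp: a_def max_def)
  \<comment> \<open>The part of the growth bound that is unbounded at the origin when the exponent is negative.\<close>
  define S where "S z = (if norm z \<le> 1 then norm z powr (1 + \<alpha>) else 0)" for z :: "real^'n"
  have S0: "0 \<le> S z" for z by (simp add: S_def)
  have iS: "integrable lebesgue S"
  proof -
    \<comment> \<open>On the unit ball the weight is bounded below, so weighted integrability is integrability there.\<close>
    have "compact (v ` cball 0 1)"
      by (intro compact_continuous_image continuous_on_subset[OF continuous_excess]) auto
    then obtain B where "\<forall>t\<in>v ` cball 0 1. norm t \<le> B"
      using compact_imp_bounded by (metis bounded_iff)
    then have B: "v z \<le> B" if "z \<in> cball 0 1" for z using that by force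
    let ?q = "(real CARD('n) + \<sigma>\<^sub>0) / 2"
    have zm: "(\<lambda>y :: real^'n. norm y powr (1 + \<alpha>)) \<in> borel_measurable lebesgue"
      and zi: "integrable lebesgue (\<lambda>y. \<bar>norm y powr (1 + \<alpha>)\<bar> * weight \<sigma>\<^sub>0 \<phi> y)"
      using \<zeta> by (auto simp: weighted_L1_def)
    have bpos: "0 < 1 + B powr ?q" by (rule add_pos_nonneg) auto
    show ?thesis
    proof (rule Bochner_Integration.integrable_bound[of _ "\<lambda>y. (1 + B powr ?q) * (\<bar>norm y powr (1 + \<alpha>)\<bar> * weight \<sigma>\<^sub>0 \<phi> y)"])
      show "integrable lebesgue (\<lambda>y. (1 + B powr ?q) * (\<bar>norm y powr (1 + \<alpha>)\<bar> * weight \<sigma>\<^sub>0 \<phi> y))"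
        using zi by (rule integrable_mult_right)
      have "(norm :: real^'n \<Rightarrow> real) \<in> borel_measurable lebesgue" by (simp add: measurable_completion)
      then show "S \<in> borel_measurable lebesgue" unfolding S_def using zm by measurable
      show "AE y in lebesgue. norm (S y) \<le> norm ((1 + B powr ?q) * (\<bar>norm y powr (1 + \<alpha>)\<bar> * weight \<sigma>\<^sub>0 \<phi> y))"
      proof (rule AE_I2)
        fix y :: "real^'n"
        have vp: "0 < 1 + v y powr ?q" by (rule add_pos_nonneg) auto
        have "1 \<le> (1 + B powr ?q) * weight \<sigma>\<^sub>0 \<phi> y" if "norm y \<le> 1"
        proof -
          have "v y powr ?q \<le> B powr ?q"
            using B[of y] that excess_nonneg[of y] \<sigma> by (intro powr_mono2) auto
          then show ?thesis using vp by (simp add: weight_def)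
        qed
        then have "norm y powr (1 + \<alpha>) * 1 \<le> norm y powr (1 + \<alpha>) * ((1 + B powr ?q) * weight \<sigma>\<^sub>0 \<phi> y)" if "norm y \<le> 1"
          using that by (intro mult_left_mono) auto
        moreover have "0 \<le> weight \<sigma>\<^sub>0 \<phi> y" using vp by (simp add: weight_def)
        ultimately show "norm (S y) \<le> norm ((1 + B powr ?q) * (\<bar>norm y powr (1 + \<alpha>)\<bar> * weight \<sigma>\<^sub>0 \<phi> y))"
          using bpos by (auto simp: S_def abs_mult mult_ac)
      qed
    qed
  qed
  have growth0: "\<bar>u k z\<bar> \<le> (1 + norm z powr a) + S z" if "z \<noteq> 0" for k z
  proof (cases "norm z \<le> 1")
    case True
    have "0 \<le> norm z powr a" by simp
    with ubd[OF that, of k] True show ?thesis unfolding S_def by (simp, linarith)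
  next
    case False
    then have "norm z powr (1 + \<alpha>) \<le> norm z powr a" by (intro powr_mono) (auto simp: a_def)
    moreover have "S z = 0" using False by (simp add: S_def)
    ultimately show ?thesis using ubd[OF that, of k] by linarith
  qed
  have u'c: "continuous_on (closure \<Omega>) u'"
    using uniform_limit_theorem[OF _ ulim] uc by (auto intro: always_eventually)
  show ?thesis
    unfolding viscosity_subsolution_def
  proof (intro conjI allI impI)
    show "usc_on (closure \<Omega>) u'" by (rule continuous_on_imp_usc_on[OF u'c])
  next
    fix x0 N p
    assume x0: "x0 \<in> \<Omega>" "x0 \<in> N" and N: "open N" "N \<subseteq> \<Omega>" and C2: "C2_closure N p"
      and touch: "p x0 = u' x0" and above: "\<forall>y\<in>N - {x0}. p y > u' y"
    let ?K = "nonlocal_kernel \<sigma> (quadratic_part \<phi>) b'"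
    have clN: "closure N \<subseteq> closure \<Omega>" using N(2) by (rule closure_mono)
    have bN: "bounded N" using \<Omega>(2) N(2) by (rule bounded_subset)
    have cN: "compact (closure N)" using bN by (simp add: compact_closure)
    have x0cl: "x0 \<in> closure N" using x0(2) closure_subset by blast
    have pc: "continuous_on (closure N) p" using C2 by (simp add: C2_closure_def)
    have p_ge: "u' z \<le> p z" if "z \<in> closure N" for z
    proof -
      have "continuous_on (closure N) (\<lambda>z. p z - u' z)"
        by (intro continuous_intros pc continuous_on_subset[OF u'c clN])
      then have "0 \<le> p z - u' z"
        using that by (rule continuous_ge_on_closure) (use above touch in \<open>force simp: less_imp_le\<close>)
      then show ?thesis by simp
    qed
    have "nonlocal_defined ?K (patch N (\<lambda>z. p z + \<theta> * (norm (z - x0))\<^sup>2) u') x0 \<and>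
        f' x0 \<le> nonlocal ?K (patch N (\<lambda>z. p z + \<theta> * (norm (z - x0))\<^sup>2) u') x0" if "0 < \<theta>" for \<theta>
    proof -
      define \<eta> where "\<eta> = \<theta> / 2"
      have \<eta>: "0 < \<eta>" "\<theta> = 2 * \<eta>" using that by (auto simp: \<eta>_def)
      define P where "P z = p z + \<eta> * (norm (z - x0))\<^sup>2" for z
      have Pc: "continuous_on (closure N) P"
        unfolding P_def by (intro continuous_intros pc)
      have "\<exists>z\<in>closure N. \<forall>w\<in>closure N. P z - u k z \<le> P w - u k w" for k
        using cN x0cl by (intro continuous_attains_inf continuous_intros Pc continuous_on_subset[OF uc clN]) auto
      then obtain m where m: "\<And>k. m k \<in> closure N" "\<And>k w. w \<in> closure N \<Longrightarrow> P (m k) - u k (m k) \<le> P w - u k w"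
        by metis
      have m_lim: "m \<longlonglongrightarrow> x0"
      proof -
        have "(\<lambda>k. (norm (m k - x0))\<^sup>2) \<longlonglongrightarrow> 0"
        proof (rule tendstoI)
          fix e :: real assume e: "0 < e"
          then have "0 < \<eta> * e / 3" using \<eta> by simp
          from uniform_limitD[OF ulim this]
          show "\<forall>\<^sub>F k in sequentially. dist ((norm (m k - x0))\<^sup>2) 0 < e"
          proof eventually_elim
            case (elim k)
            have "\<bar>u k (m k) - u' (m k)\<bar> < \<eta> * e / 3" "\<bar>u k x0 - u' x0\<bar> < \<eta> * e / 3"
              using elim m(1)[of k] x0cl clN by (auto simp: dist_real_def)
            moreover have "u' (m k) \<le> p (m k)" by (rule p_ge[OF m(1)])
            moreover have "P (m k) - u k (m k) \<le> P x0 - u k x0" by (rule m(2)[OF x0cl])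
            moreover have "P x0 = u' x0" "P (m k) = p (m k) + \<eta> * (norm (m k - x0))\<^sup>2"
              by (simp_all add: P_def touch)
            moreover have "0 < \<eta> * e" using e \<eta> by simp
            ultimately have "\<eta> * (norm (m k - x0))\<^sup>2 < \<eta> * e" by linarith
            then show ?case using \<eta> by simp
          qed
        qed
        then have "(\<lambda>k. sqrt ((norm (m k - x0))\<^sup>2)) \<longlonglongrightarrow> sqrt 0" by (rule tendsto_real_sqrt)
        then show ?thesis by (simp add: tendsto_norm_zero_iff LIM_zero_iff)
      qed
      obtain \<rho>0 where \<rho>0: "0 < \<rho>0" "cball x0 \<rho>0 \<subseteq> N" using N(1) x0(2) open_contains_cball by blast
      define \<rho> where "\<rho> = \<rho>0 / 2"
      have \<rho>: "0 < \<rho>" "ball x0 (2 * \<rho>) \<subseteq> N" "cball x0 (2 * \<rho>) \<subseteq> N"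
        using \<rho>0 by (auto simp: \<rho>_def)
      have "\<forall>\<^sub>F k in sequentially. dist (m k) x0 < \<rho>" using m_lim \<rho>(1) by (rule tendstoD)
      then obtain k0 where k0: "\<And>k. k0 \<le> k \<Longrightarrow> dist (m k) x0 < \<rho>" by (auto simp: eventually_sequentially)
      \<comment> \<open>Indices are shifted by \<open>k0\<close> so that all contact points lie in \<open>N\<close>.\<close>
      define x where "x k = m (k + k0)" for k
      have x_ball: "x k \<in> ball x0 \<rho>" for k using k0[of "k + k0"] by (simp add: x_def dist_commute)
      have xN: "x k \<in> N" for k using x_ball[of k] \<rho> by (auto simp: subset_iff dist_commute)
      have x\<Omega>: "x k \<in> \<Omega>" for k using xN N(2) by blast
      have xlim: "x \<longlonglongrightarrow> x0" unfolding x_def by (rule LIMSEQ_ignore_initial_segment[OF m_lim])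
      have ux: "(\<lambda>k. u (k + k0) (x k)) \<longlonglongrightarrow> u' x0"
        unfolding x_def
        by (rule LIMSEQ_ignore_initial_segment, rule uniform_limit_along_sequence[OF ulim u'c _ m_lim])
           (use m(1) clN x0cl in auto)
      have Px: "(\<lambda>k. P (x k)) \<longlonglongrightarrow> P x0"
        using Pc xlim x0cl xN closure_subset[of N] by (auto simp: continuous_on_sequentially o_def)
      \<comment> \<open>The constant that makes the test function touch \<open>u (k + k0)\<close> at \<open>x k\<close>.\<close>
      define c where "c k = u (k + k0) (x k) - P (x k)" for k
      have clim: "c \<longlonglongrightarrow> 0"
        using tendsto_diff[OF ux Px] by (simp add: c_def[abs_def] P_def touch)
      define pk where "pk k z = P z + \<eta> * (norm (z - x k))\<^sup>2 + c k" for k z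
      have C2pk: "C2_closure N (pk k)" for k
        using C2_closure_add_quadratic[OF C2_closure_add_quadratic[OF C2, of \<eta> x0 0], of \<eta> "x k" "c k"]
        by (simp add: pk_def[abs_def] P_def)
      have pkx: "pk k (x k) = u (k + k0) (x k)" for k by (simp add: pk_def c_def)
      have pk_above: "u (k + k0) z < pk k z" if "z \<in> N" "z \<noteq> x k" for k z
      proof -
        have "0 < \<eta> * (norm (z - x k))\<^sup>2" using \<eta> that by simp
        moreover have "P (x k) - u (k + k0) (x k) \<le> P z - u (k + k0) z"
          unfolding x_def using that closure_subset[of N] by (intro m(2)) auto
        ultimately show ?thesis by (simp add: pk_def c_def)
      qed
      define T where "T k = patch N (pk k) (u (k + k0))" for k
      define T' where "T' = patch N (\<lambda>z. p z + \<theta> * (norm (z - x0))\<^sup>2) u'"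
      have visc: "nonlocal_defined (nonlocal_kernel \<sigma> (rescale \<phi> (l (k + k0))) (b (k + k0))) (T k) (x k) \<and>
        f (k + k0) (x k) \<le> nonlocal (nonlocal_kernel \<sigma> (rescale \<phi> (l (k + k0))) (b (k + k0))) (T k) (x k)" for k
        unfolding T_def
        by (rule sub[of "k + k0", unfolded viscosity_subsolution_def, THEN conjunct2, rule_format,
              OF x\<Omega> N(1) xN N(2) C2pk pkx]) (use pk_above in auto)
      have "\<exists>s. strict_mono s \<and>
        integrable lebesgue (\<lambda>y. second_difference T' x0 y * (b' x0 y / quadratic_part \<phi> y powr ((real CARD('n) + \<sigma>) / 2))) \<and>
        (\<lambda>k. \<integral>y. second_difference (T (s k)) (x (s k)) y * (b (s k + k0) (x (s k)) y
              / excess (rescale \<phi> (l (s k + k0))) y powr ((real CARD('n) + \<sigma>) / 2)) \<partial>lebesgue)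
          \<longlonglongrightarrow> (\<integral>y. second_difference T' x0 y * (b' x0 y / quadratic_part \<phi> y powr ((real CARD('n) + \<sigma>) / 2)) \<partial>lebesgue)"
      proof -
        obtain RN where RN: "\<And>z. z \<in> closure N \<Longrightarrow> norm z \<le> RN"
          using compact_imp_bounded[OF cN] by (auto simp: bounded_iff)
        obtain BP where BP: "\<And>z. z \<in> closure N \<Longrightarrow> \<bar>P z\<bar> \<le> BP"
          using compact_imp_bounded[OF compact_continuous_image[OF Pc cN]] by (auto simp: bounded_iff)
        obtain Bc where Bc: "\<And>k. \<bar>c k\<bar> \<le> Bc"
          using convergent_imp_Bseq[of c] clim by (metis Bseq_def convergentI real_norm_def)
        \<comment> \<open>\<open>D\<close> bounds the test functions on \<open>N\<close>; the summand \<open>1\<close> is for the solutions outside \<open>N\<close>.\<close>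
        define D where "D = 1 + BP + \<eta> * (2 * RN)\<^sup>2 + Bc"
        have pk_le: "\<bar>pk k z\<bar> \<le> BP + \<eta> * (2 * RN)\<^sup>2 + Bc" if "z \<in> N" for k z
        proof -
          have z: "z \<in> closure N" "x k \<in> closure N" using that xN closure_subset by blast+
          have "norm (z - x k) \<le> 2 * RN"
            using norm_triangle_ineq4[of z "x k"] RN[OF z(1)] RN[OF z(2)] by linarith
          then have "\<eta> * (norm (z - x k))\<^sup>2 \<le> \<eta> * (2 * RN)\<^sup>2"
            using \<eta> by (intro mult_left_mono power_mono) auto
          moreover have "0 \<le> \<eta> * (norm (z - x k))\<^sup>2" using \<eta> by simp
          ultimately show ?thesis using BP[OF z(1)] Bc[of k] unfolding pk_def by linarith
        qed
        have Dnn: "0 \<le> BP + \<eta> * (2 * RN)\<^sup>2 + Bc" using pk_le[OF x0(2), of 0] by linarith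
        obtain g A where gA: "continuous_on (closure N) A"
          "\<And>x. x \<in> N \<Longrightarrow> (p has_derivative (\<lambda>h. g x \<bullet> h)) (at x)"
          "\<And>x. x \<in> N \<Longrightarrow> (g has_derivative (\<lambda>h. A x *v h)) (at x)"
          using C2 unfolding C2_closure_def by blast
        obtain BA where BA: "\<And>z. z \<in> closure N \<Longrightarrow> norm (A z) \<le> BA"
          using compact_imp_bounded[OF compact_continuous_image[OF gA(1) cN]] by (auto simp: bounded_iff)
        have BA0: "0 \<le> BA" using BA[OF x0cl] norm_ge_zero[of "A x0"] by linarith
        show ?thesis
        proof (rule operator_limit[where s = \<sigma>\<^sub>0 and a = a and D = D and S = S and \<rho> = \<rho> and M = "2 * BA + 4 * \<eta>"
              and \<Lambda> = \<Lambda> and l = "\<lambda>k. l (k + k0)" and T = T and \<beta> = "\<lambda>k. b (k + k0) (x k)"])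
          show "0 < \<sigma>\<^sub>0" "\<sigma>\<^sub>0 \<le> \<sigma>" "1 < \<sigma>" "\<sigma> < 2" using \<sigma> by auto
          show "0 < l (k + k0) \<and> l (k + k0) \<le> 1" for k by (rule l(1))
          show "(\<lambda>k. l (k + k0)) \<longlonglongrightarrow> 0" by (rule LIMSEQ_ignore_initial_segment[OF l(2)])
          show "T k \<in> borel_measurable lebesgue" for k
            unfolding T_def using C2pk[of k] closure_subset[of N]
            by (intro measurable_patch N um) (auto simp: C2_closure_def intro: continuous_on_subset)
          show "AE z in lebesgue. (\<lambda>k. T k z) \<longlonglongrightarrow> T' z"
            using uae
          proof eventually_elim
            case (elim z)
            have "(\<lambda>k. pk k z) \<longlonglongrightarrow> P z + \<eta> * (norm (z - x0))\<^sup>2 + 0"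
              unfolding pk_def by (intro tendsto_intros xlim clim)
            moreover have "P z + \<eta> * (norm (z - x0))\<^sup>2 + 0 = p z + \<theta> * (norm (z - x0))\<^sup>2"
              by (simp add: P_def \<eta>(2))
            ultimately show ?case
              using LIMSEQ_ignore_initial_segment[OF elim, of k0] by (simp add: T_def T'_def patch_def)
          qed
          show "(\<lambda>k. T k (x k)) \<longlonglongrightarrow> T' x0"
            using ux xN x0(2) by (simp add: T_def T'_def patch_def pkx touch)
          show "AE z in lebesgue. \<bar>T k z\<bar> \<le> D * (1 + norm z powr a) + S z" for k
            using AE_completion[OF AE_lborel_singleton[of "0 :: real^'n"]]
          proof eventually_elim
            case (elim z)
            have one: "1 \<le> 1 + norm z powr a" by simp
            have D1: "1 \<le> D" using Dnn by (simp add: D_def)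
            show ?case
            proof (cases "z \<in> N")
              case True
              have "\<bar>T k z\<bar> \<le> D" using pk_le[OF True, of k] True by (simp add: T_def patch_def D_def)
              moreover have "D * 1 \<le> D * (1 + norm z powr a)" using D1 one by (intro mult_left_mono) auto
              ultimately show ?thesis using S0[of z] by linarith
            next
              case False
              have T_le: "\<bar>T k z\<bar> \<le> (1 + norm z powr a) + S z"
                using growth0[OF elim] False by (simp add: T_def patch_def)
              have "0 \<le> 1 + norm z powr a" by simp
              from mult_right_mono[OF D1 this] have "1 + norm z powr a \<le> D * (1 + norm z powr a)"
                by (simp only: mult_1_left)
              from order_trans[OF T_le add_right_mono[OF this]] show ?thesis .
            qed
          qed
          show "0 \<le> D" using Dnn by (simp add: D_def)
          show "0 < \<rho>" by (rule \<rho>(1))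
          show "0 \<le> 2 * BA + 4 * \<eta>" using BA0 \<eta> by simp
          show "\<bar>second_difference (T k) (x k) y\<bar> \<le> (2 * BA + 4 * \<eta>) * (norm y)\<^sup>2" if y: "norm y \<le> \<rho>" for k y
          proof -
            have inN: "x k + y \<in> N" "x k - y \<in> N"
            proof -
              have "norm (x k - x0) < \<rho>" using x_ball[of k] by (simp add: dist_norm norm_minus_commute)
              moreover have "dist (x k + y) x0 \<le> norm (x k - x0) + norm y"
                using norm_triangle_ineq[of "x k - x0" y] by (simp add: dist_norm algebra_simps)
              moreover have "dist (x k - y) x0 \<le> norm (x k - x0) + norm y"
                using norm_triangle_ineq4[of "x k - x0" y] by (simp add: dist_norm algebra_simps)
              ultimately have "dist (x k + y) x0 < 2 * \<rho>" "dist (x k - y) x0 < 2 * \<rho>"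
                using y by linarith+
              then show "x k + y \<in> N" "x k - y \<in> N" using \<rho>(2) by (auto simp: dist_commute)
            qed
            \<comment> \<open>A paraboloid has second difference \<open>2 |y|\<^sup>2\<close> at every point, whatever its centre.\<close>
            have quad: "(norm (z + y - w))\<^sup>2 + (norm (z - y - w))\<^sup>2 - 2 * (norm (z - w))\<^sup>2 = 2 * (norm y)\<^sup>2" for z w
              unfolding power2_norm_eq_inner by (simp add: algebra_simps inner_commute)
            have "second_difference (T k) (x k) y = pk k (x k + y) + pk k (x k - y) - 2 * pk k (x k)"
              using inN xN[of k] by (simp add: second_difference_def T_def patch_def)
            also have "\<dots> = second_difference p (x k) y
                + \<eta> * ((norm (x k + y - x0))\<^sup>2 + (norm (x k - y - x0))\<^sup>2 - 2 * (norm (x k - x0))\<^sup>2)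
                + \<eta> * ((norm (x k + y - x k))\<^sup>2 + (norm (x k - y - x k))\<^sup>2 - 2 * (norm (x k - x k))\<^sup>2)"
              by (simp add: second_difference_def pk_def P_def algebra_simps)
            also have "\<dots> = second_difference p (x k) y + 4 * \<eta> * (norm y)\<^sup>2"
              unfolding quad by simp
            finally have eq: "second_difference (T k) (x k) y = second_difference p (x k) y + 4 * \<eta> * (norm y)\<^sup>2" .
            have "\<bar>second_difference p (x k) y\<bar> \<le> 2 * BA * (norm y)\<^sup>2"
            proof (rule second_difference_C2_bound[OF _ _ _ x_ball y])
              fix z assume "z \<in> ball x0 (2 * \<rho>)"
              then have z: "z \<in> N" "z \<in> closure N" using \<rho>(2) closure_subset[of N] by auto
              show "(p has_derivative (\<lambda>h. g z \<bullet> h)) (at z)" by (rule gA(2)[OF z(1)])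
              show "(g has_derivative (\<lambda>h. A z *v h)) (at z)" by (rule gA(3)[OF z(1)])
              show "norm (A z) \<le> BA" by (rule BA[OF z(2)])
            qed
            moreover have "0 \<le> 4 * \<eta> * (norm y)\<^sup>2" using \<eta> by simp
            ultimately show ?thesis unfolding eq distrib_right by linarith
          qed
          show "\<bar>b (k + k0) (x k) y\<bar> \<le> \<Lambda>" for k y by (rule b[OF x\<Omega>])
          show "AE y in lebesgue. (\<lambda>k. b (k + k0) (x k) y) \<longlonglongrightarrow> b' x0 y"
            using bcont[OF x0(1)]
          proof eventually_elim
            case (elim y)
            have "(\<lambda>k. b (k + k0) (x k) y - b' (x k) y) \<longlonglongrightarrow> 0"
            proof (rule tendstoI)
              fix e :: real assume "0 < e"
              from uniform_limitD[OF blim this] obtain K where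
                K: "\<And>k z. K \<le> k \<Longrightarrow> z \<in> \<Omega> \<Longrightarrow> dist (b k z y) (b' z y) < e"
                by (auto simp: eventually_sequentially)
              show "\<forall>\<^sub>F k in sequentially. dist (b (k + k0) (x k) y - b' (x k) y) 0 < e"
                unfolding eventually_sequentially
                by (rule exI[of _ K]) (use K x\<Omega> in \<open>auto simp: dist_real_def\<close>)
            qed
            moreover have "(\<lambda>k. b' (x k) y) \<longlonglongrightarrow> b' x0 y"
              using elim xlim by (rule isCont_tendsto_compose)
            ultimately have "(\<lambda>k. (b (k + k0) (x k) y - b' (x k) y) + b' (x k) y) \<longlonglongrightarrow> 0 + b' x0 y"
              by (rule tendsto_add)
            then show ?case by simp
          qed
          show "integrable lebesgue (\<lambda>y. second_difference (T k) (x k) y *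
              (b (k + k0) (x k) y / excess (rescale \<phi> (l (k + k0))) y powr ((real CARD('n) + \<sigma>) / 2)))" for k
            using visc[of k] by (simp add: nonlocal_defined_def nonlocal_kernel_def)
        qed (use a wa iS S0 xlim in auto)
      qed
      then obtain s where s: "strict_mono s" "nonlocal_defined ?K T' x0"
        "(\<lambda>k. nonlocal (nonlocal_kernel \<sigma> (rescale \<phi> (l (s k + k0))) (b (s k + k0))) (T (s k)) (x (s k))) \<longlonglongrightarrow> nonlocal ?K T' x0"
        by (auto simp: nonlocal_def nonlocal_defined_def nonlocal_kernel_def excess_quadratic_part)
      have flim': "(\<lambda>k. f (k + k0) (x k)) \<longlonglongrightarrow> f' x0"
      proof -
        have sub\<Omega>: "cball x0 \<rho> \<subseteq> \<Omega>" using \<rho> N(2) by (auto simp: subset_iff)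
        then have U: "uniform_limit (cball x0 \<rho>) f f' sequentially" by (intro flim) auto
        have "continuous_on (cball x0 \<rho>) f'"
          using uniform_limit_theorem[OF _ U] continuous_on_subset[OF fc sub\<Omega>] by (auto intro: always_eventually)
        moreover have "uniform_limit (cball x0 \<rho>) (\<lambda>k. f (k + k0)) f' sequentially"
          using filterlim_compose[OF U filterlim_add_const_nat_at_top[of k0]] by simp
        ultimately show ?thesis
          using x_ball xlim \<rho>(1) by (intro uniform_limit_along_sequence[where S = "cball x0 \<rho>"]) (auto simp: less_imp_le)
      qed
      have "f' x0 \<le> nonlocal ?K T' x0"
        by (rule LIMSEQ_le[OF LIMSEQ_subseq_LIMSEQ[OF flim' s(1), unfolded o_def] s(3)]) (use visc in auto)
      with s(2) show ?thesis by (simp add: T'_def)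
    qed
    from test_function_perturbation_limit[OF this x0(2)]
    show "nonlocal_defined ?K (patch N p u') x0" "f' x0 \<le> nonlocal ?K (patch N p u') x0" by auto
  qed
qed

end

lemma second_difference_minus: "second_difference (\<lambda>x. - w x) x y = - second_difference w x y"
  by (simp add: second_difference_def)

lemma nonlocal_defined_minus: "nonlocal_defined K (\<lambda>x. - w x) x \<longleftrightarrow> nonlocal_defined K w x"
  by (simp add: nonlocal_defined_def second_difference_minus)

lemma nonlocal_minus: "nonlocal K (\<lambda>x. - w x) x = - nonlocal K w x"
  by (simp add: nonlocal_def second_difference_minus)

lemma patch_minus: "patch N (\<lambda>x. - p x) u = (\<lambda>x. - patch N p (\<lambda>x. - u x) x)"
  by (auto simp: patch_def)

lemma C2_closure_minus:
  fixes p :: "real^'n \<Rightarrow> real"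
  assumes "C2_closure N p" shows "C2_closure N (\<lambda>x. - p x)"
proof -
  obtain G H where *: "continuous_on (closure N) p" "continuous_on (closure N) G" "continuous_on (closure N) H"
    "\<And>x. x \<in> N \<Longrightarrow> (p has_derivative (\<lambda>h. G x \<bullet> h)) (at x)" "\<And>x. x \<in> N \<Longrightarrow> (G has_derivative (\<lambda>h. H x *v h)) (at x)"
    using assms unfolding C2_closure_def by blast
  have minus_mv: "(- A) *v h = - (A *v h)" for A :: "real^'n^'n" and h
    by (simp add: vec_eq_iff matrix_vector_mult_def sum_negf)
  have d: "((\<lambda>x. - p x) has_derivative (\<lambda>h. (- G x) \<bullet> h)) (at x)"
    "((\<lambda>x. - G x) has_derivative (\<lambda>h. (- H x) *v h)) (at x)" if "x \<in> N" for x
    using has_derivative_minus[OF *(4)[OF that]] has_derivative_minus[OF *(5)[OF that]]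
    by (simp_all only: inner_minus_left minus_mv)
  show ?thesis
    unfolding C2_closure_def
    by (intro conjI exI[of _ "\<lambda>x. - G x"] exI[of _ "\<lambda>x. - H x"] ballI d continuous_on_minus *(1-3))
qed

lemma lsc_on_iff_usc_on_minus: "lsc_on S u \<longleftrightarrow> usc_on S (\<lambda>x. - u x)"
proof
  assume L: "lsc_on S u"
  show "usc_on S (\<lambda>x. - u x)"
    unfolding usc_on_def
  proof (intro ballI allI impI)
    fix x a assume "x \<in> S" "- u x < a"
    then have "\<forall>\<^sub>F y in at x within S. - a < u y"
      by (intro L[unfolded lsc_on_def, rule_format]) auto
    then show "\<forall>\<^sub>F y in at x within S. - u y < a" by eventually_elim simp
  qed
next
  assume U: "usc_on S (\<lambda>x. - u x)"
  show "lsc_on S u"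
    unfolding lsc_on_def
  proof (intro ballI allI impI)
    fix x a assume "x \<in> S" "a < u x"
    then have "\<forall>\<^sub>F y in at x within S. - u y < - a"
      by (intro U[unfolded usc_on_def, rule_format]) auto
    then show "\<forall>\<^sub>F y in at x within S. a < u y" by eventually_elim simp
  qed
qed

text \<open>Reduces statements on supersolutions to subsolutions, since the operator is linear in its argument.\<close>

lemma viscosity_supersolution_iff_minus:
  "viscosity_supersolution \<Omega> K f u \<longleftrightarrow> viscosity_subsolution \<Omega> K (\<lambda>x. - f x) (\<lambda>x. - u x)"
proof
  assume super: "viscosity_supersolution \<Omega> K f u"
  show "viscosity_subsolution \<Omega> K (\<lambda>x. - f x) (\<lambda>x. - u x)"
    unfolding viscosity_subsolution_def
  proof (intro conjI[OF _ allI[OF allI[OF allI]]] impI)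
    show "usc_on (closure \<Omega>) (\<lambda>x. - u x)"
      using super by (simp add: viscosity_supersolution_def lsc_on_iff_usc_on_minus)
    fix x0 N p
    assume *: "x0 \<in> \<Omega>" "open N" "x0 \<in> N" "N \<subseteq> \<Omega>" "C2_closure N p" "p x0 = - u x0" "\<forall>y\<in>N - {x0}. p y > - u y"
    have "nonlocal_defined K (patch N (\<lambda>x. - p x) u) x0 \<and> nonlocal K (patch N (\<lambda>x. - p x) u) x0 \<le> f x0"
    proof (rule super[unfolded viscosity_supersolution_def, THEN conjunct2, rule_format,
          OF *(1-4) C2_closure_minus[OF *(5)]])
      show "- p y < u y" if "y \<in> N - {x0}" for y using *(7)[rule_format, OF that] by simp
    qed (simp add: *(6))
    then show "nonlocal_defined K (patch N p (\<lambda>x. - u x)) x0 \<and> - f x0 \<le> nonlocal K (patch N p (\<lambda>x. - u x)) x0"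
      unfolding patch_minus nonlocal_defined_minus nonlocal_minus by (simp add: minus_le_iff)
  qed
next
  assume sub: "viscosity_subsolution \<Omega> K (\<lambda>x. - f x) (\<lambda>x. - u x)"
  show "viscosity_supersolution \<Omega> K f u"
    unfolding viscosity_supersolution_def
  proof (intro conjI[OF _ allI[OF allI[OF allI]]] impI)
    show "lsc_on (closure \<Omega>) u"
      using sub by (simp add: viscosity_subsolution_def lsc_on_iff_usc_on_minus)
    fix x0 N p
    assume *: "x0 \<in> \<Omega>" "open N" "x0 \<in> N" "N \<subseteq> \<Omega>" "C2_closure N p" "p x0 = u x0" "\<forall>y\<in>N - {x0}. p y < u y"
    have "nonlocal_defined K (patch N (\<lambda>x. - p x) (\<lambda>x. - u x)) x0 \<and> - f x0 \<le> nonlocal K (patch N (\<lambda>x. - p x) (\<lambda>x. - u x)) x0"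
    proof (rule sub[unfolded viscosity_subsolution_def, THEN conjunct2, rule_format,
          OF *(1-4) C2_closure_minus[OF *(5)]])
      show "- u y < - p y" if "y \<in> N - {x0}" for y using *(7)[rule_format, OF that] by simp
    qed (simp add: *(6))
    then show "nonlocal_defined K (patch N p u) x0 \<and> nonlocal K (patch N p u) x0 \<le> f x0"
      unfolding patch_minus nonlocal_defined_minus nonlocal_minus minus_minus by simp
  qed
qed

theorem lemma3:
  fixes \<sigma>\<^sub>0 \<sigma> \<gamma> \<Gamma> \<Lambda> \<alpha>\<^sub>1 :: real
    and \<Omega> :: "(real^'n) set"
    and \<phi> :: "real^'n \<Rightarrow> real"
    and \<zeta> :: "real^'n \<Rightarrow> real"
    and l :: "nat \<Rightarrow> real"
    and u :: "nat \<Rightarrow> real^'n \<Rightarrow> real" and u_lim :: "real^'n \<Rightarrow> real"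
    and f :: "nat \<Rightarrow> real^'n \<Rightarrow> real" and f_lim :: "real^'n \<Rightarrow> real"
    and b :: "nat \<Rightarrow> real^'n \<Rightarrow> real^'n \<Rightarrow> real" and b_lim :: "real^'n \<Rightarrow> real^'n \<Rightarrow> real"
  assumes "1 < \<sigma>\<^sub>0" and "\<sigma>\<^sub>0 \<le> \<sigma>" and "\<sigma> < 2"
    and "open \<Omega>" and "bounded \<Omega>"
    and "C2_closure UNIV \<phi>" and "convex_on UNIV \<phi>"
    and "0 < \<gamma>" and "\<gamma> \<le> \<Gamma>"
    and "\<And>y. \<gamma> \<le> det (hessian \<phi> y) \<and> det (hessian \<phi> y) \<le> \<Gamma>"
    and "\<zeta> = (\<lambda>y. norm y powr (1 + \<alpha>\<^sub>1))"
    and "\<alpha>\<^sub>1 < \<sigma>\<^sub>0 - 1"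
    and "weighted_L1 \<sigma>\<^sub>0 \<phi> \<zeta>"
    and "1 \<le> \<Lambda>"
    and "\<And>k. 0 < l k \<and> l k \<le> 1"
    and "\<And>k. continuous_on (closure \<Omega>) (u k)"
    and "\<And>k. weighted_L1 \<sigma>\<^sub>0 (rescale \<phi> (l k)) (u k)"
    and "\<And>k. continuous_on \<Omega> (f k)" and "\<And>k. bounded (f k ` \<Omega>)"
    and "\<And>k. (\<lambda>(x, y). b k x y) \<in> borel_measurable (lebesgue_on (\<Omega> \<times> UNIV))"
    and "\<And>k x y. x \<in> \<Omega> \<Longrightarrow> 1 / \<Lambda> \<le> b k x y \<and> b k x y \<le> \<Lambda>"
    and "\<And>k. viscosity_solution \<Omega> (nonlocal_kernel \<sigma> (rescale \<phi> (l k)) (b k)) (f k) (u k)"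
    and "uniform_limit (closure \<Omega>) u u_lim sequentially"
    and "AE x in lebesgue. (\<lambda>k. u k x) \<longlonglongrightarrow> u_lim x"
    \<comment> \<open>The guard excludes only the origin when \<open>1 + \<alpha>\<^sub>1 \<le> 0\<close>, where \<open>0 powr (1 + \<alpha>\<^sub>1) = 0\<close> in HOL
        is not the intended value of \<open>\<zeta>\<close>.\<close>
    and "\<And>k x. x \<noteq> 0 \<or> 0 < 1 + \<alpha>\<^sub>1 \<Longrightarrow> \<bar>u k x\<bar> \<le> 1 + \<zeta> x"
    and "l \<longlonglongrightarrow> 0"
    and "\<And>C. compact C \<Longrightarrow> C \<subseteq> \<Omega> \<Longrightarrow> uniform_limit C f f_lim sequentially"
    and "uniform_limit (\<Omega> \<times> UNIV) (\<lambda>k (x, y). b k x y) (\<lambda>(x, y). b_lim x y) sequentially"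
    \<comment> \<open>The limit operator depends continuously on the base point, as viscosity theory presupposes.
        For coefficients merely measurable in \<open>x\<close> the conclusion fails.\<close>
    and "\<And>x. x \<in> \<Omega> \<Longrightarrow> AE y in lebesgue. isCont (\<lambda>x'. b_lim x' y) x"
  shows "viscosity_solution \<Omega> (nonlocal_kernel \<sigma> (quadratic_part \<phi>) b_lim) f_lim u_lim"
proof -
  interpret convex_potential \<phi> \<gamma>
    using assms(6,7,8,10) by unfold_locales auto
  let ?K = "nonlocal_kernel \<sigma> (quadratic_part \<phi>) b_lim"
  let ?Kk = "\<lambda>k. nonlocal_kernel \<sigma> (rescale \<phi> (l k)) (b k)"
  have bound: "\<bar>b k x y\<bar> \<le> \<Lambda>" if "x \<in> \<Omega>" for k x y
  proof -
    have "0 \<le> 1 / \<Lambda>" using assms(14) by simp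
    then show ?thesis using assms(21)[OF that, of k y] by linarith
  qed
  have meas: "u k \<in> borel_measurable lebesgue" for k
    using assms(17)[of k] by (simp add: weighted_L1_def)
  have zeta: "weighted_L1 \<sigma>\<^sub>0 \<phi> (\<lambda>y. norm y powr (1 + \<alpha>\<^sub>1))" using assms(11,13) by simp
  have growth: "\<bar>u k x\<bar> \<le> 1 + norm x powr (1 + \<alpha>\<^sub>1)" if "x \<noteq> 0" for k x
    using assms(25)[of x k] that by (simp add: assms(11))
  have sub: "viscosity_subsolution \<Omega> (?Kk k) (f k) (u k)"
    and super: "viscosity_subsolution \<Omega> (?Kk k) (\<lambda>x. - f k x) (\<lambda>x. - u k x)" for k
    using assms(22)[of k] by (auto simp: viscosity_solution_def viscosity_supersolution_iff_minus)
  have "viscosity_subsolution \<Omega> ?K f_lim u_lim"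
    by (rule viscosity_subsolution_limit[OF assms(1,2,3,4,5,12) zeta assms(15,26,16) meas bound sub
          assms(23,24) growth assms(18,27,28,29)])
  moreover have "viscosity_subsolution \<Omega> ?K (\<lambda>x. - f_lim x) (\<lambda>x. - u_lim x)"
  proof (rule viscosity_subsolution_limit[where u = "\<lambda>k x. - u k x" and f = "\<lambda>k x. - f k x",
        OF assms(1,2,3,4,5,12) zeta assms(15,26) _ _ bound super])
    show "continuous_on (closure \<Omega>) (\<lambda>x. - u k x)" "continuous_on \<Omega> (\<lambda>x. - f k x)" for k
      by (intro continuous_intros assms(16,18))+
    show "(\<lambda>x. - u k x) \<in> borel_measurable lebesgue" for k using meas by simp
    show "uniform_limit (closure \<Omega>) (\<lambda>k x. - u k x) (\<lambda>x. - u_lim x) sequentially"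
      by (intro uniform_limit_intros assms(23))
    show "AE x in lebesgue. (\<lambda>k. - u k x) \<longlonglongrightarrow> - u_lim x"
      using assms(24) by eventually_elim (rule tendsto_minus)
    show "\<bar>- u k x\<bar> \<le> 1 + norm x powr (1 + \<alpha>\<^sub>1)" if "x \<noteq> 0" for k x using growth[OF that] by simp
    show "uniform_limit C (\<lambda>k x. - f k x) (\<lambda>x. - f_lim x) sequentially" if "compact C" "C \<subseteq> \<Omega>" for C
      by (intro uniform_limit_intros assms(27) that)
    show "uniform_limit (\<Omega> \<times> UNIV) (\<lambda>k (x, y). b k x y) (\<lambda>(x, y). b_lim x y) sequentially" by (rule assms(28))
    show "AE y in lebesgue. isCont (\<lambda>x'. b_lim x' y) x" if "x \<in> \<Omega>" for x by (rule assms(29)[OF that])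
  qed
  ultimately show ?thesis
    by (simp add: viscosity_solution_def viscosity_supersolution_iff_minus)
qed

end
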